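(* Let $m$ be a multiplier of the type described in the context and let $K(t,u)=\int_{\mathbb{R}^2}m(x,y)e^{itx+iuy}\,dx\,dy$. Suppose $1<p\le\infty$ is such that for each $(x_0,y_0)$ in the support of $m$, the associated function $g(x,y)=\chi_E(x,y)\prod_{i=1}^n|f_i(x,y)|^{\gamma_i}$ is in $L^p(N)$ for some neighborhood $N$ of the origin. Let $p'$ be the exponent with $\frac1p+\frac1{p'}=1$. Then there is a constant $C$ depending on $m$ and $p$ such that for all $(t,u)\in\mathbb{R}^2$ $$|K(t,u)|\le C(2+|(t,u)|)^{-\frac1{p'}}\quad\text{if }p<\infty,$$ $$|K(t,u)|\le C(2+|(t,u)|)^{-1}\ln(2+|(t,u)|)\quad\text{if }p=\infty.$$
   Context: **Local data.** Local data $(f_1,\dots,f_n,\gamma_1,\dots,\gamma_n,E)$ consist of the following. Let $f_1,\dots,f_n$ be real analytic functions on a neighborhood of $(0,0)$ in $\mathbb{R}^2$, none identically zero near the origin, and let $\gamma_1,\dots,\gamma_n$ be real exponents. The set $E$ is either a disk $\{x^2+y^2<\rho^2\}$, or a disjoint union of finitely many open sets $E_1,\dots,E_q$ ($q\ge1$), where each $E_j$ is a region bounded by two curves $C_1,C_2$ connecting the origin to the circle $x^2+y^2=\rho^2$ and by that circle (either of the two regions so formed is allowed). Each such curve is half of a graph $y=h(|x|^{1/N})$ or $x=h(|y|^{1/N})$ with $N$ a positive integer, $h$ real analytic, $h(0)=0$. All the curves (over all $j$) are disjoint in $\{x^2+y^2\le\rho^2\}$ apart from the origin, so the closures of the $E_j$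 meet only at the origin. Put $g(x,y)=\chi_E(x,y)\prod_{i=1}^n|f_i(x,y)|^{\gamma_i}$; it is assumed that $g$ is integrable on a neighborhood of the origin. **Multipliers.** $m(x,y)$ is a compactly supported function on $\mathbb{R}^2$ such that for each $(x_0,y_0)$ in its support there are local data $(f_1,\dots,f_n,\gamma_1,\dots,\gamma_n,E)$ and a function $\alpha$ with $$m(x_0+x,y_0+y)=\alpha(x,y)\,\chi_E(x,y)\prod_{i=1}^n|f_i(x,y)|^{\gamma_i}$$ on a neighborhood of $(0,0)$, where $\alpha$ is $C^1$ except at $(0,0)$ and for some constant $A$: $|\alpha(x,y)|\le A$ and $|\nabla\alpha(x,y)|\le A(x^2+y^2)^{-1/2}$. The "associated function $g$" at $(x_0,y_0)$ is the one from these data. $|(t,u)|=(t^2+u^2)^{1/2}$. *)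

theory Defs
  imports "HOL-Analysis.Analysis"
begin

definition real_analytic_at :: "(real \<Rightarrow> real) \<Rightarrow> real \<Rightarrow> bool" where
  "real_analytic_at h a \<longleftrightarrow> (\<exists>F. (\<lambda>x. h (a + x)) has_fps_expansion F)"

definition real_analytic2_at :: "(real \<times> real \<Rightarrow> real) \<Rightarrow> real \<times> real \<Rightarrow> bool" where
  "real_analytic2_at f a \<longleftrightarrow>
     (\<exists>c r. r > 0 \<and>
        (\<forall>x y. \<bar>x\<bar> < r \<and> \<bar>y\<bar> < r \<longrightarrow>
           ((\<lambda>(j, k). c j k * x ^ j * y ^ k) has_sum f (a + (x, y))) (UNIV :: (nat \<times> nat) set)))"

definition real_analytic2_near :: "(real \<times> real \<Rightarrow> real) \<Rightarrow> real \<times> real \<Rightarrow> bool" where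
  "real_analytic2_near f a \<longleftrightarrow> (\<exists>U. open U \<and> a \<in> U \<and> (\<forall>z\<in>U. real_analytic2_at f z))"

text \<open>
  A boundary curve is the part of one half (\<open>x \<ge> 0\<close> for \<open>s = 1\<close>, \<open>x \<le> 0\<close> for \<open>s = - 1\<close>) of a
  graph \<open>y = h (\<bar>x\<bar> powr (1/N))\<close> from the origin up to the first point on the circle of
  radius \<open>\<rho>\<close>; or the same with the two coordinates interchanged.  Both end points belong
  to the curve.
\<close>

definition half_graph :: "nat \<Rightarrow> (real \<Rightarrow> real) \<Rightarrow> real \<Rightarrow> real \<Rightarrow> (real \<times> real) set" where
  "half_graph N h s b = (\<lambda>x. (s * x, h (root N \<bar>s * x\<bar>))) ` {0..b}"

definition boundary_curve :: "real \<Rightarrow> (real \<times> real) set \<Rightarrow> bool" where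
  "boundary_curve \<rho> C \<longleftrightarrow>
     (\<exists>N h s b. N > 0 \<and> s \<in> {1, -1} \<and> b > 0 \<and> h 0 = 0 \<and>
        (\<forall>t\<in>{0..root N b}. real_analytic_at h t) \<and>
        (\<forall>x\<in>{0..<b}. x\<^sup>2 + (h (root N x))\<^sup>2 < \<rho>\<^sup>2) \<and>
        b\<^sup>2 + (h (root N b))\<^sup>2 = \<rho>\<^sup>2 \<and>
        (C = half_graph N h s b \<or> C = prod.swap ` half_graph N h s b))"

text \<open>
  The region \<open>E\<^sub>j\<close> is one of the components into which the two curves \<open>C (2 * j)\<close> and
  \<open>C (2 * j + 1)\<close> cut the disk.
\<close>

definition admissible_region :: "(real \<times> real) set \<Rightarrow> bool" where
  "admissible_region E \<longleftrightarrow>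
     (\<exists>\<rho>>0. E = ball 0 \<rho> \<or>
        (\<exists>(q::nat) C Ej. q \<ge> 1 \<and>
           (\<forall>i<2 * q. boundary_curve \<rho> (C i)) \<and>
           (\<forall>i<2 * q. \<forall>k<2 * q. i \<noteq> k \<longrightarrow> C i \<inter> C k = {0}) \<and>
           (\<forall>j<q. Ej j \<in> components (ball 0 \<rho> - (C (2 * j) \<union> C (2 * j + 1)))) \<and>
           disjoint_family_on Ej {..<q} \<and>
           E = (\<Union>j<q. Ej j)))"

text \<open>
  The functions and exponents are indexed by \<open>i < n\<close>.  Since \<open>0 powr a = 0\<close> for every
  \<open>a\<close>, the value of \<open>assoc_g\<close> differs from the usual one only at zeros of some \<open>f i\<close> with
  \<open>\<gamma> i \<le> 0\<close>; near the origin these form a null set.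
\<close>

definition assoc_g ::
  "nat \<Rightarrow> (nat \<Rightarrow> real \<times> real \<Rightarrow> real) \<Rightarrow> (nat \<Rightarrow> real) \<Rightarrow> (real \<times> real) set \<Rightarrow> real \<times> real \<Rightarrow> real" where
  "assoc_g n f \<gamma> E z = indicator E z * (\<Prod>i<n. \<bar>f i z\<bar> powr \<gamma> i)"

definition local_data ::
  "nat \<Rightarrow> (nat \<Rightarrow> real \<times> real \<Rightarrow> real) \<Rightarrow> (nat \<Rightarrow> real) \<Rightarrow> (real \<times> real) set \<Rightarrow> bool" where
  "local_data n f \<gamma> E \<longleftrightarrow>
     (\<forall>i<n. real_analytic2_near (f i) 0 \<and> \<not> (\<forall>\<^sub>F z in nhds 0. f i z = 0)) \<and>
     admissible_region E \<and>
     (\<exists>N. open N \<and> 0 \<in> N \<and> set_integrable lebesgue N (assoc_g n f \<gamma> E))"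

definition supp :: "(real \<times> real \<Rightarrow> complex) \<Rightarrow> (real \<times> real) set" where
  "supp m = closure {z. m z \<noteq> 0}"

text \<open>
  \<open>\<alpha>\<^sub>x\<close> and \<open>\<alpha>\<^sub>y\<close> are the partial derivatives; the norm of the pair is the Euclidean
  length of the gradient.
\<close>

definition C1_amplitude :: "(real \<times> real) set \<Rightarrow> (real \<times> real \<Rightarrow> complex) \<Rightarrow> bool" where
  "C1_amplitude V \<alpha> \<longleftrightarrow>
     (\<exists>A \<alpha>\<^sub>x \<alpha>\<^sub>y.
        (\<forall>z\<in>V. norm (\<alpha> z) \<le> A) \<and>
        continuous_on (V - {0}) \<alpha>\<^sub>x \<and> continuous_on (V - {0}) \<alpha>\<^sub>y \<and>
        (\<forall>z\<in>V - {0}.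
           (\<alpha> has_derivative (\<lambda>(a, b). a *\<^sub>R \<alpha>\<^sub>x z + b *\<^sub>R \<alpha>\<^sub>y z)) (at z) \<and>
           norm (\<alpha>\<^sub>x z, \<alpha>\<^sub>y z) \<le> A / norm z))"

text \<open>
  The identity for \<open>m\<close> is required wherever its right-hand side is meaningful: at points of
  \<open>E\<close> where a factor with \<open>\<gamma> i \<le> 0\<close> vanishes (a null set), \<open>m\<close> is left unconstrained instead
  of being tied to the convention \<open>0 powr a = 0\<close>.
\<close>

definition local_form ::
  "(real \<times> real \<Rightarrow> complex) \<Rightarrow> real \<times> real \<Rightarrow> (real \<times> real \<Rightarrow> complex) \<Rightarrow>
   nat \<Rightarrow> (nat \<Rightarrow> real \<times> real \<Rightarrow> real) \<Rightarrow> (nat \<Rightarrow> real) \<Rightarrow> (real \<times> real) set \<Rightarrow> bool" where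
  "local_form m z\<^sub>0 \<alpha> n f \<gamma> E \<longleftrightarrow>
     (\<exists>V. open V \<and> 0 \<in> V \<and> C1_amplitude V \<alpha> \<and>
        (\<forall>z\<in>V. (z \<in> E \<longrightarrow> (\<forall>i<n. \<gamma> i \<le> 0 \<longrightarrow> f i z \<noteq> 0)) \<longrightarrow>
           m (z\<^sub>0 + z) = \<alpha> z * complex_of_real (assoc_g n f \<gamma> E z)))"

text \<open>
  A multiplier together with a choice, for every point \<open>z\<close> of its support, of an amplitude
  \<open>\<alpha> z\<close> and local data \<open>n z, f z, \<gamma> z, E z\<close>.
\<close>

definition multiplier ::
  "(real \<times> real \<Rightarrow> complex) \<Rightarrow> (real \<times> real \<Rightarrow> real \<times> real \<Rightarrow> complex) \<Rightarrow>
   (real \<times> real \<Rightarrow> nat) \<Rightarrow> (real \<times> real \<Rightarrow> nat \<Rightarrow> real \<times> real \<Rightarrow> real) \<Rightarrow>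
   (real \<times> real \<Rightarrow> nat \<Rightarrow> real) \<Rightarrow> (real \<times> real \<Rightarrow> (real \<times> real) set) \<Rightarrow> bool" where
  "multiplier m \<alpha> n f \<gamma> E \<longleftrightarrow>
     compact (supp m) \<and>
     (\<forall>z\<in>supp m. local_data (n z) (f z) (\<gamma> z) (E z) \<and>
        local_form m z (\<alpha> z) (n z) (f z) (\<gamma> z) (E z))"

definition multiplier_kernel :: "(real \<times> real \<Rightarrow> complex) \<Rightarrow> real \<Rightarrow> real \<Rightarrow> complex" where
  "multiplier_kernel m t u =
     (LINT z|lebesgue. m z * exp (\<i> * complex_of_real t * complex_of_real (fst z)
                                 + \<i> * complex_of_real u * complex_of_real (snd z)))"

definition in_Lp :: "ennreal \<Rightarrow> (real \<times> real) set \<Rightarrow> (real \<times> real \<Rightarrow> real) \<Rightarrow> bool" where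
  "in_Lp p N g \<longleftrightarrow>
     set_borel_measurable lebesgue N g \<and>
     (if p = \<infinity> then \<exists>B. AE z in lebesgue. z \<in> N \<longrightarrow> \<bar>g z\<bar> \<le> B
      else set_integrable lebesgue N (\<lambda>z. \<bar>g z\<bar> powr enn2real p))"

end

theory Submission
  imports Defs
begin

text \<open>
  With \<open>d = \<pi> / \<bar>t\<bar>\<close>, shifting \<open>x\<close> by \<open>d\<close> changes the sign of \<open>exp (\<i> t x)\<close>, so
  \<open>2 \<bar>K(t,u)\<bar>\<close> is at most the integral of \<open>\<bar>m(x + d, y) - m(x, y)\<bar>\<close>; exchanging the coordinates we may
  take \<open>\<bar>t\<bar> \<ge> \<bar>u\<bar>\<close>.  Near a point of the support, every horizontal line \<open>y \<noteq> 0\<close> is cut into boundedly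
  many intervals on which \<open>m = \<alpha> g\<close> with \<open>g\<close> monotone: a nonzero double power series has boundedly many zeros
  on these lines (factor out a power of \<open>y\<close> and apply Rolle's theorem), and this applies to the \<open>f\<^sub>i\<close>,
  to the numerator of the logarithmic derivative of \<open>g\<close>, and to the functions \<open>h(x) - y\<close> that describe the
  boundary curves.  On such an interval \<open>J\<close> the shift difference of \<open>1\<^sub>J \<alpha> g\<close> has \<open>L\<^sup>1\<close> norm at most a multiple
  of the integral of \<open>g(x) min(1, d / \<bar>x - q\<bar>)\<close> over \<open>J\<close>, where \<open>q\<close> runs over the end points of \<open>J\<close> and the
  singularity \<open>0\<close> of \<open>\<alpha>\<close>.  Young's inequality with the weight \<open>d\<^bsup>1 - 1/p\<^esup>\<close> bounds this by
  \<open>d\<^bsup>1 - 1/p\<^esup> (C + \<integral> g\<^sup>p)\<close>, which is integrable in \<open>y\<close>; for \<open>p = \<infinity>\<close> the weight integrates to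
  \<open>O(d ln (1/d))\<close>.
\<close>

section \<open>Double power series\<close>

text \<open>The number of pieces has to be bounded uniformly in y; this is what analyticity
  supplies. The line y = 0 is left out because some f_i may vanish on all of it, and near the origin
  it is the only horizontal line on which this can happen. Nothing is known about the size of the
  derivative of g, so only its sign is used: for monotone g the integral of a shift difference
  telescopes up to a loss within d of an end point. The gradient bound for \<alpha> enters through
  |z| \<ge> |x|, which makes x = 0 the one singular point of a line. The weight T = d^(1/p') in
  Young's inequality satisfies T^p' = d. The integral of min(1, d/|x|)^p' over the line is a
  multiple of d when p' > 1, so after division by T^p' it leaves a constant. For p = \<infinity> the
  tail d/|x| is not integrable, and cutting it off at distance 1 produces the logarithm. The kernel
  is a Bochner integral: it is 0 if m is not integrable, and otherwise m is replaced by a Borel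
  function vanishing off the support. Exchanging coordinates means passing to m composed with
  \<open>prod.swap\<close>, which satisfies the mirror images of all local conditions.\<close>

definition pser :: "real \<Rightarrow> (nat \<times> nat \<Rightarrow> real) \<Rightarrow> (real \<times> real \<Rightarrow> real) \<Rightarrow> bool" where
  "pser r c f \<longleftrightarrow> r > 0 \<and> (\<forall>x y. \<bar>x\<bar> < r \<longrightarrow> \<bar>y\<bar> < r \<longrightarrow>
     ((\<lambda>q. c q * (x ^ fst q * y ^ snd q)) has_sum f (x, y)) UNIV)"

lemma pserD:
  assumes "pser r c f" "\<bar>x\<bar> < r" "\<bar>y\<bar> < r"
  shows "((\<lambda>q. c q * (x ^ fst q * y ^ snd q)) has_sum f (x, y)) UNIV"
  using assms by (auto simp: pser_def)

text \<open>Unordered summability of real families is absolute. This is what justifies products,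
  regrouping by rows and division by powers of y below.\<close>

lemma pser_abs_summable:
  assumes "pser r c f" "\<bar>x\<bar> < r" "\<bar>y\<bar> < r"
  shows "(\<lambda>q. \<bar>c q\<bar> * (\<bar>x\<bar> ^ fst q * \<bar>y\<bar> ^ snd q)) summable_on UNIV"
proof -
  have "(\<lambda>q. c q * (x ^ fst q * y ^ snd q)) summable_on UNIV"
    using pserD[OF assms] by (auto simp: summable_on_def)
  then have "(\<lambda>q. norm (c q * (x ^ fst q * y ^ snd q))) summable_on UNIV"
    by (rule summable_on_iff_abs_summable_on_real[THEN iffD1])
  then show ?thesis by (simp add: abs_mult power_abs)
qed

lemma pser_mono: "pser r c f \<Longrightarrow> 0 < s \<Longrightarrow> s \<le> r \<Longrightarrow> pser s c f"
  by (auto simp: pser_def)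

lemma pser_const: "r > 0 \<Longrightarrow> pser r (\<lambda>q. if q = (0,0) then a else 0) (\<lambda>_. a)"
  unfolding pser_def
proof (intro conjI allI impI)
  fix x y :: real
  have "((\<lambda>q. (if q = (0,0) then a else 0) * (x ^ fst q * y ^ snd q)) has_sum a) {(0,0)}"
    by (rule has_sum_finiteI) auto
  then show "((\<lambda>q. (if q = (0,0) then a else 0) * (x ^ fst q * y ^ snd q)) has_sum a) UNIV"
    by (rule has_sum_cong_neutral[THEN iffD1, rotated -1]) auto
qed

lemma pser_add:
  assumes "pser r c f" "pser r d g"
  shows "pser r (\<lambda>q. c q + d q) (\<lambda>z. f z + g z)"
  using assms unfolding pser_def by (auto simp: distrib_right intro!: has_sum_add)

text \<open>Both series converge absolutely, so their product may be summed over all pairs of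
  indices and then regrouped by the sum of the two indices.\<close>

lemma pser_mult:
  assumes "pser r c f" "pser r d g"
  shows "pser r (\<lambda>(J,K). \<Sum>(j,k)\<in>{..J}\<times>{..K}. c (j,k) * d (J-j,K-k)) (\<lambda>z. f z * g z)"
  unfolding pser_def
proof (intro conjI allI impI)
  show "r > 0" using assms by (auto simp: pser_def)
  fix x y :: real assume xy: "\<bar>x\<bar> < r" "\<bar>y\<bar> < r"
  let ?a = "\<lambda>q. c q * (x ^ fst q * y ^ snd q)"
  let ?b = "\<lambda>q. d q * (x ^ fst q * y ^ snd q)"
  let ?P = "\<lambda>(p,q). ?a p * ?b q"
  have a: "(?a has_sum f (x,y)) UNIV" and b: "(?b has_sum g (x,y)) UNIV"
    using pserD[OF assms(1) xy] pserD[OF assms(2) xy] by auto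
  have na: "(\<lambda>q. norm (?a q)) summable_on UNIV" and nb: "(\<lambda>q. norm (?b q)) summable_on UNIV"
    by (rule summable_on_iff_abs_summable_on_real[THEN iffD1], rule has_sum_imp_summable[OF a],
      rule summable_on_iff_abs_summable_on_real[THEN iffD1], rule has_sum_imp_summable[OF b])
  have "(\<lambda>z. norm (?P z)) summable_on UNIV \<times> UNIV"
      proof (rule Infinite_Sum.abs_summable_on_Sigma_iff[THEN iffD2], intro conjI ballI)
    fix p show "(\<lambda>q. norm (?P (p,q))) summable_on UNIV"
      using summable_on_cmult_right[OF nb, of "norm (?a p)"] by (simp add: abs_mult)
    have "(\<lambda>p. norm (?a p) * infsum (\<lambda>q. norm (?b q)) UNIV) summable_on UNIV"
      by (rule summable_on_cmult_left[OF na])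
    moreover have "(\<Sum>\<^sub>\<infinity>q. norm (?P (p,q))) = norm (?a p) * infsum (\<lambda>q. norm (?b q)) UNIV" for p
      using infsum_cmult_right[of "norm (?a p)" "\<lambda>q. norm (?b q)" UNIV] nb by (simp add: abs_mult)
    moreover have "norm (infsum (\<lambda>q. norm (?b q)) UNIV) = infsum (\<lambda>q. norm (?b q)) UNIV"
      by (simp add: infsum_nonneg)
    ultimately show "(\<lambda>p. norm (\<Sum>\<^sub>\<infinity>q. norm (?P (p,q)))) summable_on UNIV"
      by (simp add: abs_mult)
  qed
  then have "?P summable_on UNIV \<times> UNIV"
    by (rule summable_on_iff_abs_summable_on_real[THEN iffD2])
  then have "(?P has_sum f (x,y) * g (x,y)) (UNIV \<times> UNIV)"
    by (intro has_sum_SigmaI[where g="\<lambda>p. ?a p * g (x,y)"])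
      (auto intro!: has_sum_cmult_right has_sum_cmult_left a b)
  \<comment> \<open>The bijection sends (p, q) to (p + q, p). The fibre over a total index Q is a
    finite box, so the inner sums are finite.\<close>
  also have "?this \<longleftrightarrow> ((\<lambda>(Q,p). ?a p * ?b (fst Q - fst p, snd Q - snd p)) has_sum f (x,y) * g (x,y))
     (Sigma UNIV (\<lambda>Q. {..fst Q} \<times> {..snd Q}))"
    by (rule has_sum_reindex_bij_witness[where
          i="\<lambda>(Q,p). (p, (fst Q - fst p, snd Q - snd p))" and
          j="\<lambda>(p,q). ((fst p + fst q, snd p + snd q), p)"]) auto
  finally have "((\<lambda>(Q,p). ?a p * ?b (fst Q - fst p, snd Q - snd p)) has_sum f (x,y) * g (x,y))
     (Sigma UNIV (\<lambda>Q. {..fst Q} \<times> {..snd Q}))" .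
  then have "((\<lambda>Q. \<Sum>p\<in>{..fst Q} \<times> {..snd Q}. ?a p * ?b (fst Q - fst p, snd Q - snd p)) has_sum f (x,y) * g (x,y)) UNIV"
    by (rule has_sum_SigmaD) (auto intro!: has_sum_finiteI)
  also have "(\<lambda>Q. \<Sum>p\<in>{..fst Q} \<times> {..snd Q}. ?a p * ?b (fst Q - fst p, snd Q - snd p)) =
    (\<lambda>Q. (\<lambda>(J,K). \<Sum>(j,k)\<in>{..J}\<times>{..K}. c (j,k) * d (J-j,K-k)) Q * (x ^ fst Q * y ^ snd Q))"
  proof (rule ext)
    fix Q :: "nat \<times> nat"
    obtain J K where Q: "Q = (J,K)" by (cases Q)
    have "?a p * ?b (J - fst p, K - snd p) = (case p of (j,k) \<Rightarrow> c (j,k) * d (J-j,K-k)) * (x ^ J * y ^ K)"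
      if "p \<in> {..J} \<times> {..K}" for p
    proof -
      have "x ^ J = x ^ fst p * x ^ (J - fst p)" "y ^ K = y ^ snd p * y ^ (K - snd p)"
        using that by (auto simp flip: power_add)
      then show ?thesis by (simp add: case_prod_beta algebra_simps)
    qed
    then show "(\<Sum>p\<in>{..fst Q} \<times> {..snd Q}. ?a p * ?b (fst Q - fst p, snd Q - snd p)) =
       (\<lambda>(J,K). \<Sum>(j,k)\<in>{..J}\<times>{..K}. c (j,k) * d (J-j,K-k)) Q * (x ^ fst Q * y ^ snd Q)"
      unfolding Q by (simp add: sum_distrib_right del: )
  qed
  finally show "((\<lambda>q. (case q of (J, K) \<Rightarrow> \<Sum>(j,k)\<in>{..J}\<times>{..K}. c (j,k) * d (J-j,K-k)) * (x ^ fst q * y ^ snd q)) has_sum f (x, y) * g (x, y)) UNIV"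
    by simp
qed

text \<open>The geometric weight \<open>s\<close> with \<open>\<bar>x\<bar> < s < r\<close> absorbs the factor \<open>j + 1\<close>.\<close>

lemma pser_dx:
  assumes f: "pser r c f"
  obtains f' where "pser r (\<lambda>(j,k). real (Suc j) * c (Suc j, k)) f'"
    and "\<And>x y. \<bar>x\<bar> < r \<Longrightarrow> \<bar>y\<bar> < r \<Longrightarrow> ((\<lambda>x. f (x, y)) has_field_derivative f' (x, y)) (at x)"
proof -
  define d where "d = (\<lambda>(j,k). real (Suc j) * c (Suc j, k))"
  have r: "r > 0" using f by (simp add: pser_def)
  have ds: "(\<lambda>q. d q * (x ^ fst q * y ^ snd q)) summable_on UNIV" if xy: "\<bar>x\<bar> < r" "\<bar>y\<bar> < r" for x y
  proof -
    define s where "s = (\<bar>x\<bar> + r) / 2"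
    have s: "\<bar>x\<bar> < s" "s < r" "0 < s" using xy by (auto simp: s_def)
    have "(\<lambda>n. real (Suc n) * (\<bar>x\<bar> / s) ^ n) \<longlonglongrightarrow> 0"
    proof -
      have "norm (\<bar>x\<bar> / s) < 1" using s by simp
      from sums_summable[OF geometric_deriv_sums[OF this]]
      have "summable (\<lambda>n. real (Suc n) * (\<bar>x\<bar> / s) ^ n)" by simp
      then show ?thesis by (rule summable_LIMSEQ_zero)
    qed
    then obtain B where B: "\<And>n. norm (real (Suc n) * (\<bar>x\<bar> / s) ^ n) \<le> B"
      using convergent_imp_Bseq[of "\<lambda>n. real (Suc n) * (\<bar>x\<bar> / s) ^ n"] unfolding convergent_def Bseq_def by blast
    have B': "real (Suc n) * \<bar>x\<bar> ^ n \<le> B / s * s ^ Suc n" for n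
      using B[of n] s by (simp add: field_simps power_divide abs_mult)
    have "(\<lambda>q. \<bar>c q\<bar> * (\<bar>s\<bar> ^ fst q * \<bar>y\<bar> ^ snd q)) summable_on UNIV"
      by (rule pser_abs_summable[OF f]) (use s xy in auto)
    then have "(\<lambda>q. \<bar>c q\<bar> * (\<bar>s\<bar> ^ fst q * \<bar>y\<bar> ^ snd q)) summable_on (\<lambda>q. (Suc (fst q), snd q)) ` UNIV"
      by (rule summable_on_subset_banach) auto
    then have "(\<lambda>q. \<bar>c (Suc (fst q), snd q)\<bar> * (\<bar>s\<bar> ^ Suc (fst q) * \<bar>y\<bar> ^ snd q)) summable_on UNIV"
      by (subst (asm) summable_on_reindex) (auto simp: inj_on_def o_def)
    then have "(\<lambda>q. B / s * (\<bar>c (Suc (fst q), snd q)\<bar> * (\<bar>s\<bar> ^ Suc (fst q) * \<bar>y\<bar> ^ snd q))) summable_on UNIV"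
      by (rule summable_on_cmult_right)
    then have "(\<lambda>q. norm (d q * (x ^ fst q * y ^ snd q))) summable_on UNIV"
    proof (rule summable_on_comparison_test)
      fix q :: "nat \<times> nat"
      have "norm (d q * (x ^ fst q * y ^ snd q)) = (\<bar>c (Suc (fst q), snd q)\<bar> * \<bar>y\<bar> ^ snd q) * (real (Suc (fst q)) * \<bar>x\<bar> ^ fst q)"
        by (simp add: d_def case_prod_beta abs_mult power_abs mult_ac)
      also have "\<dots> \<le> (\<bar>c (Suc (fst q), snd q)\<bar> * \<bar>y\<bar> ^ snd q) * (B / s * s ^ Suc (fst q))"
        by (intro mult_left_mono B') auto
      also have "\<dots> = B / s * (\<bar>c (Suc (fst q), snd q)\<bar> * (\<bar>s\<bar> ^ Suc (fst q) * \<bar>y\<bar> ^ snd q))"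
        using s by simp
      finally show "norm (d q * (x ^ fst q * y ^ snd q)) \<le> B / s * (\<bar>c (Suc (fst q), snd q)\<bar> * (\<bar>s\<bar> ^ Suc (fst q) * \<bar>y\<bar> ^ snd q))" .
    qed auto
    then show ?thesis by (rule summable_on_iff_abs_summable_on_real[THEN iffD2])
  qed
  define f' where "f' = (\<lambda>(x,y). \<Sum>\<^sub>\<infinity>q. d q * (x ^ fst q * y ^ snd q))"
  have p': "pser r d f'"
    unfolding pser_def f'_def using r ds by (auto intro!: has_sum_infsum)
  \<comment> \<open>For fixed y, summing over the second index turns the double series into a power
    series in x, to which termwise differentiation in one variable applies.\<close>
  have row: "(\<lambda>j. (\<Sum>\<^sub>\<infinity>k. e (j,k) * y ^ k) * x ^ j) sums h (x,y)"
    if "pser r e h" "\<bar>x\<bar> < r" "\<bar>y\<bar> < r" for e h x y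
  proof -
    have h: "((\<lambda>q. e q * (x ^ fst q * y ^ snd q)) has_sum h (x, y)) (UNIV \<times> UNIV)" if "\<bar>x\<bar> < r" for x
      using pserD[OF \<open>pser r e h\<close> that \<open>\<bar>y\<bar> < r\<close>] by simp
    \<comment> \<open>Summability of each row is read off at the abscissa r/2, where the power can
      be divided out; x itself may be 0.\<close>
    have "(\<lambda>(j,k). e (j,k) * ((r/2) ^ j * y ^ k)) summable_on UNIV \<times> UNIV"
      using has_sum_imp_summable[OF h[of "r/2"]] r by (simp add: case_prod_unfold)
    then have "(\<lambda>k. e (j,k) * ((r/2) ^ j * y ^ k)) summable_on UNIV" for j
      by (rule summable_on_SigmaD1) auto
    then have "(\<lambda>k. 1 / (r/2) ^ j * (e (j,k) * ((r/2) ^ j * y ^ k))) summable_on UNIV" for j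
      by (rule summable_on_cmult_right)
    moreover have "1 / (r/2) ^ j * (e (j,k) * ((r/2) ^ j * y ^ k)) = e (j,k) * y ^ k" for j k
      using r by simp
    ultimately have 1: "(\<lambda>k. e (j,k) * y ^ k) summable_on UNIV" for j
      by simp
    have "((\<lambda>k. e (j,k) * (x ^ j * y ^ k)) has_sum (\<Sum>\<^sub>\<infinity>k. e (j,k) * y ^ k) * x ^ j) UNIV" for j
      using has_sum_cmult_left[OF has_sum_infsum[OF 1[of j]], of "x ^ j"] by (simp add: mult_ac)
    then have "((\<lambda>j. (\<Sum>\<^sub>\<infinity>k. e (j,k) * y ^ k) * x ^ j) has_sum h (x,y)) UNIV"
      by (intro has_sum_SigmaD[OF h[OF that(2)]]) auto
    then show ?thesis by (rule has_sum_imp_sums)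
  qed
  have "((\<lambda>x. f (x, y)) has_field_derivative f' (x, y)) (at x)" if xy: "\<bar>x\<bar> < r" "\<bar>y\<bar> < r" for x y
  proof -
    define a where "a = (\<lambda>j. \<Sum>\<^sub>\<infinity>k. c (j,k) * y ^ k)"
    have sums: "(\<lambda>j. a j * w ^ j) sums f (w,y)" if "\<bar>w\<bar> < r" for w
      unfolding a_def using row[OF f that xy(2)] .
    have "(\<lambda>j. diffs a j * x ^ j) sums f' (x,y)"
    proof -
      have "(\<Sum>\<^sub>\<infinity>k. d (j,k) * y ^ k) = diffs a j" for j
        unfolding d_def diffs_def a_def by (simp add: infsum_cmult_right' mult.assoc)
      then show ?thesis using row[OF p' xy] by simp
    qed
    moreover have "((\<lambda>w. \<Sum>j. a j * w ^ j) has_field_derivative (\<Sum>j. diffs a j * x ^ j)) (at x)"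
      by (rule termdiffs_strong'[where K=r]) (use sums xy in \<open>auto simp: sums_iff\<close>)
    ultimately have D: "((\<lambda>w. \<Sum>j. a j * w ^ j) has_field_derivative f' (x,y)) (at x)"
      by (simp add: sums_iff)
    have "\<forall>\<^sub>F w in nhds x. \<bar>w\<bar> < r"
      using xy by (intro eventually_nhds_in_open[where s="{w. \<bar>w\<bar> < r}", simplified]) (auto intro!: open_Collect_less continuous_intros)
    then have "\<forall>\<^sub>F w in nhds x. (\<Sum>j. a j * w ^ j) = f (w,y)"
      by eventually_elim (use sums in \<open>auto simp: sums_iff\<close>)
    from DERIV_cong_ev[OF refl this refl] D show ?thesis by simp
  qed
  with p' show ?thesis using that unfolding d_def by blast
qed

section \<open>Zeros of a double power series on horizontal lines\<close>

lemma pser_nonzero_near_0: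
  assumes f: "pser r c f" and c: "c (0,0) \<noteq> 0"
  obtains e where "0 < e" "e \<le> r" "\<And>x y. \<bar>x\<bar> < e \<Longrightarrow> \<bar>y\<bar> < e \<Longrightarrow> f (x, y) \<noteq> 0"
proof -
  have r: "r > 0" using f by (simp add: pser_def)
  define s where "s = r / 2"
  have s: "0 < s" "s < r" using r by (auto simp: s_def)
  define S where "S = (\<Sum>\<^sub>\<infinity>q. \<bar>c q\<bar> * (s ^ fst q * s ^ snd q))"
  have Ssum: "((\<lambda>q. \<bar>c q\<bar> * (s ^ fst q * s ^ snd q)) has_sum S) UNIV"
    unfolding S_def using pser_abs_summable[OF f, of s s] s by (intro has_sum_infsum) auto
  then have S0: "S \<ge> 0" by (rule has_sum_nonneg) (use s in auto)
  \<comment> \<open>This choice forces t * (S + 1) < |c (0,0)| for the ratio t introduced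
    below.\<close>
  define e where "e = min s (s * \<bar>c (0,0)\<bar> / (S + 1))"
  have e: "0 < e" "e \<le> s" using s c S0 by (auto simp: e_def)
  have "f (x,y) \<noteq> 0" if xy: "\<bar>x\<bar> < e" "\<bar>y\<bar> < e" for x y
  proof -
    \<comment> \<open>\<open>t\<close> measures (x, y) relative to the point (s, s). Every
      nonconstant term carries at least one factor t, so f differs from its constant coefficient by
      at most t * S.\<close>
    define t where "t = max \<bar>x\<bar> \<bar>y\<bar> / s"
    have t: "0 \<le> t" "t < 1" "\<bar>x\<bar> \<le> t * s" "\<bar>y\<bar> \<le> t * s" using xy e s by (auto simp: t_def)
    have tS: "t * S < \<bar>c (0,0)\<bar>"
    proof -
      have "t < e / s" using xy s by (auto simp: t_def divide_strict_right_mono)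
      also have "e / s \<le> \<bar>c (0,0)\<bar> / (S + 1)" 
      proof -
        have "e \<le> s * \<bar>c (0,0)\<bar> / (S + 1)" by (simp add: e_def)
        then show ?thesis using s by (simp add: divide_le_eq mult.commute)
      qed
      finally have "t * (S + 1) < \<bar>c (0,0)\<bar>" using S0 by (simp add: field_simps)
      then show ?thesis using t by (simp add: algebra_simps)
    qed
    let ?F = "\<lambda>q. c q * (x ^ fst q * y ^ snd q)"
    have F: "(?F has_sum f (x,y)) UNIV" using xy e s by (intro pserD[OF f]) auto
    have G: "((\<lambda>q. if q = (0,0) then c (0,0) else 0) has_sum c (0,0)) UNIV"
      by (rule has_sum_cong_neutral[THEN iffD1, OF _ _ _ has_sum_finiteI[of "{(0,0)}"]]) auto
    have D: "((\<lambda>q. ?F q - (if q = (0,0) then c (0,0) else 0)) has_sum f (x,y) - c (0,0)) UNIV"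
      using has_sum_add[OF F has_sum_cmult_right[OF G, of "-1"]] by simp
    have le: "norm (?F q - (if q = (0,0) then c (0,0) else 0)) \<le> t * (\<bar>c q\<bar> * (s ^ fst q * s ^ snd q))" for q
    proof (cases "q = (0,0)")
      case True
      then show ?thesis using t by simp
    next
      case False
      have "norm (?F q) \<le> \<bar>c q\<bar> * ((t * s) ^ fst q * (t * s) ^ snd q)"
        using t s by (auto simp: abs_mult power_abs intro!: mult_left_mono mult_mono power_mono)
      also have "\<dots> = t ^ (fst q + snd q) * (\<bar>c q\<bar> * (s ^ fst q * s ^ snd q))"
        by (simp add: power_mult_distrib power_add)
      also have "\<dots> \<le> t ^ 1 * (\<bar>c q\<bar> * (s ^ fst q * s ^ snd q))"
        using t s False by (intro mult_right_mono power_decreasing) (cases q, auto)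
      finally show ?thesis using False by simp
    qed
    have tSs: "((\<lambda>q. t * (\<bar>c q\<bar> * (s ^ fst q * s ^ snd q))) has_sum t * S) UNIV"
      by (rule has_sum_cmult_right[OF Ssum])
    then have "(\<lambda>q. norm (?F q - (if q = (0,0) then c (0,0) else 0))) summable_on UNIV"
      by (rule summable_on_comparison_test[OF has_sum_imp_summable]) (rule le, rule norm_ge_zero)
    then have N: "((\<lambda>q. norm (?F q - (if q = (0,0) then c (0,0) else 0))) has_sum
        (\<Sum>\<^sub>\<infinity>q. norm (?F q - (if q = (0,0) then c (0,0) else 0)))) UNIV"
      by (rule has_sum_infsum)
    have "norm (f (x,y) - c (0,0)) \<le> t * S"
      using norm_has_sum_bound[OF N D] has_sum_mono[OF N tSs le] by linarith
    then show ?thesis using tS by auto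
  qed
  then show ?thesis using that[of e] e s by auto
qed

lemma pser_eq_0:
  assumes "pser r c f" "\<And>q. c q = 0" "\<bar>x\<bar> < r" "\<bar>y\<bar> < r"
  shows "f (x,y) = 0"
  using pserD[OF assms(1,3,4)] assms(2) by (simp add: has_sum_0 has_sum_unique[OF _ has_sum_0])

text \<open>Rolle's theorem gives a zero of the derivative between neighbouring zeros of g. The zero
  set of g is not known to be finite beforehand, so finite subsets are counted; a uniform bound on
  their cardinalities yields finiteness as well.\<close>

lemma card_zeros_le_Suc_card_zeros_deriv:
  fixes g g' :: "real \<Rightarrow> real"
  assumes D: "\<And>x. \<bar>x\<bar> < e \<Longrightarrow> (g has_field_derivative g' x) (at x)"
    and fin: "finite {x. \<bar>x\<bar> < e \<and> g' x = 0}"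
  shows "finite {x. \<bar>x\<bar> < e \<and> g x = 0} \<and> card {x. \<bar>x\<bar> < e \<and> g x = 0} \<le> Suc (card {x. \<bar>x\<bar> < e \<and> g' x = 0})"
proof -
  \<comment> \<open>Counting only the zeros of \<open>g'\<close> to the left of \<open>Max Z\<close>
    makes the induction work: a new maximum adds a zero of \<open>g'\<close> strictly between the
    old maximum and itself.\<close>
  have *: "card Z \<le> Suc (card {x. x < Max Z \<and> \<bar>x\<bar> < e \<and> g' x = 0})"
    if "finite Z" "Z \<noteq> {}" "Z \<subseteq> {x. \<bar>x\<bar> < e \<and> g x = 0}" for Z
    using that
  proof (induction rule: finite_linorder_max_induct)
    case empty then show ?case by simp
  next
    case (insert b A)
    show ?case
    proof (cases "A = {}")
      case True then show ?thesis by simp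
    next
      case False
      define a where "a = Max A"
      have a: "a \<in> A" "a < b" using insert False by (auto simp: a_def)
      have mb: "Max (insert b A) = b" using insert False by (simp add: max_absorb1 less_imp_le)
      have ab: "\<bar>a\<bar> < e" "\<bar>b\<bar> < e" "g a = 0" "g b = 0" using a insert.prems by auto
      have "\<exists>z. a < z \<and> z < b \<and> (g has_field_derivative 0) (at z)"
      proof (rule Rolle[OF a(2)])
        show "g a = g b" using ab by simp
        show "continuous_on {a..b} g"
          by (rule DERIV_continuous_on, rule has_field_derivative_at_within, rule D) (use ab in auto)
        show "g differentiable at x" if "a < x" "x < b" for x
          by (rule real_differentiable_def[THEN iffD2], rule exI, rule D) (use ab that in auto)
      qed
      then obtain z where z: "a < z" "z < b" "(g has_field_derivative 0) (at z)" by blast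
      have "\<bar>z\<bar> < e" using z ab by auto
      then have z0: "g' z = 0" using DERIV_unique[OF D z(3)] by simp
      have "card (insert b A) \<le> Suc (card A)" by (simp add: card_insert_le_m1 insert.hyps)
      also have "card A \<le> Suc (card {x. x < a \<and> \<bar>x\<bar> < e \<and> g' x = 0})"
        using insert False by (auto simp: a_def)
      also have "Suc (card {x. x < a \<and> \<bar>x\<bar> < e \<and> g' x = 0}) = card (insert z {x. x < a \<and> \<bar>x\<bar> < e \<and> g' x = 0})"
        using z by (subst card_insert_disjoint) (auto intro: finite_subset[OF _ fin])
      also have "\<dots> \<le> card {x. x < b \<and> \<bar>x\<bar> < e \<and> g' x = 0}"
        using z z0 \<open>\<bar>z\<bar> < e\<close> by (intro card_mono) (auto intro: finite_subset[OF _ fin])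
      finally show ?thesis by (simp add: mb)
    qed
  qed
  have "card Z \<le> Suc (card {x. \<bar>x\<bar> < e \<and> g' x = 0})"
    if "finite Z" "Z \<subseteq> {x. \<bar>x\<bar> < e \<and> g x = 0}" for Z
  proof (cases "Z = {}")
    case False
    have "card {x. x < Max Z \<and> \<bar>x\<bar> < e \<and> g' x = 0} \<le> card {x. \<bar>x\<bar> < e \<and> g' x = 0}"
      by (intro card_mono fin) auto
    then show ?thesis using *[OF that(1) False that(2)] by simp
  qed simp
  then show ?thesis by (intro finite_if_finite_subsets_card_bdd) blast
qed

text \<open>Induction on d through the x-derivative, whose coefficient at \<open>(d, 0)\<close> is
  \<open>Suc d\<close> times that of f at \<open>(Suc d, 0)\<close>; Rolle's theorem adds one zero
  per step. The radius e is found in the base case, where there are no zeros near the origin, and is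
  passed up unchanged.\<close>

lemma pser_zeros_of_coeff:
  assumes "pser r c f" "c (d, 0) \<noteq> 0"
  shows "\<exists>e. 0 < e \<and> e \<le> r \<and> (\<forall>y. \<bar>y\<bar> < e \<longrightarrow>
    finite {x. \<bar>x\<bar> < e \<and> f (x,y) = 0} \<and> card {x. \<bar>x\<bar> < e \<and> f (x,y) = 0} \<le> d)"
  using assms
proof (induction d arbitrary: c f)
  case 0
  obtain e where e: "0 < e" "e \<le> r" "\<And>x y. \<bar>x\<bar> < e \<Longrightarrow> \<bar>y\<bar> < e \<Longrightarrow> f (x, y) \<noteq> 0"
    by (rule pser_nonzero_near_0[OF 0]) blast
  have "{x. \<bar>x\<bar> < e \<and> f (x,y) = 0} = {}" if "\<bar>y\<bar> < e" for y using e that by auto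
  then have "\<forall>y. \<bar>y\<bar> < e \<longrightarrow> finite {x. \<bar>x\<bar> < e \<and> f (x,y) = 0} \<and> card {x. \<bar>x\<bar> < e \<and> f (x,y) = 0} \<le> 0"
    by (intro allI impI) (simp only: finite.emptyI card.empty order_refl simp_thms)
  with e(1,2) show ?case by (intro exI[of _ e] conjI)
next
  case (Suc d)
  obtain f' where f': "pser r (\<lambda>(j,k). real (Suc j) * c (Suc j, k)) f'"
    and D: "\<And>x y. \<bar>x\<bar> < r \<Longrightarrow> \<bar>y\<bar> < r \<Longrightarrow> ((\<lambda>x. f (x, y)) has_field_derivative f' (x, y)) (at x)"
    by (rule pser_dx[OF Suc.prems(1)]) blast
  obtain e where e: "0 < e" "e \<le> r" and z: "\<And>y. \<bar>y\<bar> < e \<Longrightarrow>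
    finite {x. \<bar>x\<bar> < e \<and> f' (x,y) = 0} \<and> card {x. \<bar>x\<bar> < e \<and> f' (x,y) = 0} \<le> d"
    using Suc.IH[OF f'] Suc.prems(2) by auto
  show ?case
  proof (intro exI[of _ e] conjI allI impI e)
    fix y assume y: "\<bar>y\<bar> < e"
    have "finite {x. \<bar>x\<bar> < e \<and> f (x,y) = 0} \<and> card {x. \<bar>x\<bar> < e \<and> f (x,y) = 0}
        \<le> Suc (card {x. \<bar>x\<bar> < e \<and> f' (x,y) = 0})"
      by (rule card_zeros_le_Suc_card_zeros_deriv) (use D z y e in auto)
    then show "finite {x. \<bar>x\<bar> < e \<and> f (x,y) = 0}" "card {x. \<bar>x\<bar> < e \<and> f (x,y) = 0} \<le> Suc d"
      using z[OF y] by auto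
  qed
qed

text \<open>With k the least power of y that occurs, f = y^k G, and G has a nonzero coefficient at
  some \<open>(d, 0)\<close>. The factor y^k is the reason for excluding y = 0.\<close>

lemma pser_zeros:
  assumes f: "pser r c f" and c: "c q \<noteq> 0"
  obtains e d where "0 < e" "e \<le> r" "\<And>y. 0 < \<bar>y\<bar> \<Longrightarrow> \<bar>y\<bar> < e \<Longrightarrow>
    finite {x. \<bar>x\<bar> < e \<and> f (x,y) = 0} \<and> card {x. \<bar>x\<bar> < e \<and> f (x,y) = 0} \<le> d"
proof -
  have r: "r > 0" using f by (simp add: pser_def)
  define k where "k = (LEAST k. \<exists>j. c (j,k) \<noteq> 0)"
  have "\<exists>k j. c (j,k) \<noteq> 0" using c by (cases q) auto
  then have "\<exists>j. c (j,k) \<noteq> 0" unfolding k_def by (rule LeastI_ex)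
  then obtain d where d: "c (d,k) \<noteq> 0" by blast
  have k0: "c (j,l) = 0" if "l < k" for j l
    using not_less_Least[of l "\<lambda>k. \<exists>j. c (j,k) \<noteq> 0"] that by (auto simp: k_def)
  define C where "C = (\<lambda>(j,l). c (j, l + k))"
  define G where "G = (\<lambda>(x,y). \<Sum>\<^sub>\<infinity>q. C q * (x ^ fst q * y ^ snd q))"
  have shift: "((\<lambda>q. C q * (x ^ fst q * y ^ (snd q + k))) has_sum f (x,y)) UNIV" if "\<bar>x\<bar> < r" "\<bar>y\<bar> < r" for x y
  proof -
    let ?s = "\<lambda>q. (fst q, snd q + k) :: nat \<times> nat"
    have "((\<lambda>q. c q * (x ^ fst q * y ^ snd q)) has_sum f (x,y)) UNIV"
      by (rule pserD[OF f that])
    then have "((\<lambda>q. c q * (x ^ fst q * y ^ snd q)) has_sum f (x,y)) (?s ` UNIV)"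
    proof (rule has_sum_cong_neutral[THEN iffD1, rotated -1])
      fix q assume q: "q \<in> UNIV - range ?s"
      have "snd q < k"
      proof (rule ccontr)
        assume "\<not> snd q < k"
        then have "q = ?s (fst q, snd q - k)" by simp
        then show False using q by blast
      qed
      then show "c q * (x ^ fst q * y ^ snd q) = 0" using k0[of "snd q" "fst q"] by simp
    qed auto
    then have "((\<lambda>q. c q * (x ^ fst q * y ^ snd q)) \<circ> ?s has_sum f (x,y)) UNIV"
      by (subst (asm) has_sum_reindex) (auto simp: inj_on_def)
    then show ?thesis by (simp add: o_def C_def case_prod_unfold)
  qed
  have "(\<lambda>q. C q * (x ^ fst q * y ^ snd q)) summable_on UNIV" if xy: "\<bar>x\<bar> < r" "\<bar>y\<bar> < r" for x y
  proof -
    \<comment> \<open>\<open>w\<close> dominates |y| and is positive even when y = 0, so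
      \<open>w ^ k\<close> can be divided out.\<close>
    define w where "w = max \<bar>y\<bar> (r/2)"
    have w: "0 < w" "w < r" "\<bar>y\<bar> \<le> w" using xy r by (auto simp: w_def)
    have "(\<lambda>q. norm (C q * (x ^ fst q * w ^ (snd q + k)))) summable_on UNIV"
      by (rule summable_on_iff_abs_summable_on_real[THEN iffD1], rule has_sum_imp_summable, rule shift)
        (use w xy in auto)
    then have "(\<lambda>q. 1 / w ^ k * norm (C q * (x ^ fst q * w ^ (snd q + k)))) summable_on UNIV"
      by (rule summable_on_cmult_right)
    then have "(\<lambda>q. norm (C q * (x ^ fst q * y ^ snd q))) summable_on UNIV"
    proof (rule summable_on_comparison_test)
      fix q :: "nat \<times> nat"
      have "norm (C q * (x ^ fst q * y ^ snd q)) \<le> \<bar>C q\<bar> * (\<bar>x\<bar> ^ fst q * w ^ snd q)"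
        using w by (auto simp: abs_mult power_abs intro!: mult_left_mono power_mono)
      also have "\<dots> = 1 / w ^ k * norm (C q * (x ^ fst q * w ^ (snd q + k)))"
        using w by (simp add: abs_mult power_abs power_add)
      finally show "norm (C q * (x ^ fst q * y ^ snd q)) \<le> 1 / w ^ k * norm (C q * (x ^ fst q * w ^ (snd q + k)))" .
    qed auto
    then show ?thesis by (rule summable_on_iff_abs_summable_on_real[THEN iffD2])
  qed
  then have G: "pser r C G"
    unfolding pser_def G_def using r by (auto intro!: has_sum_infsum)
  have fG: "f (x,y) = y ^ k * G (x,y)" if xy: "\<bar>x\<bar> < r" "\<bar>y\<bar> < r" for x y
  proof -
    have "((\<lambda>q. y ^ k * (C q * (x ^ fst q * y ^ snd q))) has_sum y ^ k * G (x,y)) UNIV"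
      by (rule has_sum_cmult_right[OF pserD[OF G xy]])
    then show ?thesis using has_sum_unique[OF shift[OF xy]] by (simp add: power_add mult_ac)
  qed
  obtain e where e: "0 < e" "e \<le> r" and z: "\<And>y. \<bar>y\<bar> < e \<Longrightarrow>
     finite {x. \<bar>x\<bar> < e \<and> G (x,y) = 0} \<and> card {x. \<bar>x\<bar> < e \<and> G (x,y) = 0} \<le> d"
    using pser_zeros_of_coeff[OF G, of d] d by (auto simp: C_def)
  have "{x. \<bar>x\<bar> < e \<and> f (x,y) = 0} = {x. \<bar>x\<bar> < e \<and> G (x,y) = 0}" if "0 < \<bar>y\<bar>" "\<bar>y\<bar> < e" for y
    using that e fG by auto
  then show ?thesis using that[of e d] e z by auto
qed

section \<open>Piecewise monotonicity of products of powers on horizontal lines\<close>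

definition dpser :: "real \<Rightarrow> (real \<times> real \<Rightarrow> real) \<Rightarrow> bool" where
  "dpser r f \<longleftrightarrow> (\<exists>c. pser r c f)"

lemma dpser_const: "r > 0 \<Longrightarrow> dpser r (\<lambda>_. a)"
  unfolding dpser_def using pser_const by blast

lemma dpser_add: "dpser r f \<Longrightarrow> dpser r g \<Longrightarrow> dpser r (\<lambda>z. f z + g z)"
  unfolding dpser_def using pser_add by blast

lemma dpser_mult: "dpser r f \<Longrightarrow> dpser r g \<Longrightarrow> dpser r (\<lambda>z. f z * g z)"
  unfolding dpser_def using pser_mult by blast

lemma dpser_sum: "r > 0 \<Longrightarrow> (\<And>i. i \<in> I \<Longrightarrow> dpser r (f i)) \<Longrightarrow> dpser r (\<lambda>z. \<Sum>i\<in>I. f i z)"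
  by (induction I rule: infinite_finite_induct) (auto intro: dpser_const dpser_add)

lemma dpser_prod: "r > 0 \<Longrightarrow> (\<And>i. i \<in> I \<Longrightarrow> dpser r (f i)) \<Longrightarrow> dpser r (\<lambda>z. \<Prod>i\<in>I. f i z)"
  by (induction I rule: infinite_finite_induct) (auto intro: dpser_const dpser_mult)

lemma dpser_deriv:
  assumes "dpser r f"
  obtains f' where "dpser r f'"
    "\<And>x y. \<bar>x\<bar> < r \<Longrightarrow> \<bar>y\<bar> < r \<Longrightarrow> ((\<lambda>x. f (x, y)) has_field_derivative f' (x, y)) (at x)"
proof -
  obtain c where c: "pser r c f" using assms by (auto simp: dpser_def)
  show ?thesis
    by (rule pser_dx[OF c], rule that) (auto simp: dpser_def)
qed

lemma dpser_zeros:
  assumes "dpser r f"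
  obtains "\<And>x y. \<bar>x\<bar> < r \<Longrightarrow> \<bar>y\<bar> < r \<Longrightarrow> f (x,y) = 0"
  | e d where "0 < e" "e \<le> r" "\<And>y. 0 < \<bar>y\<bar> \<Longrightarrow> \<bar>y\<bar> < e \<Longrightarrow>
    finite {x. \<bar>x\<bar> < e \<and> f (x,y) = 0} \<and> card {x. \<bar>x\<bar> < e \<and> f (x,y) = 0} \<le> d"
proof -
  obtain c where c: "pser r c f" using assms by (auto simp: dpser_def)
  show ?thesis
  proof (cases "\<exists>q. c q \<noteq> 0")
    case True
    then obtain q where "c q \<noteq> 0" by blast
    then show ?thesis by (rule pser_zeros[OF c]) (rule that(2))
  next
    case False
    then show ?thesis using pser_eq_0[OF c] that(1) by blast
  qed
qed

text \<open>If the derivative has no zero, the mean value theorem makes L injective, and a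
  continuous injective function on an interval is strictly monotone. The sign of \<open>L'\<close>
  never has to be determined.\<close>

lemma DERIV_nonzero_imp_monotone:
  fixes L L' :: "real \<Rightarrow> real"
  assumes D: "\<And>x. a < x \<Longrightarrow> x < b \<Longrightarrow> (L has_field_derivative L' x) (at x)"
    and L': "(\<forall>x. a < x \<longrightarrow> x < b \<longrightarrow> L' x = 0) \<or> (\<forall>x. a < x \<longrightarrow> x < b \<longrightarrow> L' x \<noteq> 0)"
  shows "mono_on {a<..<b} L \<or> antimono_on {a<..<b} L"
proof -
  have cont: "continuous_on {a<..<b} L"
    by (rule DERIV_continuous_on, rule has_field_derivative_at_within, rule D) auto
  have sub: "\<exists>z. x < z \<and> z < y \<and> L y - L x = (y - x) * L' z" if "a < x" "x < y" "y < b" for x y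
    using MVT2[of x y L L'] D that by fastforce
  from L' show ?thesis
  proof
    assume 0: "\<forall>x. a < x \<longrightarrow> x < b \<longrightarrow> L' x = 0"
    have "L x = L y" if xy: "a < x" "x < y" "y < b" for x y
    proof -
      obtain z where "x < z" "z < y" "L y - L x = (y - x) * L' z" using sub[OF xy] by blast
      then show ?thesis using 0 xy by auto
    qed
    then have "mono_on {a<..<b} L"
      by (intro mono_onI) (metis greaterThanLessThan_iff order_le_less order_refl)
    then show ?thesis ..
  next
    assume n0: "\<forall>x. a < x \<longrightarrow> x < b \<longrightarrow> L' x \<noteq> 0"
    have "L x \<noteq> L y" if xy: "a < x" "x < y" "y < b" for x y
    proof -
      obtain z where "x < z" "z < y" "L y - L x = (y - x) * L' z" using sub[OF xy] by blast
      then show ?thesis using n0 xy by auto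
    qed
    then have "inj_on L {a<..<b}"
      by (intro inj_onI) (metis greaterThanLessThan_iff linorder_neqE_linordered_idom)
    then have "strict_mono_on {a<..<b} L \<or> strict_antimono_on {a<..<b} L"
      using injective_eq_monotone_map[OF _ cont] by (simp add: is_interval_oo)
    then show ?thesis using strict_mono_iff_mono strict_antimono_iff_antimono by blast
  qed
qed

text \<open>Half the logarithm of the square replaces the logarithm of the absolute value, so that
  the exponent can be differentiated for either sign of \<open>f i\<close>.\<close>

lemma prod_powr_eq_exp_sum:
  fixes f :: "nat \<Rightarrow> real"
  assumes "\<And>i. i < n \<Longrightarrow> f i \<noteq> 0"
  shows "(\<Prod>i<n. \<bar>f i\<bar> powr \<gamma> i) = exp (\<Sum>i<n. \<gamma> i / 2 * ln ((f i)\<^sup>2))"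
proof -
  have "\<gamma> i / 2 * ln ((f i)\<^sup>2) = \<gamma> i * ln \<bar>f i\<bar>" if "i < n" for i
    using assms[OF that] ln_realpow[of "\<bar>f i\<bar>" 2] by simp
  then have "(\<Sum>i<n. \<gamma> i / 2 * ln ((f i)\<^sup>2)) = (\<Sum>i<n. \<gamma> i * ln \<bar>f i\<bar>)"
    by (intro sum.cong) auto
  then show ?thesis using assms by (simp add: exp_sum powr_def)
qed

text \<open>The logarithmic derivative of the product is a double power series F divided by the
  product of the \<open>f i\<close>. Cutting at the zeros of F and of all \<open>f i\<close>
  therefore leaves intervals on which it has no zero, or on which it vanishes throughout and the
  product is constant.\<close>

lemma dpser_prod_powr_piecewise_monotone:
  fixes n :: nat
  assumes r: "r > 0"
    and f: "\<And>i. i < n \<Longrightarrow> dpser r (f i)"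
    and nz: "\<And>i. i < n \<Longrightarrow> \<not> (\<forall>\<^sub>F z in nhds 0. f i z = 0)"
  obtains e M where "0 < e" "e \<le> r"
    "\<And>y. 0 < \<bar>y\<bar> \<Longrightarrow> \<bar>y\<bar> < e \<Longrightarrow> \<exists>P. finite P \<and> card P \<le> M \<and>
       (\<forall>a b. {a<..<b} \<subseteq> {-e<..<e} - P \<longrightarrow>
          (\<forall>i<n. \<forall>x\<in>{a<..<b}. f i (x,y) \<noteq> 0) \<and>
          (mono_on {a<..<b} (\<lambda>x. \<Prod>i<n. \<bar>f i (x,y)\<bar> powr \<gamma> i) \<or>
           antimono_on {a<..<b} (\<lambda>x. \<Prod>i<n. \<bar>f i (x,y)\<bar> powr \<gamma> i)))"
proof -
  have "\<exists>f'. dpser r f' \<and> (\<forall>x y. \<bar>x\<bar> < r \<longrightarrow> \<bar>y\<bar> < r \<longrightarrow> ((\<lambda>x. f i (x, y)) has_field_derivative f' (x, y)) (at x))"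
    if "i < n" for i
    by (rule dpser_deriv[OF f[OF that]]) blast
  then obtain f' where f': "\<And>i. i < n \<Longrightarrow> dpser r (f' i)"
    and D: "\<And>i x y. i < n \<Longrightarrow> \<bar>x\<bar> < r \<Longrightarrow> \<bar>y\<bar> < r \<Longrightarrow> ((\<lambda>x. f i (x, y)) has_field_derivative f' i (x, y)) (at x)"
    by metis
  have box: "\<forall>\<^sub>F z in nhds (0::real\<times>real). \<bar>fst z\<bar> < r \<and> \<bar>snd z\<bar> < r"
  proof -
    have "open {z::real\<times>real. \<bar>fst z\<bar> < r \<and> \<bar>snd z\<bar> < r}"
      by (intro open_Collect_conj open_Collect_less continuous_intros)
    from eventually_nhds_in_open[OF this, of 0] r show ?thesis by simp
  qed
  have "\<exists>e d. 0 < e \<and> e \<le> r \<and> (\<forall>y. 0 < \<bar>y\<bar> \<longrightarrow> \<bar>y\<bar> < e \<longrightarrow>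
    finite {x. \<bar>x\<bar> < e \<and> f i (x,y) = 0} \<and> card {x. \<bar>x\<bar> < e \<and> f i (x,y) = 0} \<le> d)" if i: "i < n" for i
  proof (rule dpser_zeros[OF f[OF i]])
    assume 0: "\<And>x y. \<bar>x\<bar> < r \<Longrightarrow> \<bar>y\<bar> < r \<Longrightarrow> f i (x,y) = 0"
    have "\<forall>\<^sub>F z in nhds 0. f i z = 0"
      using box by eventually_elim (use 0 in auto)
    then show ?thesis using nz[OF i] by simp
  qed blast
  then have "\<forall>i. \<exists>e d. i < n \<longrightarrow> 0 < e \<and> e \<le> r \<and> (\<forall>y. 0 < \<bar>y\<bar> \<longrightarrow> \<bar>y\<bar> < e \<longrightarrow>
    finite {x. \<bar>x\<bar> < e \<and> f i (x,y) = 0} \<and> card {x. \<bar>x\<bar> < e \<and> f i (x,y) = 0} \<le> d)"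
    by blast
  from this[THEN choice] obtain e where "\<forall>i. \<exists>d. i < n \<longrightarrow> 0 < e i \<and> e i \<le> r \<and> (\<forall>y. 0 < \<bar>y\<bar> \<longrightarrow> \<bar>y\<bar> < e i \<longrightarrow>
    finite {x. \<bar>x\<bar> < e i \<and> f i (x,y) = 0} \<and> card {x. \<bar>x\<bar> < e i \<and> f i (x,y) = 0} \<le> d)" ..
  from this[THEN choice] obtain d where "\<forall>i<n. 0 < e i \<and> e i \<le> r \<and> (\<forall>y. 0 < \<bar>y\<bar> \<longrightarrow> \<bar>y\<bar> < e i \<longrightarrow>
    finite {x. \<bar>x\<bar> < e i \<and> f i (x,y) = 0} \<and> card {x. \<bar>x\<bar> < e i \<and> f i (x,y) = 0} \<le> d i)" ..
  then have e: "\<And>i. i < n \<Longrightarrow> 0 < e i \<and> e i \<le> r"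
    and z: "\<And>i y. i < n \<Longrightarrow> 0 < \<bar>y\<bar> \<Longrightarrow> \<bar>y\<bar> < e i \<Longrightarrow>
      finite {x. \<bar>x\<bar> < e i \<and> f i (x,y) = 0} \<and> card {x. \<bar>x\<bar> < e i \<and> f i (x,y) = 0} \<le> d i"
    by simp_all
  define F where "F = (\<lambda>z. \<Sum>i<n. \<gamma> i * f' i z * (\<Prod>j\<in>{..<n}-{i}. f j z))"
  have F: "dpser r F"
    unfolding F_def by (intro dpser_sum dpser_mult dpser_prod dpser_const r f f') auto
  \<comment> \<open>Both alternatives for F are covered: its zeros serve as cut points, or F
    vanishes identically and no cut point is needed.\<close>
  define ok where "ok = (\<lambda>e0 d0 y Q. finite Q \<and> card Q \<le> (d0::nat) \<and>
       (\<forall>a b. {a<..<b} \<subseteq> {-e0<..<e0} - Q \<longrightarrow> (\<forall>x\<in>{a<..<b}. F (x,y) = 0) \<or> (\<forall>x\<in>{a<..<b}. F (x,y) \<noteq> 0)))"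
  have "\<exists>e0 d0. 0 < e0 \<and> e0 \<le> r \<and> (\<forall>y. 0 < \<bar>y\<bar> \<longrightarrow> \<bar>y\<bar> < e0 \<longrightarrow> (\<exists>Q. ok e0 d0 y Q))"
  proof (rule dpser_zeros[OF F])
    assume 0: "\<And>x y. \<bar>x\<bar> < r \<Longrightarrow> \<bar>y\<bar> < r \<Longrightarrow> F (x,y) = 0"
    have "ok r 0 y {}" if "\<bar>y\<bar> < r" for y
      unfolding ok_def using 0 that by (auto simp: subset_iff)
    then show ?thesis using r by blast
  next
    fix e0 d0 assume e0: "0 < e0" "e0 \<le> r" and zF: "\<And>y. 0 < \<bar>y\<bar> \<Longrightarrow> \<bar>y\<bar> < e0 \<Longrightarrow>
      finite {x. \<bar>x\<bar> < e0 \<and> F (x,y) = 0} \<and> card {x. \<bar>x\<bar> < e0 \<and> F (x,y) = 0} \<le> d0"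
    have "ok e0 d0 y {x. \<bar>x\<bar> < e0 \<and> F (x,y) = 0}" if "0 < \<bar>y\<bar>" "\<bar>y\<bar> < e0" for y
      unfolding ok_def using zF[OF that] by (auto simp: subset_iff)
    then show ?thesis using e0 by blast
  qed
  then obtain e0 d0 Q where e0: "0 < e0" "e0 \<le> r" and
    okQ: "\<And>y. 0 < \<bar>y\<bar> \<Longrightarrow> \<bar>y\<bar> < e0 \<Longrightarrow> ok e0 d0 y (Q y)"
    by metis
  from okQ have Q: "\<And>y. 0 < \<bar>y\<bar> \<Longrightarrow> \<bar>y\<bar> < e0 \<Longrightarrow> finite (Q y) \<and> card (Q y) \<le> d0 \<and>
       (\<forall>a b. {a<..<b} \<subseteq> {-e0<..<e0} - Q y \<longrightarrow> (\<forall>x\<in>{a<..<b}. F (x,y) = 0) \<or> (\<forall>x\<in>{a<..<b}. F (x,y) \<noteq> 0))"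
    unfolding ok_def by blast
  \<comment> \<open>Including \<open>e0\<close> gives E \<le> e0 and keeps the set nonempty when n =
    0.\<close>
  define E where "E = Min (insert e0 (e ` {..<n}))"
  have E: "0 < E" "E \<le> e0" "\<And>i. i < n \<Longrightarrow> E \<le> e i"
    unfolding E_def using e e0 by auto
  have "\<exists>P. finite P \<and> card P \<le> d0 + (\<Sum>i<n. d i) \<and>
       (\<forall>a b. {a<..<b} \<subseteq> {-E<..<E} - P \<longrightarrow>
          (\<forall>i<n. \<forall>x\<in>{a<..<b}. f i (x,y) \<noteq> 0) \<and>
          (mono_on {a<..<b} (\<lambda>x. \<Prod>i<n. \<bar>f i (x,y)\<bar> powr \<gamma> i) \<or>
           antimono_on {a<..<b} (\<lambda>x. \<Prod>i<n. \<bar>f i (x,y)\<bar> powr \<gamma> i)))"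
    if y: "0 < \<bar>y\<bar>" "\<bar>y\<bar> < E" for y
  proof -
    define P where "P = Q y \<union> (\<Union>i<n. {x. \<bar>x\<bar> < e i \<and> f i (x,y) = 0})"
    have ye: "\<bar>y\<bar> < e0" "\<And>i. i < n \<Longrightarrow> \<bar>y\<bar> < e i" using y E by (force, force)
    have "finite P" unfolding P_def using Q z y(1) ye by auto
    moreover have "card P \<le> d0 + (\<Sum>i<n. d i)"
    proof -
      have "card P \<le> card (Q y) + card (\<Union>i<n. {x. \<bar>x\<bar> < e i \<and> f i (x,y) = 0})"
        unfolding P_def by (rule card_Un_le)
      also have "\<dots> \<le> d0 + (\<Sum>i<n. card {x. \<bar>x\<bar> < e i \<and> f i (x,y) = 0})"
        using Q[OF y(1) ye(1)] by (intro add_mono card_UN_le) auto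
      also have "\<dots> \<le> d0 + (\<Sum>i<n. d i)"
        using z y(1) ye by (intro add_mono sum_mono) auto
      finally show ?thesis .
    qed
    moreover have "(\<forall>i<n. \<forall>x\<in>{a<..<b}. f i (x,y) \<noteq> 0) \<and>
          (mono_on {a<..<b} (\<lambda>x. \<Prod>i<n. \<bar>f i (x,y)\<bar> powr \<gamma> i) \<or>
           antimono_on {a<..<b} (\<lambda>x. \<Prod>i<n. \<bar>f i (x,y)\<bar> powr \<gamma> i))"
      if ab: "{a<..<b} \<subseteq> {-E<..<E} - P" for a b
    proof -
      have xE: "\<bar>x\<bar> < E" if "x \<in> {a<..<b}" for x
      proof -
        have "x \<in> {-E<..<E}" using ab that by blast
        then show ?thesis by auto
      qed
      have fnz: "f i (x,y) \<noteq> 0" if "i < n" "x \<in> {a<..<b}" for i x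
      proof -
        have "x \<notin> P" using ab that(2) by auto
        moreover have "\<bar>x\<bar> < e i" using E(3)[OF that(1)] xE[OF that(2)] by simp
        ultimately show ?thesis using that(1) by (auto simp: P_def)
      qed
      define L where "L = (\<lambda>x. \<Sum>i<n. \<gamma> i / 2 * ln ((f i (x,y))\<^sup>2))"
      define L' where "L' = (\<lambda>x. \<Sum>i<n. \<gamma> i * f' i (x,y) / f i (x,y))"
      have LD: "(L has_field_derivative L' x) (at x)" if "a < x" "x < b" for x
      proof -
        have x: "x \<in> {a<..<b}" using that by simp
        have "((\<lambda>x. \<gamma> i / 2 * ln ((f i (x,y))\<^sup>2)) has_field_derivative \<gamma> i * f' i (x,y) / f i (x,y)) (at x)" if "i < n" for i
        proof -
          have "\<bar>x\<bar> < r" "\<bar>y\<bar> < r" using xE[OF x] E(2) e0(2) y by auto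
          from D[OF that this] fnz[OF that x] show ?thesis
            by (auto intro!: derivative_eq_intros simp: field_simps power2_eq_square)
              (metis linorder_neqE_linordered_idom mult_neg_neg mult_pos_pos)
        qed
        then show ?thesis unfolding L_def L'_def by (intro DERIV_sum) auto
      qed
      have L'F: "L' x * (\<Prod>i<n. f i (x,y)) = F (x,y)" if "x \<in> {a<..<b}" for x
        unfolding L'_def F_def sum_distrib_right
      proof (rule sum.cong[OF refl])
        fix i assume "i \<in> {..<n}"
        then show "\<gamma> i * f' i (x, y) / f i (x, y) * (\<Prod>i<n. f i (x, y)) = \<gamma> i * f' i (x, y) * (\<Prod>j\<in>{..<n} - {i}. f j (x, y))"
          using fnz[OF _ that, of i] prod.remove[of "{..<n}" i "\<lambda>j. f j (x,y)"] by simp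
      qed
      have "(\<forall>x\<in>{a<..<b}. F (x,y) = 0) \<or> (\<forall>x\<in>{a<..<b}. F (x,y) \<noteq> 0)"
      proof -
        have "{a<..<b} \<subseteq> {-e0<..<e0} - Q y" using ab E(2) by (auto simp: P_def subset_iff)
        then show ?thesis using Q[OF y(1) ye(1)] by blast
      qed
      moreover have "L' x = 0 \<longleftrightarrow> F (x,y) = 0" if "x \<in> {a<..<b}" for x
        using L'F[OF that, symmetric] fnz[OF _ that] by auto
      ultimately have "(\<forall>x. a < x \<longrightarrow> x < b \<longrightarrow> L' x = 0) \<or> (\<forall>x. a < x \<longrightarrow> x < b \<longrightarrow> L' x \<noteq> 0)"
        by auto
      from DERIV_nonzero_imp_monotone[OF LD this]
      have "mono_on {a<..<b} L \<or> antimono_on {a<..<b} L" .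
      moreover have "(\<Prod>i<n. \<bar>f i (x,y)\<bar> powr \<gamma> i) = exp (L x)" if "x \<in> {a<..<b}" for x
        unfolding L_def by (rule prod_powr_eq_exp_sum) (use fnz that in auto)
      ultimately show ?thesis using fnz by (auto simp: monotone_on_def)
    qed
    ultimately show ?thesis by blast
  qed
  then show ?thesis using that[of E "d0 + (\<Sum>i<n. d i)"] E(1,2) e0(2) by fastforce
qed

section \<open>Boundary curves and horizontal lines\<close>

text \<open>Viewed as a function of two variables that ignores the second, h can be combined with
  \<open>snd\<close>, so that h(x) - y falls under the zero count for double power series.\<close>

lemma dpser_of_real_analytic_at_0:
  assumes "real_analytic_at h 0"
  obtains r where "r > 0" "dpser r (\<lambda>z. h (fst z))"
proof -
  obtain F where F: "h has_fps_expansion F"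
    using assms by (auto simp: real_analytic_at_def)
  then have R: "fps_conv_radius F > 0" and "\<forall>\<^sub>F z in nhds 0. eval_fps F z = h z"
    by (auto simp: has_fps_expansion_def)
  then obtain r1 where r1: "r1 > 0" "\<And>z. \<bar>z\<bar> < r1 \<Longrightarrow> eval_fps F z = h z"
    by (auto simp: eventually_nhds_metric dist_real_def)
  obtain r2 :: real where r2: "0 < r2" "ereal r2 < fps_conv_radius F"
    using ereal_dense2[OF R] by auto
  define r where "r = min r1 r2"
  define c where "c = (\<lambda>(j::nat,k::nat). if k = 0 then fps_nth F j else 0)"
  have "pser r c (\<lambda>z. h (fst z))"
    unfolding pser_def
  proof (intro conjI allI impI)
    show "r > 0" using r1 r2 by (simp add: r_def)
    fix x y :: real assume xy: "\<bar>x\<bar> < r" "\<bar>y\<bar> < r"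
    have "ereal (norm x) < fps_conv_radius F"
      using xy r2 by (metis ereal_less_le less_imp_le min.strict_boundedE order_le_less_trans r_def real_norm_def ereal_less(3) less_ereal.simps(1) order.strict_trans)
    then have "summable (\<lambda>n. norm (fps_nth F n * x ^ n))" by (rule norm_summable_fps)
    moreover have "(\<lambda>n. fps_nth F n * x ^ n) sums h x"
    proof -
      have "eval_fps F x = h x" using r1(2)[of x] xy by (simp add: r_def)
      then show ?thesis using summable_sums[OF summable_norm_cancel[OF calculation]] by (simp add: eval_fps_def)
    qed
    ultimately have "((\<lambda>n. fps_nth F n * x ^ n) has_sum h x) UNIV"
      by (rule norm_summable_imp_has_sum)
    then have "((\<lambda>q. c q * (x ^ fst q * y ^ snd q)) has_sum h x) (range (\<lambda>n. (n, 0)))"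
      by (subst has_sum_reindex) (auto simp: inj_on_def o_def c_def)
    then show "((\<lambda>q. c q * (x ^ fst q * y ^ snd q)) has_sum h (fst (x, y))) UNIV"
      unfolding fst_conv by (rule has_sum_cong_neutral[THEN iffD1, rotated -1]) (auto simp: c_def image_iff)
  qed
  then show ?thesis using that[of r] r1 r2 by (auto simp: r_def dpser_def)
qed

lemma dpser_snd: "r > 0 \<Longrightarrow> dpser r snd"
  unfolding dpser_def pser_def
proof (intro exI conjI allI impI)
  fix x y :: real
  have "((\<lambda>q. (if q = (0,1) then 1 else 0) * (x ^ fst q * y ^ snd q)) has_sum snd (x,y)) {(0,1)}"
    by (rule has_sum_finiteI) auto
  then show "((\<lambda>q. (if q = (0,1) then 1 else 0) * (x ^ fst q * y ^ snd q)) has_sum snd (x,y)) UNIV"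
    by (rule has_sum_cong_neutral[THEN iffD1, rotated -1]) auto
qed

text \<open>The level sets of \<open>h\<close> are the zeros of \<open>h x - y\<close> on the lines \<open>y = const\<close>.\<close>

lemma boundary_curve_meets_lines:
  assumes "boundary_curve \<rho> C"
  obtains e d where "e > 0" "\<And>y. 0 < \<bar>y\<bar> \<Longrightarrow> \<bar>y\<bar> < e \<Longrightarrow>
    finite {x. \<bar>x\<bar> < e \<and> (x,y) \<in> C} \<and> card {x. \<bar>x\<bar> < e \<and> (x,y) \<in> C} \<le> d"
proof -
  obtain N h s b where N: "N > 0" and s: "s = 1 \<or> s = -1" and b: "b > 0" and
    an: "\<forall>t\<in>{0..root N b}. real_analytic_at h t" and
    C: "C = half_graph N h s b \<or> C = prod.swap ` half_graph N h s b"
    using assms by (auto simp: boundary_curve_def)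
  from C show ?thesis
  proof
    assume C: "C = half_graph N h s b"
    have "real_analytic_at h 0" using an b by (auto simp: real_root_ge_zero)
    then obtain r where r: "r > 0" and hr: "dpser r (\<lambda>z. h (fst z))"
      by (rule dpser_of_real_analytic_at_0)
    have "dpser r (\<lambda>z. h (fst z) + (-1) * snd z)"
      by (intro dpser_add dpser_mult hr dpser_snd dpser_const r)
    then show ?thesis
    proof (rule dpser_zeros)
      assume 0: "\<And>x y. \<bar>x\<bar> < r \<Longrightarrow> \<bar>y\<bar> < r \<Longrightarrow> h (fst (x,y)) + (-1) * snd (x,y) = 0"
      \<comment> \<open>The two instances give h 0 = 0 and h 0 = r/2, so h(x) - y cannot vanish
        identically.\<close>
      from 0[of 0 0] 0[of 0 "r/2"] r show ?thesis by simp
    next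
      fix e d assume e: "0 < e" "e \<le> r" and z: "\<And>y. 0 < \<bar>y\<bar> \<Longrightarrow> \<bar>y\<bar> < e \<Longrightarrow>
        finite {x. \<bar>x\<bar> < e \<and> h (fst (x,y)) + (-1) * snd (x,y) = 0} \<and>
        card {x. \<bar>x\<bar> < e \<and> h (fst (x,y)) + (-1) * snd (x,y) = 0} \<le> d"
      \<comment> \<open>A point of the curve has abscissa s * w with w = t^N, where t = root N w is
        the argument of h. The bound w < e^N brings t into the range |t| < e in which the level set
        was counted.\<close>
      define e1 where "e1 = min e (e ^ N)"
      have e1: "e1 > 0" using e by (auto simp: e1_def)
      show ?thesis
      proof (rule that[OF e1])
        fix y assume y: "0 < \<bar>y\<bar>" "\<bar>y\<bar> < e1"
        let ?Z = "{x. \<bar>x\<bar> < e \<and> h x = y}"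
        have Z: "finite ?Z" "card ?Z \<le> d" using z[of y] y by (auto simp: e1_def)
        have sub: "{x. \<bar>x\<bar> < e1 \<and> (x,y) \<in> C} \<subseteq> (\<lambda>t. s * t ^ N) ` ?Z"
        proof
          fix x assume "x \<in> {x. \<bar>x\<bar> < e1 \<and> (x,y) \<in> C}"
          then obtain w where w: "0 \<le> w" "x = s * w" "y = h (root N w)" and xe: "\<bar>x\<bar> < e1"
            using s by (auto simp: C half_graph_def)
          have "w < e ^ N" using xe w s by (auto simp: e1_def)
          then have "root N w < root N (e ^ N)" using N by (intro real_root_less_mono)
          then have "root N w < e" using N e by (simp add: real_root_power_cancel)
          moreover have "0 \<le> root N w" using w(1) by (rule real_root_ge_zero)
          moreover have "w = root N w ^ N" using N w by simp
          ultimately show "x \<in> (\<lambda>t. s * t ^ N) ` ?Z" using w by (intro image_eqI[of _ _ "root N w"]) auto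
        qed
        have "card {x. \<bar>x\<bar> < e1 \<and> (x,y) \<in> C} \<le> card ((\<lambda>t. s * t ^ N) ` ?Z)"
          using Z sub by (intro card_mono) auto
        also have "\<dots> \<le> d" using card_image_le[OF Z(1)] Z(2) le_trans by blast
        finally show "finite {x. \<bar>x\<bar> < e1 \<and> (x,y) \<in> C} \<and> card {x. \<bar>x\<bar> < e1 \<and> (x,y) \<in> C} \<le> d"
          using finite_subset[OF sub] Z by auto
      qed
    qed
  next
    assume C: "C = prod.swap ` half_graph N h s b"
    show ?thesis
    proof (rule that[of 1 1])
      fix y :: real
      \<comment> \<open>Here the curve is a graph over the y-axis, so a horizontal line meets it at
        most once; the radius 1 is arbitrary.\<close>
      have sub: "{x. \<bar>x\<bar> < 1 \<and> (x,y) \<in> C} \<subseteq> {h (root N \<bar>y\<bar>)}"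
        unfolding C half_graph_def by auto
      show "finite {x. \<bar>x\<bar> < 1 \<and> (x,y) \<in> C} \<and> card {x. \<bar>x\<bar> < 1 \<and> (x,y) \<in> C} \<le> 1"
        using finite_subset[OF sub] card_mono[OF _ sub] by auto
    qed simp
  qed
qed

text \<open>The property of a region on which the estimates rest: a connected set that avoids the
  curves does not cross the boundary. It is visibly stable under exchange of the coordinates, and
  the full disk is the case of no curves.\<close>

definition curve_separated :: "(real \<times> real) set \<Rightarrow> bool" where
  "curve_separated E \<longleftrightarrow> (\<exists>\<rho>>0. \<exists>\<C>. finite \<C> \<and> (\<forall>C\<in>\<C>. boundary_curve \<rho> C) \<and>
     (\<forall>S. connected S \<longrightarrow> S \<subseteq> ball 0 \<rho> - \<Union>\<C> \<longrightarrow> S \<subseteq> E \<or> S \<inter> E = {}))"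

text \<open>A connected set avoiding all curves avoids the two that bound \<open>Ej j\<close>, so by
  maximality of components it lies in \<open>Ej j\<close> or misses it.\<close>

lemma admissible_region_curve_separated:
  assumes "admissible_region E"
  shows "curve_separated E"
proof -
  obtain \<rho> where \<rho>: "\<rho> > 0" and E: "E = ball 0 \<rho> \<or>
        (\<exists>(q::nat) C Ej. q \<ge> 1 \<and>
           (\<forall>i<2 * q. boundary_curve \<rho> (C i)) \<and>
           (\<forall>i<2 * q. \<forall>k<2 * q. i \<noteq> k \<longrightarrow> C i \<inter> C k = {0}) \<and>
           (\<forall>j<q. Ej j \<in> components (ball 0 \<rho> - (C (2 * j) \<union> C (2 * j + 1)))) \<and>
           disjoint_family_on Ej {..<q} \<and>
           E = (\<Union>j<q. Ej j))"
    using assms unfolding admissible_region_def by blast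
  from E show ?thesis
  proof
    assume "E = ball 0 \<rho>"
    then show ?thesis unfolding curve_separated_def
      by (intro exI[of _ \<rho>] conjI \<rho> exI[of _ "{}"]) auto
  next
    assume "\<exists>(q::nat) C Ej. q \<ge> 1 \<and>
           (\<forall>i<2 * q. boundary_curve \<rho> (C i)) \<and>
           (\<forall>i<2 * q. \<forall>k<2 * q. i \<noteq> k \<longrightarrow> C i \<inter> C k = {0}) \<and>
           (\<forall>j<q. Ej j \<in> components (ball 0 \<rho> - (C (2 * j) \<union> C (2 * j + 1)))) \<and>
           disjoint_family_on Ej {..<q} \<and>
           E = (\<Union>j<q. Ej j)"
    then obtain q :: nat and C Ej where bc: "\<And>i. i < 2 * q \<Longrightarrow> boundary_curve \<rho> (C i)"
      and Ej: "\<And>j. j < q \<Longrightarrow> Ej j \<in> components (ball 0 \<rho> - (C (2 * j) \<union> C (2 * j + 1)))"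
      and E: "E = (\<Union>j<q. Ej j)" by blast
    show ?thesis unfolding curve_separated_def
    proof (intro exI[of _ \<rho>] conjI \<rho> exI[of _ "C ` {..<2*q}"] allI impI)
      show "finite (C ` {..<2*q})" by simp
      show "\<forall>C\<in>C ` {..<2*q}. boundary_curve \<rho> C" using bc by auto
      fix S :: "(real \<times> real) set" assume S: "connected S" "S \<subseteq> ball 0 \<rho> - \<Union> (C ` {..<2*q})"
      have "S \<subseteq> Ej j \<or> S \<inter> Ej j = {}" if j: "j < q" for j
      proof (cases "S \<inter> Ej j = {}")
        case False
        have "S \<subseteq> ball 0 \<rho> - (C (2 * j) \<union> C (2 * j + 1))" using S(2) j by fastforce
        then show ?thesis using components_maximal[OF Ej[OF j] S(1)] False by blast
      qed simp
      then show "S \<subseteq> E \<or> S \<inter> E = {}" unfolding E by blast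
    qed
  qed
qed

lemma boundary_curve_swap: "boundary_curve \<rho> C \<Longrightarrow> boundary_curve \<rho> (prod.swap ` C)"
proof -
  assume "boundary_curve \<rho> C"
  then obtain N h s b where *: "N > 0 \<and> s \<in> {1, -1} \<and> b > 0 \<and> h 0 = 0 \<and>
        (\<forall>t\<in>{0..root N b}. real_analytic_at h t) \<and>
        (\<forall>x\<in>{0..<b}. x\<^sup>2 + (h (root N x))\<^sup>2 < \<rho>\<^sup>2) \<and>
        b\<^sup>2 + (h (root N b))\<^sup>2 = \<rho>\<^sup>2"
    and C: "C = half_graph N h s b \<or> C = prod.swap ` half_graph N h s b"
    unfolding boundary_curve_def by blast
  from C have "prod.swap ` C = half_graph N h s b \<or> prod.swap ` C = prod.swap ` half_graph N h s b"
    by (auto simp: image_image)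
  with * show ?thesis unfolding boundary_curve_def by blast
qed

lemma curve_separated_swap:
  assumes "curve_separated E"
  shows "curve_separated (prod.swap ` E)"
proof -
  obtain \<rho> \<C> where \<rho>: "\<rho> > 0" and \<C>: "finite \<C>" "\<And>C. C \<in> \<C> \<Longrightarrow> boundary_curve \<rho> C"
    and sep: "\<And>S. connected S \<Longrightarrow> S \<subseteq> ball 0 \<rho> - \<Union>\<C> \<Longrightarrow> S \<subseteq> E \<or> S \<inter> E = {}"
    using assms unfolding curve_separated_def by blast
  show ?thesis unfolding curve_separated_def
  proof (intro exI[of _ \<rho>] conjI \<rho> exI[of _ "(`) prod.swap ` \<C>"] allI impI)
    show "finite ((`) prod.swap ` \<C>)" using \<C> by simp
    show "\<forall>C\<in>(`) prod.swap ` \<C>. boundary_curve \<rho> C" using \<C> boundary_curve_swap by auto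
    fix S :: "(real \<times> real) set" assume S: "connected S" "S \<subseteq> ball 0 \<rho> - \<Union> ((`) prod.swap ` \<C>)"
    have "connected (prod.swap ` S)"
      by (intro connected_continuous_image S(1)) (auto simp: prod.swap_def[abs_def] intro!: continuous_intros)
    moreover have "prod.swap ` S \<subseteq> ball 0 \<rho> - \<Union>\<C>"
    proof
      fix z assume "z \<in> prod.swap ` S"
      then have z: "prod.swap z \<in> S" by auto
      then have "prod.swap z \<in> ball 0 \<rho>" "prod.swap z \<notin> \<Union> ((`) prod.swap ` \<C>)" using S(2) by auto
      moreover have "norm (prod.swap z) = norm z" by (cases z) (simp add: norm_prod_def add.commute)
      ultimately show "z \<in> ball 0 \<rho> - \<Union>\<C>" by (auto simp: image_iff)
    qed
    ultimately have "prod.swap ` S \<subseteq> E \<or> prod.swap ` S \<inter> E = {}" by (rule sep)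
    then show "S \<subseteq> prod.swap ` E \<or> S \<inter> prod.swap ` E = {}"
    proof
      assume "prod.swap ` S \<subseteq> E"
      then have "prod.swap ` prod.swap ` S \<subseteq> prod.swap ` E" by (rule image_mono)
      then show ?thesis by (simp add: image_image)
    next
      assume "prod.swap ` S \<inter> E = {}"
      then have "S \<inter> prod.swap ` E = {}" by (force simp: image_iff)
      then show ?thesis ..
    qed
  qed
qed

text \<open>An open segment of a horizontal line that misses the curves is connected. The cut points
  are the curve points on the line, added up curve by curve.\<close>

lemma curve_separated_lines:
  assumes "curve_separated E"
  obtains e d where "e > 0" "\<And>y. 0 < \<bar>y\<bar> \<Longrightarrow> \<bar>y\<bar> < e \<Longrightarrow> \<exists>P. finite P \<and> card P \<le> d \<and>
    (\<forall>a b. {a<..<b} \<subseteq> {-e<..<e} - P \<longrightarrow> {a<..<b} \<times> {y} \<subseteq> E \<or> ({a<..<b} \<times> {y}) \<inter> E = {})"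
proof -
  obtain \<rho> \<C> where \<rho>: "\<rho> > 0" and \<C>: "finite \<C>" "\<And>C. C \<in> \<C> \<Longrightarrow> boundary_curve \<rho> C"
    and sep: "\<And>S. connected S \<Longrightarrow> S \<subseteq> ball 0 \<rho> - \<Union>\<C> \<Longrightarrow> S \<subseteq> E \<or> S \<inter> E = {}"
    using assms unfolding curve_separated_def by blast
  define ok where "ok = (\<lambda>C (e::real) d. e > 0 \<and> (\<forall>y. 0 < \<bar>y\<bar> \<longrightarrow> \<bar>y\<bar> < e \<longrightarrow>
    finite {x. \<bar>x\<bar> < e \<and> (x,y) \<in> C} \<and> card {x. \<bar>x\<bar> < e \<and> (x,y) \<in> C} \<le> (d::nat)))"
  have "\<exists>e d. ok C e d" if "C \<in> \<C>" for C
    by (rule boundary_curve_meets_lines[OF \<C>(2)[OF that]]) (auto simp: ok_def)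
  then obtain e d where ok: "\<And>C. C \<in> \<C> \<Longrightarrow> ok C (e C) (d C)" by metis
  \<comment> \<open>The entry \<open>\<rho>/2\<close> keeps the square of half side e0 inside the
    disk, the norm being at most |x| + |y|.\<close>
  define e0 where "e0 = Min (insert (\<rho>/2) (e ` \<C>))"
  have e0: "0 < e0" "e0 \<le> \<rho>/2" "\<And>C. C \<in> \<C> \<Longrightarrow> e0 \<le> e C"
  proof -
    show "0 < e0" unfolding e0_def using ok \<rho> \<C>(1) by (auto simp: ok_def)
    show "e0 \<le> \<rho>/2" unfolding e0_def by (rule Min_le) (use \<C>(1) in auto)
    show "e0 \<le> e C" if "C \<in> \<C>" for C unfolding e0_def by (rule Min_le) (use \<C>(1) that in auto)
  qed
  show ?thesis
  proof (rule that[OF e0(1)])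
    fix y assume y: "0 < \<bar>y\<bar>" "\<bar>y\<bar> < e0"
    define P where "P = (\<Union>C\<in>\<C>. {x. \<bar>x\<bar> < e C \<and> (x,y) \<in> C})"
    have fin: "finite {x. \<bar>x\<bar> < e C \<and> (x,y) \<in> C} \<and> card {x. \<bar>x\<bar> < e C \<and> (x,y) \<in> C} \<le> d C" if "C \<in> \<C>" for C
    proof -
      have "\<bar>y\<bar> < e C" using e0(3)[OF that] y by simp
      then show ?thesis using ok[OF that] y(1) unfolding ok_def by blast
    qed
    show "\<exists>P. finite P \<and> card P \<le> (\<Sum>C\<in>\<C>. d C) \<and>
    (\<forall>a b. {a<..<b} \<subseteq> {-e0<..<e0} - P \<longrightarrow> {a<..<b} \<times> {y} \<subseteq> E \<or> ({a<..<b} \<times> {y}) \<inter> E = {})"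
    proof (intro exI[of _ P] conjI allI impI)
      show "finite P" unfolding P_def using fin \<C>(1) by blast
      have "card P \<le> (\<Sum>C\<in>\<C>. card {x. \<bar>x\<bar> < e C \<and> (x,y) \<in> C})"
        unfolding P_def by (rule card_UN_le[OF \<C>(1)])
      also have "\<dots> \<le> (\<Sum>C\<in>\<C>. d C)" using fin by (intro sum_mono) blast
      finally show "card P \<le> (\<Sum>C\<in>\<C>. d C)" .
      fix a b assume ab: "{a<..<b} \<subseteq> {-e0<..<e0} - P"
      have "connected ({a<..<b} \<times> {y})"
        by (intro connected_Times) auto
      moreover have "{a<..<b} \<times> {y} \<subseteq> ball 0 \<rho> - \<Union>\<C>"
      proof
        fix z assume "z \<in> {a<..<b} \<times> {y}"
        then obtain x where z: "z = (x,y)" and x: "x \<in> {a<..<b}" by auto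
        have xe: "\<bar>x\<bar> < e0" and xP: "x \<notin> P" using subsetD[OF ab x] by auto
        have "norm z \<le> \<bar>x\<bar> + \<bar>y\<bar>" unfolding z using norm_Pair_le[of x y] by simp
        then have "z \<in> ball 0 \<rho>" using xe y e0(2) by simp
        moreover have "z \<notin> C" if "C \<in> \<C>" for C
          using xP e0(3)[OF that] xe that by (force simp: P_def z)
        ultimately show "z \<in> ball 0 \<rho> - \<Union>\<C>" by blast
      qed
      ultimately show "{a<..<b} \<times> {y} \<subseteq> E \<or> ({a<..<b} \<times> {y}) \<inter> E = {}" by (rule sep)
    qed
  qed
qed

section \<open>Shift differences in one variable\<close>

text \<open>This is min(1, d/|s|) with the value 1 at s = 0; the case distinction is needed because
  d / 0 = 0.\<close>

definition wt :: "real \<Rightarrow> real \<Rightarrow> real" where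
  "wt d s = (if \<bar>s\<bar> \<le> d then 1 else d / \<bar>s\<bar>)"

lemma wt_measurable [measurable]: "wt d \<in> borel_measurable borel"
  unfolding wt_def by measurable

lemma wt_nonneg: "0 \<le> d \<Longrightarrow> 0 \<le> wt d s"
  by (simp add: wt_def)

lemma wt_eq_1: "\<bar>s\<bar> \<le> d \<Longrightarrow> wt d s = 1"
  by (simp add: wt_def)

lemma nn_integral_lborel_shift:
  fixes f :: "'a::euclidean_space \<Rightarrow> ennreal"
  assumes [measurable]: "f \<in> borel_measurable borel"
  shows "(\<integral>\<^sup>+x. f (x + d) \<partial>lborel) = (\<integral>\<^sup>+x. f x \<partial>lborel)"
proof -
  have "(\<integral>\<^sup>+x. f x \<partial>lborel) = (\<integral>\<^sup>+x. f x \<partial>distr lborel borel ((+) d))"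
    by (subst lborel_distr_plus) simp
  also have "\<dots> = (\<integral>\<^sup>+x. f (d + x) \<partial>lborel)"
    by (rule nn_integral_distr) measurable
  finally show ?thesis by (simp add: add.commute)
qed

lemma AE_lborel_shift:
  fixes d :: "'a::euclidean_space"
  assumes "AE x in lborel. P x"
  shows "AE x in lborel. P (x + d)"
proof -
  have "AE x in distr lborel borel ((+) d). P x" using assms by (subst lborel_distr_plus)
  from AE_distrD[OF _ this] show ?thesis by (simp add: add.commute)
qed

text \<open>Subtraction on \<open>ennreal\<close> is truncated, so the shift estimates are phrased
  with the subtracted terms moved to the other side; this lifts such a real inequality.\<close>

lemma ennreal_add_le_add_twice:
  assumes "0 \<le> a" "0 \<le> b" "0 \<le> c" "0 \<le> e" "a + b \<le> c + 2 * e"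
  shows "ennreal a + ennreal b \<le> ennreal c + 2 * ennreal e"
proof -
  have "ennreal a + ennreal b = ennreal (a + b)" using assms by simp
  also have "\<dots> \<le> ennreal (c + 2 * e)" using assms by (intro ennreal_leI)
  also have "\<dots> = ennreal c + 2 * ennreal e" using assms by (simp add: ennreal_mult)
  finally show ?thesis .
qed

text \<open>For \<open>h\<close> increasing on the interval, \<open>\<bar>h(x + d) - h(x)\<bar>\<close> exceeds \<open>h(x + d) - h(x)\<close>, whose integral
  vanishes, only for \<open>x\<close> within \<open>d\<close> of \<open>v\<close>.\<close>

lemma nn_integral_shift_diff_monotone:
  fixes h :: "real \<Rightarrow> real"
  assumes d: "d > 0" and h [measurable]: "h \<in> borel_measurable borel"
    and pos: "\<And>x. 0 \<le> h x" and out: "\<And>x. x \<notin> {u<..<v} \<Longrightarrow> h x = 0"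
    and mono: "mono_on {u<..<v} h \<or> antimono_on {u<..<v} h"
    and S: "\<And>q. q \<in> {u, v} \<Longrightarrow> (\<integral>\<^sup>+x. ennreal (h x * wt d (x - q)) \<partial>lborel) \<le> S"
  shows "(\<integral>\<^sup>+x. ennreal \<bar>h (x + d) - h x\<bar> \<partial>lborel) \<le> 2 * S"
proof (cases "S = \<infinity> \<or> v \<le> u")
  case True
  then show ?thesis
  proof
    assume "v \<le> u"
    then have "h x = 0" for x by (intro out) auto
    then show ?thesis by simp
  qed (simp add: ennreal_mult_top)
next
  case False
  then have Sfin: "S < \<infinity>" and uv: "u < v" by (auto simp: less_top)
  \<comment> \<open>On the interval the weight is at least 1 / ?L. A finite S thus makes the plain
    integral of h finite, which is required for cancelling it in \<open>ennreal\<close>.\<close>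
  let ?L = "(d + (v - u)) / d"
  have "ennreal (h x) \<le> ennreal ?L * ennreal (h x * wt d (x - u))" for x
  proof (cases "x \<in> {u<..<v}")
    case True
    have "1 \<le> ?L * wt d (x - u)"
    proof (cases "\<bar>x - u\<bar> \<le> d")
      case True
      then show ?thesis using d uv by (simp add: wt_def)
    next
      case False
      then have "?L * wt d (x - u) = (d + (v - u)) / (x - u)"
        using \<open>x \<in> _\<close> d by (simp add: wt_def)
      then show ?thesis using \<open>x \<in> _\<close> d by simp
    qed
    then have "h x * 1 \<le> h x * (?L * wt d (x - u))" by (intro mult_left_mono pos)
    then show ?thesis
      using d uv pos by (subst ennreal_mult[symmetric]) (auto simp: wt_nonneg mult_ac intro!: ennreal_leI)
  qed (simp add: out)
  then have "(\<integral>\<^sup>+x. ennreal (h x) \<partial>lborel) \<le> (\<integral>\<^sup>+x. ennreal ?L * ennreal (h x * wt d (x - u)) \<partial>lborel)"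
    by (intro nn_integral_mono)
  also have "\<dots> = ennreal ?L * (\<integral>\<^sup>+x. ennreal (h x * wt d (x - u)) \<partial>lborel)"
    by (rule nn_integral_cmult) measurable
  also have "\<dots> \<le> ennreal ?L * S" by (intro mult_left_mono S) auto
  also have "\<dots> < \<infinity>" using Sfin by (simp add: ennreal_mult_less_top)
  finally have fin: "(\<integral>\<^sup>+x. ennreal (h x) \<partial>lborel) \<noteq> \<infinity>" by simp
  have shift: "(\<integral>\<^sup>+x. ennreal (h (x + d)) \<partial>lborel) = (\<integral>\<^sup>+x. ennreal (h x) \<partial>lborel)"
    by (rule nn_integral_lborel_shift) measurable
  from mono show ?thesis
  proof
    assume m: "mono_on {u<..<v} h"
    \<comment> \<open>For x inside the interval: if x + d < v, the left side is exactly h(x + d).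
      Otherwise h(x + d) = 0 and the left side is 2 h(x), covered by the weight, which is 1 within d
      of v.\<close>
    have "ennreal \<bar>h (x + d) - h x\<bar> + ennreal (h x) \<le> ennreal (h (x + d)) + 2 * ennreal (h x * wt d (x - v))" for x
    proof -
      have "\<bar>h (x + d) - h x\<bar> + h x \<le> h (x + d) + 2 * (h x * wt d (x - v))"
      proof (cases "x \<in> {u<..<v}")
        case True
        show ?thesis
        proof (cases "x + d < v")
          case True
          then have "h x \<le> h (x + d)" using \<open>x \<in> _\<close> d by (intro mono_onD[OF m]) auto
          then show ?thesis using pos[of x] d by (simp add: wt_nonneg)
        next
          case False
          then have "wt d (x - v) = 1" using \<open>x \<in> _\<close> d by (intro wt_eq_1) auto
          then show ?thesis using pos[of x] out[of "x + d"] False by auto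
        qed
      qed (use pos[of "x + d"] in \<open>simp add: out\<close>)
      then show ?thesis using d by (intro ennreal_add_le_add_twice mult_nonneg_nonneg pos wt_nonneg) auto
    qed
    then have "(\<integral>\<^sup>+x. ennreal \<bar>h (x + d) - h x\<bar> + ennreal (h x) \<partial>lborel) \<le>
       (\<integral>\<^sup>+x. ennreal (h (x + d)) + 2 * ennreal (h x * wt d (x - v)) \<partial>lborel)"
      by (intro nn_integral_mono)
    then have "(\<integral>\<^sup>+x. ennreal (h x) \<partial>lborel) + (\<integral>\<^sup>+x. ennreal \<bar>h (x + d) - h x\<bar> \<partial>lborel) \<le>
       (\<integral>\<^sup>+x. ennreal (h x) \<partial>lborel) + 2 * (\<integral>\<^sup>+x. ennreal (h x * wt d (x - v)) \<partial>lborel)"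
      by (simp add: nn_integral_add nn_integral_cmult shift add.commute)
    then have "(\<integral>\<^sup>+x. ennreal \<bar>h (x + d) - h x\<bar> \<partial>lborel) \<le> 2 * (\<integral>\<^sup>+x. ennreal (h x * wt d (x - v)) \<partial>lborel)"
      using fin by (simp add: ennreal_add_left_cancel_le)
    also have "\<dots> \<le> 2 * S" by (intro mult_left_mono S) auto
    finally show ?thesis .
  next
    assume m: "antimono_on {u<..<v} h"
    \<comment> \<open>In the decreasing case the excess occurs where x + d is within d of u, so the
      weight is taken at the shifted point and later translated back.\<close>
    have "ennreal \<bar>h (x + d) - h x\<bar> + ennreal (h (x + d)) \<le> ennreal (h x) + 2 * ennreal (h (x + d) * wt d (x + d - u))" for x
    proof -
      have "\<bar>h (x + d) - h x\<bar> + h (x + d) \<le> h x + 2 * (h (x + d) * wt d (x + d - u))"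
      proof (cases "x + d \<in> {u<..<v}")
        case True
        show ?thesis
        proof (cases "u < x")
          case True
          then have "h (x + d) \<le> h x" using \<open>x + d \<in> _\<close> d by (intro monotone_onD[OF m]) auto
          then show ?thesis using pos[of "x + d"] d by (simp add: wt_nonneg)
        next
          case False
          then have "wt d (x + d - u) = 1" using \<open>x + d \<in> _\<close> d by (intro wt_eq_1) auto
          then show ?thesis using pos[of "x + d"] out[of x] False by auto
        qed
      qed (use pos[of x] in \<open>simp add: out\<close>)
      then show ?thesis using d by (intro ennreal_add_le_add_twice mult_nonneg_nonneg pos wt_nonneg) auto
    qed
    then have "(\<integral>\<^sup>+x. ennreal \<bar>h (x + d) - h x\<bar> + ennreal (h (x + d)) \<partial>lborel) \<le>
       (\<integral>\<^sup>+x. ennreal (h x) + 2 * ennreal (h (x + d) * wt d (x + d - u)) \<partial>lborel)"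
      by (intro nn_integral_mono)
    moreover have "(\<integral>\<^sup>+x. ennreal (h (x + d) * wt d (x + d - u)) \<partial>lborel) = (\<integral>\<^sup>+x. ennreal (h x * wt d (x - u)) \<partial>lborel)"
      by (rule nn_integral_lborel_shift[of "\<lambda>x. ennreal (h x * wt d (x - u))"]) measurable
    ultimately have "(\<integral>\<^sup>+x. ennreal (h x) \<partial>lborel) + (\<integral>\<^sup>+x. ennreal \<bar>h (x + d) - h x\<bar> \<partial>lborel) \<le>
       (\<integral>\<^sup>+x. ennreal (h x) \<partial>lborel) + 2 * (\<integral>\<^sup>+x. ennreal (h x * wt d (x - u)) \<partial>lborel)"
      by (simp add: nn_integral_add nn_integral_cmult shift add.commute)
    then have "(\<integral>\<^sup>+x. ennreal \<bar>h (x + d) - h x\<bar> \<partial>lborel) \<le> 2 * (\<integral>\<^sup>+x. ennreal (h x * wt d (x - u)) \<partial>lborel)"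
      using fin by (simp add: ennreal_add_left_cancel_le)
    also have "\<dots> \<le> 2 * S" by (intro mult_left_mono S) auto
    finally show ?thesis .
  qed
qed

text \<open>The trivial bound 2 A is combined with the mean value bound over [x, x + d]. As c lies
  outside the interval, the derivative bound is largest at the end nearer to c: x if c is to the
  left, x + d if it is to the right.\<close>

lemma norm_diff_le_of_deriv_bound:
  fixes \<alpha> \<alpha>' :: "real \<Rightarrow> complex"
  assumes d: "d > 0" and c: "c \<notin> {u<..<v}" and x: "u < x" "x + d < v"
    and bd: "\<And>x. x \<in> {u<..<v} \<Longrightarrow> norm (\<alpha> x) \<le> A"
    and der: "\<And>x. x \<in> {u<..<v} \<Longrightarrow> (\<alpha> has_vector_derivative \<alpha>' x) (at x)"
    and bd': "\<And>x. x \<in> {u<..<v} \<Longrightarrow> norm (\<alpha>' x) \<le> A / \<bar>x - c\<bar>"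
  shows "norm (\<alpha> (x + d) - \<alpha> x) \<le> 2 * A * wt d ((if c \<le> u then x else x + d) - c)"
proof -
  let ?y = "if c \<le> u then x else x + d"
  have A: "A \<ge> 0" using bd[of x] x d by (auto intro: order_trans[OF norm_ge_zero])
  have c': "c \<le> u \<or> v \<le> c" using c by auto
  have "norm (\<alpha> (x + d) - \<alpha> x) \<le> norm (\<alpha> (x + d)) + norm (\<alpha> x)" by (rule norm_triangle_ineq4)
  also have "\<dots> \<le> 2 * A" using bd[of x] bd[of "x + d"] x d by simp
  finally have 1: "norm (\<alpha> (x + d) - \<alpha> x) \<le> 2 * A" .
  have "norm (\<alpha> (x + d) - \<alpha> x) \<le> (A / \<bar>?y - c\<bar>) * norm ((x + d) - x)"
  proof (rule differentiable_bound[where S="{x..x+d}" and f'="\<lambda>z h. h *\<^sub>R \<alpha>' z"])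
    fix z assume z: "z \<in> {x..x+d}"
    then have zuv: "z \<in> {u<..<v}" using x by auto
    show "(\<alpha> has_derivative (\<lambda>h. h *\<^sub>R \<alpha>' z)) (at z within {x..x+d})"
      using has_vector_derivative_at_within[OF der[OF zuv]] by (simp add: has_vector_derivative_def)
    have "norm (\<alpha>' z) \<le> A / \<bar>z - c\<bar>" by (rule bd'[OF zuv])
    also have "\<dots> \<le> A / \<bar>?y - c\<bar>"
      using c' z x d A by (intro divide_left_mono mult_pos_pos) auto
    finally have "norm (\<alpha>' z) \<le> A / \<bar>?y - c\<bar>" .
    then show "onorm (\<lambda>h. h *\<^sub>R \<alpha>' z) \<le> A / \<bar>?y - c\<bar>"
    proof (intro onorm_le)
      fix h :: real
      have "norm (h *\<^sub>R \<alpha>' z) = norm (\<alpha>' z) * norm h" by simp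
      also have "\<dots> \<le> (A / \<bar>?y - c\<bar>) * norm h"
        by (intro mult_right_mono) (use \<open>norm (\<alpha>' z) \<le> A / \<bar>?y - c\<bar>\<close> in auto)
      finally show "norm (h *\<^sub>R \<alpha>' z) \<le> (A / \<bar>?y - c\<bar>) * norm h" .
    qed
  qed (use d in auto)
  then have 2: "norm (\<alpha> (x + d) - \<alpha> x) \<le> A * d / \<bar>?y - c\<bar>" using d by simp
  moreover have "0 \<le> A * d / \<bar>?y - c\<bar>" using A d by (intro divide_nonneg_nonneg mult_nonneg_nonneg) auto
  ultimately have "norm (\<alpha> (x + d) - \<alpha> x) \<le> 2 * (A * d / \<bar>?y - c\<bar>)" by linarith
  with 1 show ?thesis unfolding wt_def by (cases "\<bar>?y - c\<bar> \<le> d") simp_all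
qed

text \<open>If both points lie in the interval, a discrete product rule separates the difference of
  h from that of \<alpha>. The first part costs A times the bound 2 S for monotone functions, the
  second 2 A S, together 4 A S. If only one point lies inside, \<open>k\<close> is 0 at the other
  and the first part suffices.\<close>

lemma nn_integral_shift_diff_piece:
  fixes \<psi> \<alpha> \<alpha>' :: "real \<Rightarrow> complex" and h :: "real \<Rightarrow> real"
  assumes d: "d > 0" and A: "A \<ge> 0" and c: "c \<notin> {u<..<v}"
    and hm [measurable]: "h \<in> borel_measurable borel" and pos: "\<And>x. 0 \<le> h x"
    and mono: "mono_on {u<..<v} h \<or> antimono_on {u<..<v} h"
    and bd: "\<And>x. x \<in> {u<..<v} \<Longrightarrow> norm (\<alpha> x) \<le> A"
    and der: "\<And>x. x \<in> {u<..<v} \<Longrightarrow> (\<alpha> has_vector_derivative \<alpha>' x) (at x)"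
    and bd': "\<And>x. x \<in> {u<..<v} \<Longrightarrow> norm (\<alpha>' x) \<le> A / \<bar>x - c\<bar>"
    and \<psi>: "AE x in lborel. x \<in> {u<..<v} \<longrightarrow> \<psi> x = \<alpha> x * complex_of_real (h x)"
    and S: "\<And>q. q \<in> {u, v, c} \<Longrightarrow> (\<integral>\<^sup>+x\<in>{u<..<v}. ennreal (h x * wt d (x - q)) \<partial>lborel) \<le> S"
  shows "(\<integral>\<^sup>+x. ennreal (norm (indicator {u<..<v} (x + d) * \<psi> (x + d) - indicator {u<..<v} x * \<psi> x)) \<partial>lborel)
    \<le> ennreal (4 * A) * S"
proof -
  define k where "k x = indicator {u<..<v} x * h x" for x
  have k [measurable]: "k \<in> borel_measurable borel" unfolding k_def by measurable
  have kpos: "0 \<le> k x" for x unfolding k_def by (simp add: pos)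
  have kS: "(\<integral>\<^sup>+x. ennreal (k x * wt d (x - q)) \<partial>lborel) \<le> S" if "q \<in> {u, v, c}" for q
  proof -
    have "(\<integral>\<^sup>+x. ennreal (k x * wt d (x - q)) \<partial>lborel) = (\<integral>\<^sup>+x\<in>{u<..<v}. ennreal (h x * wt d (x - q)) \<partial>lborel)"
      by (intro nn_integral_cong) (auto simp: k_def indicator_def)
    then show ?thesis using S[OF that] by simp
  qed
  have kV: "(\<integral>\<^sup>+x. ennreal \<bar>k (x + d) - k x\<bar> \<partial>lborel) \<le> 2 * S"
  proof (rule nn_integral_shift_diff_monotone[OF d k kpos])
    show "mono_on {u<..<v} k \<or> antimono_on {u<..<v} k"
      using mono by (auto simp: k_def monotone_on_def)
  qed (use kS in \<open>auto simp: k_def\<close>)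
  \<comment> \<open>In the product rule h is kept at the end of [x, x + d] nearer to c, where the
    weight is evaluated too; translation by ?s then yields a weighted integral bounded by S.\<close>
  let ?s = "if c \<le> u then 0 else d"
  have kc: "(\<integral>\<^sup>+x. ennreal (k (x + ?s) * wt d (x + ?s - c)) \<partial>lborel) \<le> S"
    using nn_integral_lborel_shift[of "\<lambda>x. ennreal (k x * wt d (x - c))" ?s] kS[of c] by simp
  have \<psi>': "AE x in lborel. x + d \<in> {u<..<v} \<longrightarrow> \<psi> (x + d) = \<alpha> (x + d) * complex_of_real (h (x + d))"
    using AE_lborel_shift[OF \<psi>] .
  have "(\<integral>\<^sup>+x. ennreal (norm (indicator {u<..<v} (x + d) * \<psi> (x + d) - indicator {u<..<v} x * \<psi> x)) \<partial>lborel)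
     \<le> (\<integral>\<^sup>+x. ennreal A * ennreal \<bar>k (x + d) - k x\<bar> + ennreal (2 * A) * ennreal (k (x + ?s) * wt d (x + ?s - c)) \<partial>lborel)"
    using \<psi> \<psi>'
  proof (intro nn_integral_mono_AE, eventually_elim)
    case (elim x)
    have "norm (indicator {u<..<v} (x + d) * \<psi> (x + d) - indicator {u<..<v} x * \<psi> x)
       \<le> A * \<bar>k (x + d) - k x\<bar> + 2 * A * (k (x + ?s) * wt d (x + ?s - c))"
    proof (cases "x \<in> {u<..<v} \<and> x + d \<in> {u<..<v}")
      case False
      have "0 \<le> 2 * A * (k (x + ?s) * wt d (x + ?s - c))"
        using A d kpos by (intro mult_nonneg_nonneg wt_nonneg) auto
      moreover have "norm (indicator {u<..<v} (x + d) * \<psi> (x + d) - indicator {u<..<v} x * \<psi> x) \<le> A * \<bar>k (x + d) - k x\<bar>"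
        using False elim bd[of x] bd[of "x + d"] pos[of x] pos[of "x + d"]
        by (auto simp: k_def indicator_def norm_mult intro!: mult_right_mono)
      ultimately show ?thesis by linarith
    next
      case True
      then have in1: "x \<in> {u<..<v}" and in2: "x + d \<in> {u<..<v}" by auto
      have e: "norm (\<alpha> (x + d) - \<alpha> x) \<le> 2 * A * wt d (x + ?s - c)"
        using norm_diff_le_of_deriv_bound[OF d c _ _ bd der bd', of x] in1 in2 by (auto split: if_splits)
      have "norm (\<alpha> (x + d) * complex_of_real (h (x + d)) - \<alpha> x * complex_of_real (h x))
          \<le> A * \<bar>h (x + d) - h x\<bar> + norm (\<alpha> (x + d) - \<alpha> x) * h (x + ?s)"
      proof (cases "c \<le> u")
        case True
        have "\<alpha> (x + d) * complex_of_real (h (x + d)) - \<alpha> x * complex_of_real (h x) =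
          \<alpha> (x + d) * complex_of_real (h (x + d) - h x) + (\<alpha> (x + d) - \<alpha> x) * complex_of_real (h x)"
          by (simp add: algebra_simps)
        also have "norm \<dots> \<le> norm (\<alpha> (x + d)) * \<bar>h (x + d) - h x\<bar> + norm (\<alpha> (x + d) - \<alpha> x) * h x"
          by (rule order_trans[OF norm_triangle_ineq]) (simp add: norm_mult pos del: of_real_diff)
        also have "\<dots> \<le> A * \<bar>h (x + d) - h x\<bar> + norm (\<alpha> (x + d) - \<alpha> x) * h x"
          by (intro add_right_mono mult_right_mono bd in2) auto
        finally show ?thesis using True by simp
      next
        case False
        have "\<alpha> (x + d) * complex_of_real (h (x + d)) - \<alpha> x * complex_of_real (h x) =
          \<alpha> x * complex_of_real (h (x + d) - h x) + (\<alpha> (x + d) - \<alpha> x) * complex_of_real (h (x + d))"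
          by (simp add: algebra_simps)
        also have "norm \<dots> \<le> norm (\<alpha> x) * \<bar>h (x + d) - h x\<bar> + norm (\<alpha> (x + d) - \<alpha> x) * h (x + d)"
          by (rule order_trans[OF norm_triangle_ineq]) (simp add: norm_mult pos del: of_real_diff)
        also have "\<dots> \<le> A * \<bar>h (x + d) - h x\<bar> + norm (\<alpha> (x + d) - \<alpha> x) * h (x + d)"
          by (intro add_right_mono mult_right_mono bd in1) auto
        finally show ?thesis using False by simp
      qed
      also have "\<dots> \<le> A * \<bar>h (x + d) - h x\<bar> + (2 * A * wt d (x + ?s - c)) * h (x + ?s)"
        by (intro add_left_mono mult_right_mono e pos)
      finally show ?thesis using elim in1 in2 by (simp add: k_def mult_ac)
    qed
    then have "ennreal (norm (indicator {u<..<v} (x + d) * \<psi> (x + d) - indicator {u<..<v} x * \<psi> x))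
       \<le> ennreal (A * \<bar>k (x + d) - k x\<bar> + 2 * A * (k (x + ?s) * wt d (x + ?s - c)))"
      by (rule ennreal_leI)
    also have "\<dots> = ennreal A * ennreal \<bar>k (x + d) - k x\<bar> + ennreal (2 * A) * ennreal (k (x + ?s) * wt d (x + ?s - c))"
      using A d kpos by (subst ennreal_plus) (auto simp: ennreal_mult wt_nonneg intro!: mult_nonneg_nonneg)
    finally show ?case .
  qed
  also have "\<dots> = ennreal A * (\<integral>\<^sup>+x. ennreal \<bar>k (x + d) - k x\<bar> \<partial>lborel) +
      ennreal (2 * A) * (\<integral>\<^sup>+x. ennreal (k (x + ?s) * wt d (x + ?s - c)) \<partial>lborel)"
    by (subst nn_integral_add; (subst nn_integral_cmult)?; (subst nn_integral_cmult)?; simp?)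
  also have "\<dots> \<le> ennreal A * (2 * S) + ennreal (2 * A) * S"
    by (intro add_mono mult_left_mono kV kc) auto
  also have "\<dots> = ennreal (4 * A) * S"
  proof -
    have "ennreal (2 * A) = ennreal A * 2" "ennreal (4 * A) = ennreal A * 4"
      using A by (simp_all add: ennreal_mult mult.commute)
    moreover have "(4::ennreal) = 2 + 2" by simp
    ultimately show ?thesis by (simp only: distrib_left distrib_right mult.assoc)
  qed
  finally show ?thesis .
qed

text \<open>Induction on the largest cut point p: to its right no cut point remains, so that part
  costs a single B, and the part to its left has one cut point fewer.\<close>

lemma nn_integral_shift_diff_pieces:
  fixes \<psi> :: "real \<Rightarrow> complex"
  assumes [measurable]: "\<psi> \<in> borel_measurable borel"
    and P: "finite P"
    and B: "\<And>u v. u < v \<Longrightarrow> {u<..<v} \<subseteq> {a<..<b} - P \<Longrightarrow>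
      (\<integral>\<^sup>+x. ennreal (norm (indicator {u<..<v} (x + d) * \<psi> (x + d) - indicator {u<..<v} x * \<psi> x)) \<partial>lborel) \<le> B"
  shows "(\<integral>\<^sup>+x. ennreal (norm (indicator {a<..<b} (x + d) * \<psi> (x + d) - indicator {a<..<b} x * \<psi> x)) \<partial>lborel)
    \<le> of_nat (Suc (card P)) * B"
  using P B
proof (induction arbitrary: b rule: finite_linorder_max_induct)
  case empty
  show ?case
  proof (cases "a < b")
    case True
    then show ?thesis using empty by simp
  qed simp
next
  case (insert p P)
  let ?T = "\<lambda>u v. (\<integral>\<^sup>+x. ennreal (norm (indicator {u<..<v} (x + d) * \<psi> (x + d) - indicator {u<..<v} x * \<psi> x)) \<partial>lborel)"
  have pP: "p \<notin> P" using insert by auto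
  show ?case
  proof (cases "p \<in> {a<..<b}")
    case False
    have "?T a b \<le> of_nat (Suc (card P)) * B"
    proof (rule insert.IH)
      fix u v assume "u < v" "{u<..<v} \<subseteq> {a<..<b} - P"
      then show "?T u v \<le> B" using False by (intro insert.prems) auto
    qed
    also have "\<dots> \<le> of_nat (Suc (card (insert p P))) * B"
      using insert pP by (intro mult_right_mono) auto
    finally show ?thesis .
  next
    case True
    have 1: "?T a p \<le> of_nat (Suc (card P)) * B"
    proof (rule insert.IH)
      fix u v assume "u < v" "{u<..<v} \<subseteq> {a<..<p} - P"
      then show "?T u v \<le> B" using True by (intro insert.prems) auto
    qed
    have 2: "?T p b \<le> B"
      using True insert.hyps by (intro insert.prems) auto
    \<comment> \<open>The indicator of (a, b) is the sum of those of (a, p) and (p, b) except at p;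
      it is evaluated at x and at x + d, hence two excluded points.\<close>
    have ne: "AE x in lborel. x \<noteq> p \<and> x \<noteq> p - d"
      by (intro AE_conjI AE_lborel_singleton)
    have "?T a b \<le> (\<integral>\<^sup>+x. ennreal (norm (indicator {a<..<p} (x + d) * \<psi> (x + d) - indicator {a<..<p} x * \<psi> x)) +
       ennreal (norm (indicator {p<..<b} (x + d) * \<psi> (x + d) - indicator {p<..<b} x * \<psi> x)) \<partial>lborel)"
    proof (rule nn_integral_mono_AE, use ne in eventually_elim)
      case (elim x)
      have i: "indicator {a<..<b} z = (indicator {a<..<p} z + indicator {p<..<b} z :: complex)" if "z \<noteq> p" for z
        using True that by (auto simp: indicator_def)
      have "indicator {a<..<b} (x + d) * \<psi> (x + d) - indicator {a<..<b} x * \<psi> x =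
         (indicator {a<..<p} (x + d) * \<psi> (x + d) - indicator {a<..<p} x * \<psi> x) +
         (indicator {p<..<b} (x + d) * \<psi> (x + d) - indicator {p<..<b} x * \<psi> x)"
        using elim by (subst (1 2) i) (auto simp: algebra_simps)
      then show ?case
        by (simp add: ennreal_plus[symmetric] norm_triangle_ineq ennreal_leI del: ennreal_plus)
    qed
    also have "\<dots> = ?T a p + ?T p b" by (rule nn_integral_add) measurable
    also have "\<dots> \<le> of_nat (Suc (card P)) * B + B" by (intro add_mono 1 2)
    also have "\<dots> = of_nat (Suc (card (insert p P))) * B"
      using insert pP by (simp add: algebra_simps)
    finally show ?thesis .
  qed
qed

text \<open>For p = \<infinity> the essential bound by B is encoded as finiteness of an integral
  with values 0 and \<infinity>, so both cases can be integrated over lines and squares in the same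
  way.\<close>

definition Lp_cost :: "ennreal \<Rightarrow> real \<Rightarrow> real \<Rightarrow> ennreal" where
  "Lp_cost p B t = (if p = \<infinity> then (if t \<le> B then 0 else \<infinity>) else ennreal (t powr enn2real p))"

text \<open>For finite p this is d^(1/p'). For p = \<infinity> and d \<le> 1 it is the integral of
  \<open>wt d\<close> over [0, 1].\<close>

definition rate :: "ennreal \<Rightarrow> real \<Rightarrow> real" where
  "rate p d = (if p = \<infinity> then d * (1 + ln (1 / d)) else d powr (1 - 1 / enn2real p))"

lemma Lp_cost_measurable [measurable]: "Lp_cost p B \<in> borel_measurable borel"
  unfolding Lp_cost_def by measurable

lemma rate_pos:
  assumes "0 < d" "d \<le> 1/2"
  shows "0 < rate p d"
proof -
  have "0 \<le> ln (1 / d)" using assms by simp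
  then show ?thesis using assms by (auto simp: rate_def intro!: mult_pos_pos add_pos_nonneg)
qed

section \<open>Integrals against the weight\<close>

lemma wt_scale: "d > 0 \<Longrightarrow> wt d (d * t) = wt 1 t"
  by (auto simp: wt_def abs_mult mult_le_cancel_left1 field_simps)

lemma nn_integral_even:
  fixes f :: "real \<Rightarrow> ennreal"
  assumes "f \<in> borel_measurable borel" "\<And>x. f (- x) = f x"
  shows "(\<integral>\<^sup>+x\<in>{..0}. f x \<partial>lborel) = (\<integral>\<^sup>+x\<in>{0..}. f x \<partial>lborel)"
proof -
  have [measurable]: "f \<in> borel_measurable borel" by fact
  have "(\<integral>\<^sup>+x. f x * indicator {..0} x \<partial>lborel) = (\<integral>\<^sup>+x. f (- x) * indicator {..0} (- x) \<partial>lborel)"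
    using nn_integral_real_affine[of "\<lambda>x. f x * indicator {..0} x" "-1" 0] by simp
  also have "\<dots> = (\<integral>\<^sup>+x. f x * indicator {0..} x \<partial>lborel)"
    by (intro nn_integral_cong) (auto simp: assms indicator_def)
  finally show ?thesis .
qed

lemma nn_integral_le_twice_half_line:
  fixes f :: "real \<Rightarrow> ennreal"
  assumes [measurable]: "f \<in> borel_measurable borel" and "\<And>x. f (- x) = f x"
  shows "(\<integral>\<^sup>+x. f x \<partial>lborel) \<le> 2 * (\<integral>\<^sup>+x\<in>{0..}. f x \<partial>lborel)"
proof -
  have "(\<integral>\<^sup>+x. f x \<partial>lborel) \<le> (\<integral>\<^sup>+x. f x * indicator {..0} x + f x * indicator {0..} x \<partial>lborel)"
    by (intro nn_integral_mono) (auto simp: indicator_def)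
  also have "\<dots> = (\<integral>\<^sup>+x\<in>{..0}. f x \<partial>lborel) + (\<integral>\<^sup>+x\<in>{0..}. f x \<partial>lborel)"
    by (rule nn_integral_add) measurable
  finally show ?thesis using nn_integral_even[OF assms] by (simp add: mult_2)
qed

text \<open>The weight decays like 1/|t|, so a power above 1 is integrable over the whole line. It
  is applied to the conjugate exponent of a finite p.\<close>

lemma nn_integral_wt_powr_finite:
  assumes q: "q > 1"
  shows "(\<integral>\<^sup>+t. ennreal (wt 1 t powr q) \<partial>lborel) < \<infinity>"
proof -
  have "(\<integral>\<^sup>+t. ennreal (wt 1 t powr q) \<partial>lborel) \<le> 2 * (\<integral>\<^sup>+t\<in>{0..}. ennreal (wt 1 t powr q) \<partial>lborel)"
    by (rule nn_integral_le_twice_half_line) (auto simp: wt_def)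
  also have "(\<integral>\<^sup>+t\<in>{0..}. ennreal (wt 1 t powr q) \<partial>lborel) \<le>
     (\<integral>\<^sup>+t. indicator {0..1} t + ennreal (t powr (- q)) * indicator {1..} t \<partial>lborel)"
    by (intro nn_integral_mono) (auto simp: wt_def indicator_def powr_minus powr_divide inverse_eq_divide)
  also have "\<dots> = 1 + (\<integral>\<^sup>+t\<in>{1..}. ennreal (t powr (- q)) \<partial>lborel)"
    by (subst nn_integral_add) auto
  also have "(\<integral>\<^sup>+t\<in>{1..}. ennreal (t powr (- q)) \<partial>lborel) = ennreal (0 - (- (1 powr (1 - q) / (q - 1))))"
  proof (rule nn_integral_FTC_atLeast[where F="\<lambda>t. - (t powr (1 - q) / (q - 1))"])
    show "((\<lambda>t. - (t powr (1 - q) / (q - 1))) has_real_derivative t powr - q) (at t)" if "1 \<le> t" for t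
    proof -
      have "((\<lambda>t. - (t powr (1 - q) / (q - 1))) has_real_derivative - ((1 - q) * t powr (1 - q - 1) / (q - 1))) (at t)"
        by (intro DERIV_minus DERIV_cdivide has_real_derivative_powr) (use that in auto)
      moreover have "- ((1 - q) * t powr (1 - q - 1) / (q - 1)) = t powr - q"
        using q by (simp add: field_simps)
      ultimately show ?thesis by simp
    qed
    have "((\<lambda>t. t powr (1 - q)) \<longlongrightarrow> 0) at_top"
      by (rule tendsto_neg_powr) (use q in \<open>auto intro: filterlim_ident\<close>)
    from tendsto_minus[OF tendsto_divide[OF this tendsto_const, of "q - 1"]] q
    show "((\<lambda>t. - (t powr (1 - q) / (q - 1))) \<longlongrightarrow> 0) at_top" by simp
  qed auto
  finally have "(\<integral>\<^sup>+t. ennreal (wt 1 t powr q) \<partial>lborel) \<le> 2 * (1 + ennreal (0 - (- (1 powr (1 - q) / (q - 1)))))"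
    by (simp add: mult_left_mono)
  also have "\<dots> < \<infinity>" by (simp add: ennreal_mult_less_top)
  finally show ?thesis .
qed

text \<open>Young's inequality without its coefficients. Comparing b with a^(r - 1) shows that one
  of the two terms alone already dominates the product.\<close>

lemma mult_le_powr_add_powr:
  fixes a b r q :: real
  assumes "1 < r" "q = r / (r - 1)" "0 \<le> a" "0 \<le> b"
  shows "a * b \<le> a powr r + b powr q"
proof (cases "a = 0 \<or> b = 0")
  case False
  then have ab: "a > 0" "b > 0" using assms by auto
  show ?thesis
  proof (cases "b \<le> a powr (r - 1)")
    case True
    then have "a * b \<le> a powr 1 * a powr (r - 1)" using ab by simp
    also have "\<dots> = a powr r" by (simp only: powr_add[symmetric]) simp
    finally show ?thesis by (simp add: add_increasing2)
  next
    case False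
    then have "(a powr (r - 1)) powr (1 / (r - 1)) \<le> b powr (1 / (r - 1))"
      using assms by (intro powr_mono2) auto
    then have "a \<le> b powr (1 / (r - 1))" using ab assms by (simp add: powr_powr)
    then have "a * b \<le> b powr (1 / (r - 1)) * b powr 1" using ab by simp
    also have "\<dots> = b powr q"
    proof -
      have "1 / (r - 1) + 1 = q" using assms by (simp add: field_simps)
      then show ?thesis by (simp only: powr_add[symmetric])
    qed
    finally show ?thesis by (simp add: add_increasing)
  qed
qed auto

text \<open>Young's inequality is applied to h and \<open>wt / T\<close> with T = d^(1 - 1/r). The
  power of T by the conjugate exponent is d, and this cancels the factor d from scaling the weight;
  hence C depends on r only.\<close>

lemma nn_integral_wt_finite_exponent:
  fixes r :: real
  assumes r: "1 < r"
  obtains C where "C \<ge> 0" "\<And>d q h J. 0 < d \<Longrightarrow> h \<in> borel_measurable borel \<Longrightarrow> (\<And>x. 0 \<le> h x) \<Longrightarrow> J \<in> sets borel \<Longrightarrow>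
    (\<integral>\<^sup>+x\<in>J. ennreal (h x * wt d (x - q)) \<partial>lborel) \<le>
      ennreal (d powr (1 - 1 / r)) * (ennreal C + (\<integral>\<^sup>+x\<in>J. ennreal (h x powr r) \<partial>lborel))"
proof -
  define q' where "q' = r / (r - 1)"
  have q': "q' > 1" using r by (simp add: q'_def)
  define C where "C = enn2real (\<integral>\<^sup>+t. ennreal (wt 1 t powr q') \<partial>lborel)"
  have C: "ennreal C = (\<integral>\<^sup>+t. ennreal (wt 1 t powr q') \<partial>lborel)" "C \<ge> 0"
    unfolding C_def using nn_integral_wt_powr_finite[OF q'] by auto
  have "(\<integral>\<^sup>+x\<in>J. ennreal (h x * wt d (x - q)) \<partial>lborel) \<le>
      ennreal (d powr (1 - 1 / r)) * (ennreal C + (\<integral>\<^sup>+x\<in>J. ennreal (h x powr r) \<partial>lborel))"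
    if d: "0 < d" and [measurable]: "h \<in> borel_measurable borel" and h: "\<And>x. 0 \<le> h x" and [measurable]: "J \<in> sets borel"
    for d q h J
  proof -
    define T where "T = d powr (1 - 1 / r)"
    have T: "T > 0" using d by (simp add: T_def)
    have Tq: "T powr q' = d"
    proof -
      have "(1 - 1 / r) * q' = 1" using r by (simp add: q'_def field_simps)
      then show ?thesis using d by (simp add: T_def powr_powr)
    qed
    have pw: "h x * wt d (x - q) \<le> T * (h x powr r + wt d (x - q) powr q' / d)" for x
    proof -
      have "h x * (wt d (x - q) / T) \<le> h x powr r + (wt d (x - q) / T) powr q'"
        by (rule mult_le_powr_add_powr[OF r q'_def h]) (use T d in \<open>auto simp: wt_nonneg\<close>)
      also have "(wt d (x - q) / T) powr q' = wt d (x - q) powr q' / d"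
        using T d by (simp add: powr_divide wt_nonneg Tq)
      finally show ?thesis using T by (simp add: field_simps)
    qed
    \<comment> \<open>The substitution x = q + d t reduces the weight to \<open>wt 1\<close> and
      produces the factor d.\<close>
    have w: "(\<integral>\<^sup>+x. ennreal (wt d (x - q) powr q' / d) \<partial>lborel) = ennreal C"
    proof -
      have "(\<integral>\<^sup>+x. ennreal (wt d (x - q) powr q' / d) \<partial>lborel) =
         ennreal d * (\<integral>\<^sup>+t. ennreal (wt 1 t powr q' / d) \<partial>lborel)"
        using nn_integral_real_affine[of "\<lambda>x. ennreal (wt d (x - q) powr q' / d)" d q] d
        by (simp add: wt_scale)
      also have "\<dots> = (\<integral>\<^sup>+t. ennreal d * ennreal (wt 1 t powr q' / d) \<partial>lborel)"
        by (rule nn_integral_cmult[symmetric]) measurable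
      also have "\<dots> = (\<integral>\<^sup>+t. ennreal (wt 1 t powr q') \<partial>lborel)"
        using d by (intro nn_integral_cong) (simp flip: ennreal_mult'')
      finally show ?thesis using C by simp
    qed
    have "(\<integral>\<^sup>+x\<in>J. ennreal (h x * wt d (x - q)) \<partial>lborel) \<le>
       (\<integral>\<^sup>+x. ennreal T * (ennreal (wt d (x - q) powr q' / d) + ennreal (h x powr r) * indicator J x) \<partial>lborel)"
    proof (rule nn_integral_mono)
      fix x
      show "ennreal (h x * wt d (x - q)) * indicator J x \<le> ennreal T * (ennreal (wt d (x - q) powr q' / d) + ennreal (h x powr r) * indicator J x)"
      proof (cases "x \<in> J")
        case True
        have "ennreal (h x * wt d (x - q)) \<le> ennreal (T * (h x powr r + wt d (x - q) powr q' / d))"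
          by (rule ennreal_leI[OF pw])
        also have "\<dots> = ennreal T * (ennreal (wt d (x - q) powr q' / d) + ennreal (h x powr r))"
          using T d by (subst ennreal_mult') (auto simp: add.commute)
        finally show ?thesis using True by simp
      qed simp
    qed
    also have "\<dots> = ennreal T * ((\<integral>\<^sup>+x. ennreal (wt d (x - q) powr q' / d) \<partial>lborel) + (\<integral>\<^sup>+x\<in>J. ennreal (h x powr r) \<partial>lborel))"
      by (subst nn_integral_cmult, measurable, subst nn_integral_add, measurable)
    finally show ?thesis by (simp only: w T_def)
  qed
  then show ?thesis using that C(2) by blast
qed

lemma nn_integral_wt_bounded_interval:
  assumes d: "0 < d" "d \<le> 1/2"
  shows "(\<integral>\<^sup>+s\<in>{-1..1}. ennreal (wt d s) \<partial>lborel) \<le> ennreal (2 * (d * (1 + ln (1 / d))))"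
proof -
  have "(\<integral>\<^sup>+s. ennreal (wt d s) * indicator {-1..1} s \<partial>lborel) \<le>
     2 * (\<integral>\<^sup>+s\<in>{0..}. ennreal (wt d s) * indicator {-1..1} s \<partial>lborel)"
    by (rule nn_integral_le_twice_half_line) (auto simp: wt_def indicator_def)
  also have "(\<integral>\<^sup>+s\<in>{0..}. ennreal (wt d s) * indicator {-1..1} s \<partial>lborel) \<le>
      (\<integral>\<^sup>+s. indicator {0..d} s + ennreal (d / s) * indicator {d..1} s \<partial>lborel)"
    using d by (intro nn_integral_mono) (auto simp: wt_def indicator_def)
  also have "\<dots> = ennreal d + (\<integral>\<^sup>+s\<in>{d..1}. ennreal (d / s) \<partial>lborel)"
    using d by (subst nn_integral_add) auto
  also have "(\<integral>\<^sup>+s\<in>{d..1}. ennreal (d / s) \<partial>lborel) = ennreal (d * ln 1 - d * ln d)"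
  proof (rule nn_integral_FTC_Icc[where F="\<lambda>s. d * ln s"])
    show "((\<lambda>s. d * ln s) has_real_derivative d / s) (at s)" if "s \<in> {d..1}" for s
      using that d by (auto intro!: derivative_eq_intros)
  qed (use d in auto)
  also have "ennreal d + ennreal (d * ln 1 - d * ln d) = ennreal (d * (1 + ln (1 / d)))"
    using d by (subst ennreal_plus[symmetric]) (auto simp: ln_div algebra_simps mult_nonneg_nonpos)
  also have "2 * ennreal (d * (1 + ln (1 / d))) = ennreal (2 * (d * (1 + ln (1 / d))))"
    using d by (subst ennreal_mult) auto
  finally show ?thesis by (simp add: mult_left_mono)
qed

text \<open>For p = \<infinity> a finite cost integral forces h \<le> B almost everywhere on the
  interval, and an infinite one makes the right side infinite. Confining q and the interval to
  [-1/2, 1/2] ensures |x - q| \<le> 1, where the weight has a finite integral.\<close>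

lemma nn_integral_wt_le_rate:
  assumes p: "1 < p" and B: "0 \<le> B"
  obtains C where "C \<ge> 0" "\<And>d q h u v. 0 < d \<Longrightarrow> d \<le> 1/2 \<Longrightarrow> \<bar>q\<bar> \<le> 1/2 \<Longrightarrow> {u<..<v} \<subseteq> {-1/2..1/2} \<Longrightarrow>
      h \<in> borel_measurable borel \<Longrightarrow> (\<And>x. 0 \<le> h x) \<Longrightarrow>
    (\<integral>\<^sup>+x\<in>{u<..<v}. ennreal (h x * wt d (x - q)) \<partial>lborel) \<le>
      ennreal (rate p d) * (ennreal C + (\<integral>\<^sup>+x\<in>{u<..<v}. Lp_cost p B (h x) \<partial>lborel))"
proof (cases "p = \<infinity>")
  case False
  then obtain r where r: "p = ennreal r" "0 \<le> r" by (cases p) auto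
  then have r1: "1 < r" using p by (metis ennreal_1 ennreal_less_iff zero_le_one)
  obtain C where C: "C \<ge> 0" "\<And>d q h J. 0 < d \<Longrightarrow> h \<in> borel_measurable borel \<Longrightarrow> (\<And>x. 0 \<le> h x) \<Longrightarrow> J \<in> sets borel \<Longrightarrow>
    (\<integral>\<^sup>+x\<in>J. ennreal (h x * wt d (x - q)) \<partial>lborel) \<le>
      ennreal (d powr (1 - 1 / r)) * (ennreal C + (\<integral>\<^sup>+x\<in>J. ennreal (h x powr r) \<partial>lborel))"
    by (rule nn_integral_wt_finite_exponent[OF r1]) blast
  show ?thesis
    by (rule that[OF C(1)]) (use C(2) r in \<open>simp add: rate_def Lp_cost_def\<close>)
next
  case True
  show ?thesis
  proof (rule that[of "2 * B"])
    show "2 * B \<ge> 0" using B by simp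
    fix d q u v :: real and h :: "real \<Rightarrow> real"
    assume d: "0 < d" "d \<le> 1/2" and q: "\<bar>q\<bar> \<le> 1/2" and uv: "{u<..<v} \<subseteq> {-1/2..1/2}"
      and [measurable]: "h \<in> borel_measurable borel" and h: "\<And>x. 0 \<le> h x"
    let ?H = "\<integral>\<^sup>+x\<in>{u<..<v}. Lp_cost p B (h x) \<partial>lborel"
    show "(\<integral>\<^sup>+x\<in>{u<..<v}. ennreal (h x * wt d (x - q)) \<partial>lborel) \<le> ennreal (rate p d) * (ennreal (2 * B) + ?H)"
    proof (cases "?H = \<infinity>")
      case True
      then show ?thesis using rate_pos[OF d, of p] by (simp add: ennreal_mult_eq_top_iff top_unique)
    next
      case False
      then have "AE x in lborel. Lp_cost p B (h x) * indicator {u<..<v} x \<noteq> \<infinity>"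
        by (intro nn_integral_PInf_AE) auto
      then have "(\<integral>\<^sup>+x\<in>{u<..<v}. ennreal (h x * wt d (x - q)) \<partial>lborel) \<le>
         (\<integral>\<^sup>+x. ennreal B * (ennreal (wt d (x - q)) * indicator {-1..1} (x - q)) \<partial>lborel)"
      proof (intro nn_integral_mono_AE, eventually_elim)
        case (elim x)
        show ?case
        proof (cases "x \<in> {u<..<v}")
          case in1: True
          then have "h x \<le> B" using elim \<open>p = \<infinity>\<close> by (auto simp: Lp_cost_def split: if_splits)
          moreover have "x \<in> {-1/2..1/2}" using uv in1 by blast
          then have "x - q \<in> {-1..1}" using q by auto
          ultimately show ?thesis using in1 d B
            by (auto simp: wt_nonneg simp flip: ennreal_mult intro!: ennreal_leI mult_right_mono)
        qed simp
      qed
      also have "\<dots> = (\<integral>\<^sup>+s. ennreal B * (ennreal (wt d s) * indicator {-1..1} s) \<partial>lborel)"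
        using nn_integral_lborel_shift[of "\<lambda>s. ennreal B * (ennreal (wt d s) * indicator {-1..1} s)" "-q"] by simp
      also have "\<dots> = ennreal B * (\<integral>\<^sup>+s\<in>{-1..1}. ennreal (wt d s) \<partial>lborel)"
        by (rule nn_integral_cmult) measurable
      also have "\<dots> \<le> ennreal B * ennreal (2 * (d * (1 + ln (1 / d))))"
        by (intro mult_left_mono nn_integral_wt_bounded_interval d) auto
      also have "\<dots> = ennreal (rate p d) * ennreal (2 * B)"
        using True B d \<open>p = \<infinity>\<close> by (subst (1 2) ennreal_mult[symmetric]) (auto simp: rate_def mult_ac)
      also have "\<dots> \<le> ennreal (rate p d) * (ennreal (2 * B) + ?H)"
        by (intro mult_left_mono) auto
      finally show ?thesis .
    qed
  qed
qed

section \<open>Shift differences in the plane\<close>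

text \<open>The exceptional set lies in a Borel null set, and by Tonelli's theorem almost every
  horizontal slice of that set is null. Thus P itself raises no question of measurability.\<close>

lemma AE_lborel_lines:
  assumes "AE z in (lborel :: (real \<times> real) measure). P z"
  shows "AE y in lborel. AE x in lborel. P (x, y)"
proof -
  obtain N where N: "{z. \<not> P z} \<subseteq> N" "emeasure lborel N = 0" "N \<in> sets lborel"
    using AE_E[OF assms] by auto
  then have Nm [measurable]: "N \<in> sets (lborel \<Otimes>\<^sub>M lborel)" unfolding lborel_prod by simp
  have "(\<integral>\<^sup>+y. \<integral>\<^sup>+x. indicator N (x, y) \<partial>lborel \<partial>lborel) = (\<integral>\<^sup>+z. indicator N z \<partial>(lborel \<Otimes>\<^sub>M lborel))"
    by (rule lborel_pair.nn_integral_snd) measurable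
  also have "\<dots> = 0" using N by (simp add: lborel_prod)
  finally have "AE y in lborel. (\<integral>\<^sup>+x. indicator N (x, y) \<partial>(lborel :: real measure)) = 0"
    by (subst (asm) nn_integral_0_iff_AE) measurable
  then show ?thesis
  proof eventually_elim
    case (elim y)
    then have "AE x in lborel. indicator N (x, y) = (0 :: ennreal)"
      by (subst (asm) nn_integral_0_iff_AE) measurable
    then show ?case by eventually_elim (use N in \<open>auto simp: indicator_def split: if_splits\<close>)
  qed
qed

lemma nn_integral_lborel_lines:
  fixes f :: "real \<times> real \<Rightarrow> ennreal"
  assumes "f \<in> borel_measurable borel"
  shows "(\<lambda>y. \<integral>\<^sup>+x. f (x, y) \<partial>lborel) \<in> borel_measurable borel"
    and "(\<integral>\<^sup>+z. f z \<partial>lborel) = (\<integral>\<^sup>+y. \<integral>\<^sup>+x. f (x, y) \<partial>lborel \<partial>lborel)"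
proof -
  have [measurable]: "f \<in> borel_measurable (lborel \<Otimes>\<^sub>M lborel)"
    using assms by (simp add: lborel_prod)
  show "(\<integral>\<^sup>+z. f z \<partial>lborel) = (\<integral>\<^sup>+y. \<integral>\<^sup>+x. f (x, y) \<partial>lborel \<partial>lborel)"
    by (subst lborel_pair.nn_integral_snd) (simp_all add: lborel_prod assms)
  have "(\<lambda>y. \<integral>\<^sup>+x. f (x, y) \<partial>lborel) \<in> borel_measurable lborel" by measurable
  then show "(\<lambda>y. \<integral>\<^sup>+x. f (x, y) \<partial>lborel) \<in> borel_measurable borel" by simp
qed

text \<open>A slice of g is not known to be Borel, since g has a Borel version only up to a null set
  of the plane. Monotonicity on a piece supplies the measurability there.\<close>

lemma monotone_cut_off_measurable:
  fixes h :: "real \<Rightarrow> real"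
  assumes "mono_on {u<..<v} h \<or> antimono_on {u<..<v} h"
  shows "(\<lambda>x. indicator {u<..<v} x * h x) \<in> borel_measurable borel"
  using assms
proof
  assume "mono_on {u<..<v} h"
  then have "h \<in> borel_measurable (restrict_space borel {u<..<v})"
    by (intro borel_measurable_mono_on_fnc)
  then show ?thesis by (subst (asm) borel_measurable_restrict_space_iff) auto
next
  assume "antimono_on {u<..<v} h"
  then have "mono_on {u<..<v} (\<lambda>x. - h x)" by (auto simp: monotone_on_def)
  then have "(\<lambda>x. - h x) \<in> borel_measurable (restrict_space borel {u<..<v})"
    by (intro borel_measurable_mono_on_fnc)
  then have "(\<lambda>x. - (- h x)) \<in> borel_measurable (restrict_space borel {u<..<v})"
    by (rule borel_measurable_uminus)
  then show ?thesis by (subst (asm) borel_measurable_restrict_space_iff) auto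
qed

text \<open>A ball of the maximum norm: its horizontal slices are empty or always the same interval,
  so its indicator becomes a function of x alone on a line.\<close>

definition square :: "real \<Rightarrow> (real \<times> real) set" where
  "square e = {z. \<bar>fst z\<bar> < e \<and> \<bar>snd z\<bar> < e}"

lemma open_square: "open (square e)"
  unfolding square_def by (intro open_Collect_conj open_Collect_less continuous_intros)

lemma square_measurable [measurable]: "square e \<in> sets borel"
  by (rule borel_open[OF open_square])

text \<open>Near \<open>z\<^sub>0\<close> the function \<open>m\<close> is an amplitude times a function \<open>g\<close> which is monotone on
  boundedly many pieces of every horizontal line; \<open>g'\<close> is a Borel version of \<open>g\<close>.\<close>

definition line_monotone_at :: "ennreal \<Rightarrow> (real \<times> real \<Rightarrow> complex) \<Rightarrow> real \<times> real \<Rightarrow> bool" where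
  "line_monotone_at p m z\<^sub>0 \<longleftrightarrow>
    (\<exists>e A M B \<alpha> \<alpha>' g g'. 0 < e \<and> 0 \<le> A \<and> 0 \<le> B \<and> (\<forall>z. 0 \<le> g z) \<and>
      g' \<in> borel_measurable borel \<and> (AE z in lborel. z \<in> square e \<longrightarrow> g' z = g z) \<and>
      (\<integral>\<^sup>+z\<in>square e. Lp_cost p B (g' z) \<partial>lborel) < \<infinity> \<and>
      (\<forall>x y. \<bar>x\<bar> < e \<longrightarrow> \<bar>y\<bar> < e \<longrightarrow> norm (\<alpha> (x, y)) \<le> A) \<and>
      (\<forall>x y. \<bar>x\<bar> < e \<longrightarrow> \<bar>y\<bar> < e \<longrightarrow> x \<noteq> 0 \<longrightarrow>
        ((\<lambda>x. \<alpha> (x, y)) has_vector_derivative \<alpha>' (x, y)) (at x) \<and> norm (\<alpha>' (x, y)) \<le> A / \<bar>x\<bar>) \<and>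
      (\<forall>y. 0 < \<bar>y\<bar> \<longrightarrow> \<bar>y\<bar> < e \<longrightarrow> (\<exists>P. finite P \<and> card P \<le> M \<and>
        (\<forall>u v. {u<..<v} \<subseteq> {-e<..<e} - P \<longrightarrow>
          (\<forall>x\<in>{u<..<v}. m (z\<^sub>0 + (x, y)) = \<alpha> (x, y) * complex_of_real (g (x, y))) \<and>
          (mono_on {u<..<v} (\<lambda>x. g (x, y)) \<or> antimono_on {u<..<v} (\<lambda>x. g (x, y)))))))"

text \<open>Tonelli's theorem reduces the estimate to lines. On almost every line with |y| <
  \<delta> at most M + 2 pieces each cost 4 A times the rate times C + G(y); this sum is integrable
  over the bounded range of y.\<close>

lemma local_shift_estimate:
  assumes p: "1 < p" and L: "line_monotone_at p m z\<^sub>0"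
    and m' [measurable]: "m' \<in> borel_measurable borel" and mm': "AE z in lborel. m' z = m z"
  obtains \<delta> K where "0 < \<delta>" "0 \<le> K"
    "\<And>d. 0 < d \<Longrightarrow> d \<le> 1/2 \<Longrightarrow>
      (\<integral>\<^sup>+z. ennreal (norm (indicator (square \<delta>) (z + (d, 0)) * m' (z\<^sub>0 + (z + (d, 0))) -
         indicator (square \<delta>) z * m' (z\<^sub>0 + z))) \<partial>lborel) \<le> ennreal (K * rate p d)"
proof -
  obtain e A M B \<alpha> \<alpha>' g g' where e: "0 < e" and A: "0 \<le> A" and B: "0 \<le> B" and g0: "\<forall>z. 0 \<le> g z"
    and g' [measurable]: "g' \<in> borel_measurable borel" and gg': "AE z in lborel. z \<in> square e \<longrightarrow> g' z = g z"
    and fin: "(\<integral>\<^sup>+z\<in>square e. Lp_cost p B (g' z) \<partial>lborel) < \<infinity>"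
    and bd0: "\<forall>x y. \<bar>x\<bar> < e \<longrightarrow> \<bar>y\<bar> < e \<longrightarrow> norm (\<alpha> (x, y)) \<le> A"
    and der0: "\<forall>x y. \<bar>x\<bar> < e \<longrightarrow> \<bar>y\<bar> < e \<longrightarrow> x \<noteq> 0 \<longrightarrow>
        ((\<lambda>x. \<alpha> (x, y)) has_vector_derivative \<alpha>' (x, y)) (at x) \<and> norm (\<alpha>' (x, y)) \<le> A / \<bar>x\<bar>"
    and pieces0: "\<forall>y. 0 < \<bar>y\<bar> \<longrightarrow> \<bar>y\<bar> < e \<longrightarrow> (\<exists>P. finite P \<and> card P \<le> M \<and>
        (\<forall>u v. {u<..<v} \<subseteq> {-e<..<e} - P \<longrightarrow>
          (\<forall>x\<in>{u<..<v}. m (z\<^sub>0 + (x, y)) = \<alpha> (x, y) * complex_of_real (g (x, y))) \<and>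
          (mono_on {u<..<v} (\<lambda>x. g (x, y)) \<or> antimono_on {u<..<v} (\<lambda>x. g (x, y)))))"
    using L unfolding line_monotone_at_def by (elim exE conjE) (rule that)
  note g = g0[rule_format] and bd = bd0[rule_format] and der = der0[rule_format] and pieces = pieces0[rule_format]
  obtain C where C: "C \<ge> 0" and wt: "\<And>d q h u v. 0 < d \<Longrightarrow> d \<le> 1/2 \<Longrightarrow> \<bar>q\<bar> \<le> 1/2 \<Longrightarrow> {u<..<v} \<subseteq> {-1/2..1/2} \<Longrightarrow>
      h \<in> borel_measurable borel \<Longrightarrow> (\<And>x. 0 \<le> h x) \<Longrightarrow>
    (\<integral>\<^sup>+x\<in>{u<..<v}. ennreal (h x * wt d (x - q)) \<partial>lborel) \<le>
      ennreal (rate p d) * (ennreal C + (\<integral>\<^sup>+x\<in>{u<..<v}. Lp_cost p B (h x) \<partial>lborel))"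
    by (rule nn_integral_wt_le_rate[OF p B]) blast
  \<comment> \<open>The cap 1/2 places all pieces and their end points in the range required by the
    weighted bound.\<close>
  define \<delta> where "\<delta> = min e (1/2)"
  have \<delta>: "0 < \<delta>" "\<delta> \<le> e" "\<delta> \<le> 1/2" using e by (auto simp: \<delta>_def)
  define G where "G y = (\<integral>\<^sup>+x. Lp_cost p B (g' (x, y)) * indicator (square e) (x, y) \<partial>lborel)" for y
  have G [measurable]: "G \<in> borel_measurable borel"
    unfolding G_def by (rule nn_integral_lborel_lines(1)[of "\<lambda>z. Lp_cost p B (g' z) * indicator (square e) z"]) measurable
  have Gint: "(\<integral>\<^sup>+y. G y \<partial>lborel) = (\<integral>\<^sup>+z\<in>square e. Lp_cost p B (g' z) \<partial>lborel)"
    unfolding G_def by (rule nn_integral_lborel_lines(2)[symmetric]) measurable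
  obtain I where I: "0 \<le> I" "(\<integral>\<^sup>+y. G y \<partial>lborel) = ennreal I"
    using fin unfolding Gint[symmetric] by (cases "\<integral>\<^sup>+y. G y \<partial>lborel") auto
  let ?D = "\<lambda>d z. ennreal (norm (indicator (square \<delta>) (z + (d, 0)) * m' (z\<^sub>0 + (z + (d, 0))) -
         indicator (square \<delta>) z * m' (z\<^sub>0 + z)))"
  have m'0: "AE z in lborel. m' (z\<^sub>0 + z) = m (z\<^sub>0 + z)"
    using AE_lborel_shift[OF mm', of z\<^sub>0] by (simp add: add.commute)
  \<comment> \<open>The indicator of \<open>{-\<delta>..\<delta>}\<close> is what makes the constant
    C integrable in y.\<close>
  have line: "AE y in lborel. (\<integral>\<^sup>+x. ?D d (x, y) \<partial>lborel) \<le>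
      (ennreal (real (M + 2) * (4 * A) * rate p d) * (ennreal C + G y)) * indicator {-\<delta>..\<delta>} y"
    if d: "0 < d" "d \<le> 1/2" for d
    using AE_lborel_lines[OF m'0] AE_lborel_lines[OF gg'] AE_lborel_singleton[of 0]
  proof eventually_elim
    case (elim y)
    show ?case
    proof (cases "\<bar>y\<bar> < \<delta>")
      case False
      then show ?thesis by (simp add: square_def)
    next
      case True
      then have y: "0 < \<bar>y\<bar>" "\<bar>y\<bar> < e" using elim(3) \<delta> by auto
      obtain P where P: "finite P" "card P \<le> M" and
        pm: "\<And>u v. {u<..<v} \<subseteq> {-e<..<e} - P \<Longrightarrow>
          (\<forall>x\<in>{u<..<v}. m (z\<^sub>0 + (x, y)) = \<alpha> (x, y) * complex_of_real (g (x, y))) \<and>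
          (mono_on {u<..<v} (\<lambda>x. g (x, y)) \<or> antimono_on {u<..<v} (\<lambda>x. g (x, y)))"
        using pieces[OF y] by blast
      define S where "S = ennreal (rate p d) * (ennreal C + G y)"
      define \<psi> where "\<psi> x = m' (z\<^sub>0 + (x, y))" for x
      have \<psi> [measurable]: "\<psi> \<in> borel_measurable borel"
        unfolding \<psi>_def by measurable
      have "(\<integral>\<^sup>+x. ?D d (x, y) \<partial>lborel) =
        (\<integral>\<^sup>+x. ennreal (norm (indicator {-\<delta><..<\<delta>} (x + d) * \<psi> (x + d) - indicator {-\<delta><..<\<delta>} x * \<psi> x)) \<partial>lborel)"
      proof (intro nn_integral_cong)
        fix x
        have "indicator (square \<delta>) (w, y) = (indicator {-\<delta><..<\<delta>} w :: complex)" for w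
          using True by (auto simp: indicator_def square_def)
        then show "?D d (x, y) = ennreal (norm (indicator {-\<delta><..<\<delta>} (x + d) * \<psi> (x + d) - indicator {-\<delta><..<\<delta>} x * \<psi> x))"
          by (simp add: \<psi>_def)
      qed
      \<comment> \<open>The point 0, where \<alpha> may be singular, becomes a further cut point: at
        most M + 1 cut points, hence at most M + 2 intervals.\<close>
      also have "\<dots> \<le> of_nat (Suc (card (insert 0 P))) * (ennreal (4 * A) * S)"
      proof (rule nn_integral_shift_diff_pieces[OF \<psi>])
        show "finite (insert 0 P)" using P by simp
        fix u v :: real assume uv: "u < v" "{u<..<v} \<subseteq> {-\<delta><..<\<delta>} - insert 0 P"
        have "{u<..<v} \<subseteq> {-\<delta>..\<delta>}" using uv(2) by auto
        then have uv\<delta>: "-\<delta> \<le> u" "v \<le> \<delta>" using uv(1)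
          by (auto simp: greaterThanLessThan_subseteq_atLeastAtMost_iff)
        have sub: "{u<..<v} \<subseteq> {-e<..<e} - P" using uv \<delta> by fastforce
        \<comment> \<open>\<open>h\<close> is a slice of g and not of \<open>g'\<close>, because
          monotonicity is known for g only. Both agree almost everywhere on this line, which
          suffices for the comparison with \<open>G y\<close>.\<close>
        define h where "h x = indicator {u<..<v} x * g (x, y)" for x
        have mono: "mono_on {u<..<v} (\<lambda>x. g (x, y)) \<or> antimono_on {u<..<v} (\<lambda>x. g (x, y))"
          using pm[OF sub] by blast
        have hm: "h \<in> borel_measurable borel"
          unfolding h_def by (rule monotone_cut_off_measurable[OF mono])
        have h: "\<And>x. 0 \<le> h x" by (simp add: h_def g)
        have in_e: "\<bar>x\<bar> < e" "x \<noteq> 0" if "x \<in> {u<..<v}" for x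
          using that uv(2) \<delta> by fastforce+
        show "(\<integral>\<^sup>+x. ennreal (norm (indicator {u<..<v} (x + d) * \<psi> (x + d) - indicator {u<..<v} x * \<psi> x)) \<partial>lborel)
          \<le> ennreal (4 * A) * S"
        proof (rule nn_integral_shift_diff_piece[where c = 0 and \<alpha> = "\<lambda>x. \<alpha> (x, y)" and \<alpha>' = "\<lambda>x. \<alpha>' (x, y)" and h = h])
          show "0 \<notin> {u<..<v}" using uv(2) by auto
          show "mono_on {u<..<v} h \<or> antimono_on {u<..<v} h"
            using mono by (auto simp: h_def monotone_on_def)
          show "AE x in lborel. x \<in> {u<..<v} \<longrightarrow> \<psi> x = \<alpha> (x, y) * complex_of_real (h x)"
            using elim(1)
          proof eventually_elim
            case (elim x)
            then show ?case using pm[OF sub] by (auto simp: \<psi>_def h_def)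
          qed
          fix q assume q: "q \<in> {u, v, 0}"
          have "(\<integral>\<^sup>+x\<in>{u<..<v}. ennreal (h x * wt d (x - q)) \<partial>lborel) \<le>
             ennreal (rate p d) * (ennreal C + (\<integral>\<^sup>+x\<in>{u<..<v}. Lp_cost p B (h x) \<partial>lborel))"
            by (rule wt[OF d _ _ hm h]) (use q uv(1) uv\<delta> \<delta> in auto)
          also have "(\<integral>\<^sup>+x\<in>{u<..<v}. Lp_cost p B (h x) \<partial>lborel) \<le> G y"
            unfolding G_def using elim(2)
          proof (intro nn_integral_mono_AE, eventually_elim)
            case (elim x)
            show ?case
            proof (cases "x \<in> {u<..<v}")
              case True
              then have "(x, y) \<in> square e" using in_e y by (auto simp: square_def)
              then show ?thesis using elim True by (simp add: h_def)
            qed simp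
          qed
          finally show "(\<integral>\<^sup>+x\<in>{u<..<v}. ennreal (h x * wt d (x - q)) \<partial>lborel) \<le> S"
            by (simp add: S_def mult_left_mono add_left_mono)
        qed (use d A hm h bd der in_e y in auto)
      qed
      also have "\<dots> \<le> of_nat (M + 2) * (ennreal (4 * A) * S)"
        using P by (intro mult_right_mono of_nat_mono) (auto simp: card_insert_if)
      also have "\<dots> = ennreal (real (M + 2) * (4 * A) * rate p d) * (ennreal C + G y)"
        using A rate_pos[OF d, of p] unfolding S_def ennreal_of_nat_eq_real_of_nat
        by (simp only: ennreal_mult mult.assoc of_nat_0_le_iff mult_nonneg_nonneg less_imp_le zero_le_numeral)
      finally have "(\<integral>\<^sup>+x. ?D d (x, y) \<partial>lborel) \<le> ennreal (real (M + 2) * (4 * A) * rate p d) * (ennreal C + G y)" .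
      moreover have "indicator {-\<delta>..\<delta>} y = (1::ennreal)" using True by (auto simp: indicator_def)
      ultimately show ?thesis by (simp only: mult_1_right)
    qed
  qed
  have "(\<integral>\<^sup>+z. ?D d z \<partial>lborel) \<le> ennreal ((real (M + 2) * (4 * A) * (C * (2 * \<delta>) + I)) * rate p d)"
    if d: "0 < d" "d \<le> 1/2" for d
  proof -
    let ?R = "ennreal (real (M + 2) * (4 * A) * rate p d)"
    have "(\<integral>\<^sup>+z. ?D d z \<partial>lborel) = (\<integral>\<^sup>+y. \<integral>\<^sup>+x. ?D d (x, y) \<partial>lborel \<partial>lborel)"
      by (rule nn_integral_lborel_lines(2)) measurable
    also have "\<dots> \<le> (\<integral>\<^sup>+y. (?R * (ennreal C + G y)) * indicator {-\<delta>..\<delta>} y \<partial>lborel)"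
      by (rule nn_integral_mono_AE[OF line[OF d]])
    also have "\<dots> \<le> (\<integral>\<^sup>+y. ?R * (ennreal C * indicator {-\<delta>..\<delta>} y + G y) \<partial>lborel)"
      by (intro nn_integral_mono) (auto simp: indicator_def)
    also have "\<dots> = ?R * (ennreal C * ennreal (2 * \<delta>) + ennreal I)"
      using \<delta> I by (subst nn_integral_cmult, measurable, subst nn_integral_add, measurable) (simp add: nn_integral_cmult_indicator)
    also have "\<dots> = ennreal ((real (M + 2) * (4 * A) * rate p d) * (C * (2 * \<delta>) + I))"
      using A C \<delta> I rate_pos[OF d, of p]
      by (simp only: ennreal_mult ennreal_plus mult_nonneg_nonneg add_nonneg_nonneg less_imp_le of_nat_0_le_iff zero_le_numeral)
    finally show ?thesis by (simp add: mult_ac)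
  qed
  moreover have "0 \<le> real (M + 2) * (4 * A) * (C * (2 * \<delta>) + I)"
    using A C \<delta> I by (intro mult_nonneg_nonneg add_nonneg_nonneg) auto
  ultimately show ?thesis using that[OF \<delta>(1)] by blast
qed

section \<open>From local data to monotone pieces on lines\<close>

lemma dpser_of_real_analytic2_near:
  assumes "real_analytic2_near f 0"
  obtains r where "r > 0" "dpser r f"
proof -
  have "real_analytic2_at f 0" using assms by (auto simp: real_analytic2_near_def)
  then obtain c r where r: "r > 0" and c: "\<And>x y. \<bar>x\<bar> < r \<Longrightarrow> \<bar>y\<bar> < r \<Longrightarrow>
      ((\<lambda>(j, k). c j k * x ^ j * y ^ k) has_sum f (0 + (x, y))) (UNIV :: (nat \<times> nat) set)"
    unfolding real_analytic2_at_def by blast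
  have "pser r (\<lambda>(j, k). c j k) f"
    unfolding pser_def
  proof (intro conjI allI impI r)
    fix x y assume "\<bar>x\<bar> < r" "\<bar>y\<bar> < r"
    from c[OF this] show "((\<lambda>q. (case q of (j, k) \<Rightarrow> c j k) * (x ^ fst q * y ^ snd q)) has_sum f (x, y)) UNIV"
      by (simp add: case_prod_unfold mult.assoc)
  qed
  then show ?thesis using that r by (auto simp: dpser_def)
qed

lemma dpser_swap:
  assumes "dpser r f"
  shows "dpser r (f \<circ> prod.swap)"
proof -
  obtain c where c: "pser r c f" using assms by (auto simp: dpser_def)
  have "pser r (c \<circ> prod.swap) (f \<circ> prod.swap)"
    unfolding pser_def
  proof (intro conjI allI impI)
    show "r > 0" using c by (simp add: pser_def)
    fix x y :: real assume xy: "\<bar>x\<bar> < r" "\<bar>y\<bar> < r"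
    have "((\<lambda>q. c q * (y ^ fst q * x ^ snd q)) has_sum f (y, x)) UNIV"
      by (rule pserD[OF c xy(2,1)])
    also have "?this \<longleftrightarrow> ((\<lambda>q. c (prod.swap q) * (y ^ fst (prod.swap q) * x ^ snd (prod.swap q))) has_sum f (y, x)) UNIV"
      by (rule has_sum_reindex_bij_betw[symmetric, OF bij_swap])
    finally show "((\<lambda>q. (c \<circ> prod.swap) q * (x ^ fst q * y ^ snd q)) has_sum (f \<circ> prod.swap) (x, y)) UNIV"
      by (simp add: mult_ac)
  qed
  then show ?thesis by (auto simp: dpser_def)
qed

lemma dpser_mono: "dpser r f \<Longrightarrow> 0 < s \<Longrightarrow> s \<le> r \<Longrightarrow> dpser s f"
  unfolding dpser_def using pser_mono by blast

lemma assoc_g_nonneg: "0 \<le> assoc_g n f \<gamma> E z"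
  unfolding assoc_g_def by (intro mult_nonneg_nonneg prod_nonneg) auto

text \<open>The cut points of the product and of the region are united. Between them the segment
  lies in E, where g is the product, or misses E, where g is 0.\<close>

lemma assoc_g_piecewise_monotone:
  assumes f: "\<And>i. i < n \<Longrightarrow> \<exists>r>0. dpser r (f i)"
    and nz: "\<And>i. i < n \<Longrightarrow> \<not> (\<forall>\<^sub>F z in nhds 0. f i z = 0)"
    and E: "curve_separated E"
  shows "\<exists>e>0. \<exists>M. \<forall>y. 0 < \<bar>y\<bar> \<longrightarrow> \<bar>y\<bar> < e \<longrightarrow> (\<exists>P. finite P \<and> card P \<le> M \<and>
    (\<forall>u v. {u<..<v} \<subseteq> {-e<..<e} - P \<longrightarrow>
      (\<forall>x\<in>{u<..<v}. (x, y) \<in> E \<longrightarrow> (\<forall>i<n. f i (x, y) \<noteq> 0)) \<and>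
      (mono_on {u<..<v} (\<lambda>x. assoc_g n f \<gamma> E (x, y)) \<or> antimono_on {u<..<v} (\<lambda>x. assoc_g n f \<gamma> E (x, y)))))"
proof -
  obtain R where R: "\<And>i. i < n \<Longrightarrow> R i > 0 \<and> dpser (R i) (f i)" using f by metis
  define r where "r = Min (insert 1 (R ` {..<n}))"
  have r: "r > 0" unfolding r_def using R by (subst Min_gr_iff) auto
  have fr: "dpser r (f i)" if "i < n" for i
    by (rule dpser_mono[of "R i"]) (use R[OF that] r that in \<open>auto simp: r_def intro!: Min_le\<close>)
  obtain e1 M1 where e1: "0 < e1" "e1 \<le> r" and
    1: "\<And>y. 0 < \<bar>y\<bar> \<Longrightarrow> \<bar>y\<bar> < e1 \<Longrightarrow> \<exists>P. finite P \<and> card P \<le> M1 \<and>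
       (\<forall>a b. {a<..<b} \<subseteq> {-e1<..<e1} - P \<longrightarrow>
          (\<forall>i<n. \<forall>x\<in>{a<..<b}. f i (x,y) \<noteq> 0) \<and>
          (mono_on {a<..<b} (\<lambda>x. \<Prod>i<n. \<bar>f i (x,y)\<bar> powr \<gamma> i) \<or>
           antimono_on {a<..<b} (\<lambda>x. \<Prod>i<n. \<bar>f i (x,y)\<bar> powr \<gamma> i)))"
    by (rule dpser_prod_powr_piecewise_monotone[OF r fr nz, where \<gamma> = \<gamma>]) (assumption, assumption, rule that)
  obtain e2 M2 where e2: "e2 > 0" and 2: "\<And>y. 0 < \<bar>y\<bar> \<Longrightarrow> \<bar>y\<bar> < e2 \<Longrightarrow> \<exists>P. finite P \<and> card P \<le> M2 \<and>
    (\<forall>a b. {a<..<b} \<subseteq> {-e2<..<e2} - P \<longrightarrow> {a<..<b} \<times> {y} \<subseteq> E \<or> ({a<..<b} \<times> {y}) \<inter> E = {})"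
    by (rule curve_separated_lines[OF E]) blast
  define e where "e = min e1 e2"
  have e: "0 < e" "e \<le> e1" "e \<le> e2" using e1 e2 by (auto simp: e_def)
  show ?thesis
  proof (intro exI[of _ e] conjI e(1) exI[of _ "M1 + M2"] allI impI)
    fix y assume y: "0 < \<bar>y\<bar>" "\<bar>y\<bar> < e"
    then have y12: "\<bar>y\<bar> < e1" "\<bar>y\<bar> < e2" using e by auto
    obtain P1 where P1: "finite P1" "card P1 \<le> M1" and
      m: "\<And>a b. {a<..<b} \<subseteq> {-e1<..<e1} - P1 \<Longrightarrow>
          (\<forall>i<n. \<forall>x\<in>{a<..<b}. f i (x,y) \<noteq> 0) \<and>
          (mono_on {a<..<b} (\<lambda>x. \<Prod>i<n. \<bar>f i (x,y)\<bar> powr \<gamma> i) \<or>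
           antimono_on {a<..<b} (\<lambda>x. \<Prod>i<n. \<bar>f i (x,y)\<bar> powr \<gamma> i))"
      using 1[OF y(1) y12(1)] by blast
    obtain P2 where P2: "finite P2" "card P2 \<le> M2" and
      s: "\<And>a b. {a<..<b} \<subseteq> {-e2<..<e2} - P2 \<Longrightarrow> {a<..<b} \<times> {y} \<subseteq> E \<or> ({a<..<b} \<times> {y}) \<inter> E = {}"
      using 2[OF y(1) y12(2)] by blast
    show "\<exists>P. finite P \<and> card P \<le> M1 + M2 \<and>
    (\<forall>u v. {u<..<v} \<subseteq> {-e<..<e} - P \<longrightarrow>
      (\<forall>x\<in>{u<..<v}. (x, y) \<in> E \<longrightarrow> (\<forall>i<n. f i (x, y) \<noteq> 0)) \<and>
      (mono_on {u<..<v} (\<lambda>x. assoc_g n f \<gamma> E (x, y)) \<or> antimono_on {u<..<v} (\<lambda>x. assoc_g n f \<gamma> E (x, y))))"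
    proof (intro exI[of _ "P1 \<union> P2"] conjI[of "finite _"] conjI[of "card _ \<le> _"] allI impI)
      show "finite (P1 \<union> P2)" using P1 P2 by simp
      show "card (P1 \<union> P2) \<le> M1 + M2" using card_Un_le[of P1 P2] P1 P2 by linarith
      fix u v assume uv: "{u<..<v} \<subseteq> {-e<..<e} - (P1 \<union> P2)"
      have uv1: "{u<..<v} \<subseteq> {-e1<..<e1} - P1" using uv e by fastforce
      have uv2: "{u<..<v} \<subseteq> {-e2<..<e2} - P2" using uv e by fastforce
      from s[OF uv2] show "(\<forall>x\<in>{u<..<v}. (x, y) \<in> E \<longrightarrow> (\<forall>i<n. f i (x, y) \<noteq> 0)) \<and>
      (mono_on {u<..<v} (\<lambda>x. assoc_g n f \<gamma> E (x, y)) \<or> antimono_on {u<..<v} (\<lambda>x. assoc_g n f \<gamma> E (x, y)))"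
      proof
        assume sub: "{u<..<v} \<times> {y} \<subseteq> E"
        have g: "assoc_g n f \<gamma> E (x, y) = (\<Prod>i<n. \<bar>f i (x,y)\<bar> powr \<gamma> i)" if "x \<in> {u<..<v}" for x
        proof -
          have "(x, y) \<in> E" using sub that by blast
          then show ?thesis by (simp add: assoc_g_def)
        qed
        have "mono_on {u<..<v} (\<lambda>x. assoc_g n f \<gamma> E (x, y)) \<longleftrightarrow> mono_on {u<..<v} (\<lambda>x. \<Prod>i<n. \<bar>f i (x,y)\<bar> powr \<gamma> i)"
          "antimono_on {u<..<v} (\<lambda>x. assoc_g n f \<gamma> E (x, y)) \<longleftrightarrow> antimono_on {u<..<v} (\<lambda>x. \<Prod>i<n. \<bar>f i (x,y)\<bar> powr \<gamma> i)"
          unfolding monotone_on_def by (simp_all only: g cong: ball_cong)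
        with m[OF uv1] show ?thesis by blast
      next
        assume d: "({u<..<v} \<times> {y}) \<inter> E = {}"
        have "assoc_g n f \<gamma> E (x, y) = 0" if "x \<in> {u<..<v}" for x
        proof -
          have "(x, y) \<notin> E" using d that by blast
          then show ?thesis by (simp add: assoc_g_def)
        qed
        then have "mono_on {u<..<v} (\<lambda>x. assoc_g n f \<gamma> E (x, y))" by (auto simp: monotone_on_def)
        with d show ?thesis by blast
      qed
    qed
  qed
qed

section \<open>Exchange of the coordinates and verification of the local conditions\<close>

lemma distr_lborel_swap: "distr lborel lborel prod.swap = (lborel :: (real \<times> real) measure)"
proof -
  have "(lborel \<Otimes>\<^sub>M lborel :: (real \<times> real) measure) = distr (lborel \<Otimes>\<^sub>M lborel) (lborel \<Otimes>\<^sub>M lborel) (\<lambda>(x, y). (y, x))"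
    by (rule lborel_pair.distr_pair_swap)
  moreover have "(\<lambda>(x, y). (y, x)) = (prod.swap :: real \<times> real \<Rightarrow> real \<times> real)" by auto
  ultimately show ?thesis by (simp add: lborel_prod)
qed

lemma swap_measurable [measurable]: "prod.swap \<in> borel_measurable (borel :: (real \<times> real) measure)"
  by (intro borel_measurable_continuous_onI) (auto simp: prod.swap_def[abs_def] intro!: continuous_intros)

lemma AE_lborel_swap:
  assumes "AE z in (lborel :: (real \<times> real) measure). P z"
  shows "AE z in (lborel :: (real \<times> real) measure). P (prod.swap z)"
proof -
  have "AE z in distr lborel lborel prod.swap. P z" using assms by (simp only: distr_lborel_swap)
  from AE_distrD[OF _ this] show ?thesis by simp
qed

lemma nn_integral_lborel_swap:
  assumes "f \<in> borel_measurable (borel :: (real \<times> real) measure)"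
  shows "(\<integral>\<^sup>+z. f (prod.swap z) \<partial>lborel) = (\<integral>\<^sup>+z. f z \<partial>lborel)"
proof -
  have "(\<integral>\<^sup>+z. f z \<partial>lborel) = (\<integral>\<^sup>+z. f z \<partial>distr lborel lborel prod.swap)"
    by (simp only: distr_lborel_swap)
  also have "\<dots> = (\<integral>\<^sup>+z. f (prod.swap z) \<partial>lborel)"
    by (rule nn_integral_distr) (use assms in auto)
  finally show ?thesis by simp
qed

text \<open>A Lebesgue measurable function may have non-measurable slices, so it is replaced by a
  Borel one before it is integrated along lines.\<close>

lemma in_Lp_borel_version:
  assumes "in_Lp p N g" "open N" "\<And>z. 0 \<le> g z"
  obtains g' B where "g' \<in> borel_measurable borel" "0 \<le> B" "AE z in lborel. z \<in> N \<longrightarrow> g' z = g z"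
    "(\<integral>\<^sup>+z\<in>N. Lp_cost p B (g' z) \<partial>lborel) < \<infinity>"
proof -
  have "(\<lambda>z. indicator N z *\<^sub>R g z) \<in> borel_measurable lebesgue"
    using assms(1) by (simp add: in_Lp_def set_borel_measurable_def)
  then obtain g' where g': "g' \<in> borel_measurable lborel" and eq: "AE z in lborel. indicator N z *\<^sub>R g z = g' z"
    using completion_ex_borel_measurable_real by blast
  then have [measurable]: "g' \<in> borel_measurable borel" by simp
  have [measurable]: "N \<in> sets borel" using assms(2) by simp
  have eq': "AE z in lborel. z \<in> N \<longrightarrow> g' z = g z" using eq by eventually_elim auto
  show ?thesis
  proof (cases "p = \<infinity>")
    case True
    then obtain B where "AE z in lebesgue. z \<in> N \<longrightarrow> \<bar>g z\<bar> \<le> B"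
      using assms(1) by (auto simp: in_Lp_def)
    then have "AE z in lborel. z \<in> N \<longrightarrow> \<bar>g z\<bar> \<le> B" by (simp add: AE_completion_iff)
    \<comment> \<open>The given essential bound carries no sign, whereas 0 \<le> B is required;
      hence the maximum with 0.\<close>
    with eq' have "AE z in lborel. Lp_cost p (max 0 B) (g' z) * indicator N z = 0"
      by eventually_elim (auto simp: Lp_cost_def True indicator_def)
    then have "(\<integral>\<^sup>+z\<in>N. Lp_cost p (max 0 B) (g' z) \<partial>lborel) = 0"
      by (subst nn_integral_0_iff_AE) auto
    then show ?thesis by (intro that[of g' "max 0 B"] eq') auto
  next
    case False
    then have "integrable lebesgue (\<lambda>z. indicator N z *\<^sub>R (\<bar>g z\<bar> powr enn2real p))"
      using assms(1) by (simp add: in_Lp_def set_integrable_def)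
    then have "(\<integral>\<^sup>+z. ennreal (norm (indicator N z *\<^sub>R (\<bar>g z\<bar> powr enn2real p))) \<partial>lebesgue) < \<infinity>"
      by (simp add: integrable_iff_bounded)
    then have fin: "(\<integral>\<^sup>+z. ennreal (norm (indicator N z *\<^sub>R (\<bar>g z\<bar> powr enn2real p))) \<partial>lborel) < \<infinity>"
      by (simp add: nn_integral_completion)
    have "(\<integral>\<^sup>+z\<in>N. Lp_cost p 0 (g' z) \<partial>lborel) = (\<integral>\<^sup>+z. ennreal (norm (indicator N z *\<^sub>R (\<bar>g z\<bar> powr enn2real p))) \<partial>lborel)"
      using eq' by (intro nn_integral_cong_AE, eventually_elim)
        (use False in \<open>auto simp: Lp_cost_def indicator_def assms(3)\<close>)
    with fin show ?thesis by (intro that[of g' 0] eq') auto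
  qed
qed

lemma open_contains_square:
  assumes "open V" "0 \<in> V"
  obtains e where "e > 0" "square e \<subseteq> V"
proof -
  obtain r where r: "r > 0" "ball 0 r \<subseteq> V" using assms open_contains_ball by blast
  have "square (r/2) \<subseteq> ball 0 r"
  proof
    fix z assume z: "z \<in> square (r/2)"
    have "norm z \<le> \<bar>fst z\<bar> + \<bar>snd z\<bar>" using norm_Pair_le[of "fst z" "snd z"] by simp
    then show "z \<in> ball 0 r" using z by (auto simp: square_def)
  qed
  then show ?thesis using that[of "r/2"] r by auto
qed

text \<open>All conditions are restricted to one square inside V and N. On a piece no factor
  vanishes inside E, so the identity for m holds at every point of it. Keeping the ingredients
  abstract lets the argument serve both the original data and their mirror image.\<close>

lemma line_monotone_atI:
  assumes pieces: "\<exists>e>0. \<exists>M. \<forall>y. 0 < \<bar>y\<bar> \<longrightarrow> \<bar>y\<bar> < e \<longrightarrow> (\<exists>P. finite P \<and> card P \<le> M \<and>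
    (\<forall>u v. {u<..<v} \<subseteq> {-e<..<e} - P \<longrightarrow>
      (\<forall>x\<in>{u<..<v}. (x, y) \<in> E \<longrightarrow> (\<forall>i<n. f i (x, y) \<noteq> 0)) \<and>
      (mono_on {u<..<v} (\<lambda>x. assoc_g n f \<gamma> E (x, y)) \<or> antimono_on {u<..<v} (\<lambda>x. assoc_g n f \<gamma> E (x, y)))))"
    and V: "open V" "0 \<in> V"
    and form: "\<And>z. z \<in> V \<Longrightarrow> (z \<in> E \<longrightarrow> (\<forall>i<n. f i z \<noteq> 0)) \<Longrightarrow>
      m (z\<^sub>0 + z) = \<alpha> z * complex_of_real (assoc_g n f \<gamma> E z)"
    and bd: "\<And>z. z \<in> V \<Longrightarrow> norm (\<alpha> z) \<le> A"
    and der: "\<And>x y. (x, y) \<in> V \<Longrightarrow> x \<noteq> 0 \<Longrightarrow>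
      ((\<lambda>x. \<alpha> (x, y)) has_vector_derivative \<alpha>' (x, y)) (at x) \<and> norm (\<alpha>' (x, y)) \<le> A / \<bar>x\<bar>"
    and N: "open N" "0 \<in> N"
    and g': "g' \<in> borel_measurable borel" "0 \<le> B"
      "AE z in lborel. z \<in> N \<longrightarrow> g' z = assoc_g n f \<gamma> E z"
      "(\<integral>\<^sup>+z\<in>N. Lp_cost p B (g' z) \<partial>lborel) < \<infinity>"
  shows "line_monotone_at p m z\<^sub>0"
proof -
  obtain e1 M where e1: "e1 > 0" and pc: "\<forall>y. 0 < \<bar>y\<bar> \<longrightarrow> \<bar>y\<bar> < e1 \<longrightarrow> (\<exists>P. finite P \<and> card P \<le> M \<and>
    (\<forall>u v. {u<..<v} \<subseteq> {-e1<..<e1} - P \<longrightarrow>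
      (\<forall>x\<in>{u<..<v}. (x, y) \<in> E \<longrightarrow> (\<forall>i<n. f i (x, y) \<noteq> 0)) \<and>
      (mono_on {u<..<v} (\<lambda>x. assoc_g n f \<gamma> E (x, y)) \<or> antimono_on {u<..<v} (\<lambda>x. assoc_g n f \<gamma> E (x, y)))))"
    using pieces by (elim exE conjE) (rule that)
  obtain e2 where e2: "e2 > 0" "square e2 \<subseteq> V \<inter> N"
    using open_contains_square[of "V \<inter> N"] V N by (auto simp: open_Int)
  define e where "e = min e1 e2"
  have e: "0 < e" "e \<le> e1" "e \<le> e2" using e1 e2 by (auto simp: e_def)
  have sq: "(x, y) \<in> V" "(x, y) \<in> N" if "\<bar>x\<bar> < e" "\<bar>y\<bar> < e" for x y
    using that e2 e by (auto simp: square_def subset_iff)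
  have sqN: "z \<in> N" if "z \<in> square e" for z
    using that sq(2)[of "fst z" "snd z"] by (auto simp: square_def)
  show ?thesis
    unfolding line_monotone_at_def
  proof (rule exI[of _ e], rule exI[of _ A], rule exI[of _ M], rule exI[of _ B], rule exI[of _ \<alpha>], rule exI[of _ \<alpha>'],
      rule exI[of _ "assoc_g n f \<gamma> E"], rule exI[of _ g'], intro conjI allI impI)
    show "0 < e" "g' \<in> borel_measurable borel" "0 \<le> B" by (fact e g')+
    show "0 \<le> A" using order_trans[OF norm_ge_zero bd[OF V(2)]] .
    show "0 \<le> assoc_g n f \<gamma> E z" for z by (rule assoc_g_nonneg)
    show "AE z in lborel. z \<in> square e \<longrightarrow> g' z = assoc_g n f \<gamma> E z"
      using g'(3) by eventually_elim (use sqN in auto)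
    have "(\<integral>\<^sup>+z\<in>square e. Lp_cost p B (g' z) \<partial>lborel) \<le> (\<integral>\<^sup>+z\<in>N. Lp_cost p B (g' z) \<partial>lborel)"
      by (intro nn_integral_mono) (use sqN in \<open>auto simp: indicator_def\<close>)
    then show "(\<integral>\<^sup>+z\<in>square e. Lp_cost p B (g' z) \<partial>lborel) < \<infinity>"
      using g'(4) by (rule order.strict_trans1)
  next
    fix x y assume xy: "\<bar>x\<bar> < e" "\<bar>y\<bar> < e"
    show "norm (\<alpha> (x, y)) \<le> A" by (rule bd[OF sq(1)[OF xy]])
    show "((\<lambda>x. \<alpha> (x, y)) has_vector_derivative \<alpha>' (x, y)) (at x)" if "x \<noteq> 0"
      using der[OF sq(1)[OF xy] that] by (rule conjunct1)
    show "norm (\<alpha>' (x, y)) \<le> A / \<bar>x\<bar>" if "x \<noteq> 0"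
      using der[OF sq(1)[OF xy] that] by (rule conjunct2)
  next
    fix y assume y: "0 < \<bar>y\<bar>" "\<bar>y\<bar> < e"
    then have "\<bar>y\<bar> < e1" using e by simp
    from pc[rule_format, OF y(1) this] obtain P where P: "finite P" "card P \<le> M" and
      h: "\<forall>u v. {u<..<v} \<subseteq> {-e1<..<e1} - P \<longrightarrow>
      (\<forall>x\<in>{u<..<v}. (x, y) \<in> E \<longrightarrow> (\<forall>i<n. f i (x, y) \<noteq> 0)) \<and>
      (mono_on {u<..<v} (\<lambda>x. assoc_g n f \<gamma> E (x, y)) \<or> antimono_on {u<..<v} (\<lambda>x. assoc_g n f \<gamma> E (x, y)))"
      by (elim exE conjE) (rule that)
    have "(\<forall>x\<in>{u<..<v}. m (z\<^sub>0 + (x, y)) = \<alpha> (x, y) * complex_of_real (assoc_g n f \<gamma> E (x, y))) \<and>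
      (mono_on {u<..<v} (\<lambda>x. assoc_g n f \<gamma> E (x, y)) \<or> antimono_on {u<..<v} (\<lambda>x. assoc_g n f \<gamma> E (x, y)))"
      if uv: "{u<..<v} \<subseteq> {-e<..<e} - P" for u v
    proof -
      have "{u<..<v} \<subseteq> {-e1<..<e1} - P" using uv e by fastforce
      note h' = h[rule_format, OF this]
      have "m (z\<^sub>0 + (x, y)) = \<alpha> (x, y) * complex_of_real (assoc_g n f \<gamma> E (x, y))" if x: "x \<in> {u<..<v}" for x
      proof (rule form)
        have "x \<in> {-e<..<e}" using uv x by blast
        then show "(x, y) \<in> V" using sq(1) y by auto
        show "(x, y) \<in> E \<longrightarrow> (\<forall>i<n. f i (x, y) \<noteq> 0)" using h' x by blast
      qed
      with h' show ?thesis by blast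
    qed
    with P show "\<exists>P. finite P \<and> card P \<le> M \<and>
        (\<forall>u v. {u<..<v} \<subseteq> {-e<..<e} - P \<longrightarrow>
          (\<forall>x\<in>{u<..<v}. m (z\<^sub>0 + (x, y)) = \<alpha> (x, y) * complex_of_real (assoc_g n f \<gamma> E (x, y))) \<and>
          (mono_on {u<..<v} (\<lambda>x. assoc_g n f \<gamma> E (x, y)) \<or> antimono_on {u<..<v} (\<lambda>x. assoc_g n f \<gamma> E (x, y))))"
      by (intro exI[of _ P]) simp
  qed
qed

text \<open>Since |z| is at least |x| and at least |y|, the gradient bound becomes a bound on each
  partial derivative whose only singularity on a line is at 0. The derivative in y serves the
  reflected multiplier.\<close>

lemma C1_amplitude_partial_derivatives:
  assumes "C1_amplitude V \<alpha>"
  obtains A \<alpha>\<^sub>x \<alpha>\<^sub>y where "\<And>z. z \<in> V \<Longrightarrow> norm (\<alpha> z) \<le> A"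
    "\<And>x y. (x, y) \<in> V \<Longrightarrow> x \<noteq> 0 \<Longrightarrow>
      ((\<lambda>x. \<alpha> (x, y)) has_vector_derivative \<alpha>\<^sub>x (x, y)) (at x) \<and> norm (\<alpha>\<^sub>x (x, y)) \<le> A / \<bar>x\<bar>"
    "\<And>x y. (x, y) \<in> V \<Longrightarrow> y \<noteq> 0 \<Longrightarrow>
      ((\<lambda>y. \<alpha> (x, y)) has_vector_derivative \<alpha>\<^sub>y (x, y)) (at y) \<and> norm (\<alpha>\<^sub>y (x, y)) \<le> A / \<bar>y\<bar>"
proof -
  obtain A \<alpha>\<^sub>x \<alpha>\<^sub>y where bd: "\<forall>z\<in>V. norm (\<alpha> z) \<le> A" and
    der: "\<forall>z\<in>V - {0}. (\<alpha> has_derivative (\<lambda>(a, b). a *\<^sub>R \<alpha>\<^sub>x z + b *\<^sub>R \<alpha>\<^sub>y z)) (at z) \<and>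
           norm (\<alpha>\<^sub>x z, \<alpha>\<^sub>y z) \<le> A / norm z"
    using assms unfolding C1_amplitude_def by (elim exE conjE) (rule that)
  have D: "(\<alpha> has_derivative (\<lambda>p. fst p *\<^sub>R \<alpha>\<^sub>x z + snd p *\<^sub>R \<alpha>\<^sub>y z)) (at z)"
    and n: "norm (\<alpha>\<^sub>x z) \<le> A / norm z" "norm (\<alpha>\<^sub>y z) \<le> A / norm z" if "z \<in> V" "z \<noteq> 0" for z
  proof -
    have d: "(\<alpha> has_derivative (\<lambda>(a, b). a *\<^sub>R \<alpha>\<^sub>x z + b *\<^sub>R \<alpha>\<^sub>y z)) (at z)" "norm (\<alpha>\<^sub>x z, \<alpha>\<^sub>y z) \<le> A / norm z"
      using der that by auto
    show "(\<alpha> has_derivative (\<lambda>p. fst p *\<^sub>R \<alpha>\<^sub>x z + snd p *\<^sub>R \<alpha>\<^sub>y z)) (at z)"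
      using d(1) by (simp add: case_prod_unfold)
    show "norm (\<alpha>\<^sub>x z) \<le> A / norm z" "norm (\<alpha>\<^sub>y z) \<le> A / norm z"
      using d(2) norm_fst_le[of "\<alpha>\<^sub>x z" "\<alpha>\<^sub>y z"] norm_snd_le[of "\<alpha>\<^sub>y z" "\<alpha>\<^sub>x z"] by linarith+
  qed
  have le: "A / norm z \<le> A / c" if "z \<in> V" "0 < c" "c \<le> norm z" for z c
  proof -
    have "0 \<le> A" using order_trans[OF norm_ge_zero bd[rule_format, OF that(1)]] .
    then show ?thesis using that by (intro divide_left_mono mult_pos_pos) auto
  qed
  show ?thesis
  proof (rule that)
    show "norm (\<alpha> z) \<le> A" if "z \<in> V" for z using bd that by blast
    fix x y assume V: "(x, y) \<in> V"
    show "((\<lambda>x. \<alpha> (x, y)) has_vector_derivative \<alpha>\<^sub>x (x, y)) (at x) \<and> norm (\<alpha>\<^sub>x (x, y)) \<le> A / \<bar>x\<bar>" if x: "x \<noteq> 0"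
    proof
      have nz: "(x, y) \<noteq> 0" using x by (simp add: zero_prod_def)
      have "((\<lambda>x. (x, y)) has_derivative (\<lambda>a. (a, 0))) (at x)"
        by (auto intro!: derivative_eq_intros)
      from diff_chain_at[OF this D[OF V nz]]
      show "((\<lambda>x. \<alpha> (x, y)) has_vector_derivative \<alpha>\<^sub>x (x, y)) (at x)"
        by (simp add: has_vector_derivative_def o_def)
      have "norm (\<alpha>\<^sub>x (x, y)) \<le> A / norm (x, y)" by (rule n(1)[OF V nz])
      also have "\<dots> \<le> A / \<bar>x\<bar>" using x norm_fst_le[of x y] by (intro le V) auto
      finally show "norm (\<alpha>\<^sub>x (x, y)) \<le> A / \<bar>x\<bar>" .
    qed
    show "((\<lambda>y. \<alpha> (x, y)) has_vector_derivative \<alpha>\<^sub>y (x, y)) (at y) \<and> norm (\<alpha>\<^sub>y (x, y)) \<le> A / \<bar>y\<bar>" if y: "y \<noteq> 0"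
    proof
      have nz: "(x, y) \<noteq> 0" using y by (simp add: zero_prod_def)
      have "((\<lambda>y. (x, y)) has_derivative (\<lambda>b. (0, b))) (at y)"
        by (auto intro!: derivative_eq_intros)
      from diff_chain_at[OF this D[OF V nz]]
      show "((\<lambda>y. \<alpha> (x, y)) has_vector_derivative \<alpha>\<^sub>y (x, y)) (at y)"
        by (simp add: has_vector_derivative_def o_def)
      have "norm (\<alpha>\<^sub>y (x, y)) \<le> A / norm (x, y)" by (rule n(2)[OF V nz])
      also have "\<dots> \<le> A / \<bar>y\<bar>" using y norm_snd_le[of y x] by (intro le V) auto
      finally show "norm (\<alpha>\<^sub>y (x, y)) \<le> A / \<bar>y\<bar>" .
    qed
  qed
qed

lemma continuous_on_swap: "continuous_on S (prod.swap :: real \<times> real \<Rightarrow> _)"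
  by (simp add: prod.swap_def[abs_def] continuous_intros)

lemma swap_0 [simp]: "prod.swap (0 :: real \<times> real) = 0"
  by (simp add: zero_prod_def)

lemma swap_add: "prod.swap (a + b) = prod.swap a + prod.swap (b :: real \<times> real)"
  by (simp add: prod_eq_iff)

lemma mem_swap_image_iff: "z \<in> prod.swap ` E \<longleftrightarrow> prod.swap z \<in> E"
  by (force simp: image_iff)

lemma assoc_g_swap: "assoc_g n (\<lambda>i. f i \<circ> prod.swap) \<gamma> (prod.swap ` E) z = assoc_g n f \<gamma> E (prod.swap z)"
  unfolding assoc_g_def by (simp add: indicator_def mem_swap_image_iff)

lemma open_swap_vimage: "open (V :: (real \<times> real) set) \<Longrightarrow> open (prod.swap -` V)"
  by (rule open_vimage) (auto intro: continuous_on_swap)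

lemma eventually_nhds_0_swap:
  assumes "\<forall>\<^sub>F z in nhds (0 :: real \<times> real). P (prod.swap z)"
  shows "\<forall>\<^sub>F z in nhds (0 :: real \<times> real). P z"
proof -
  obtain S where S: "open S" "0 \<in> S" "\<And>z. z \<in> S \<Longrightarrow> P (prod.swap z)"
    using assms unfolding eventually_nhds by blast
  have "P z" if "z \<in> prod.swap -` S" for z using S(3)[of "prod.swap z"] that by simp
  moreover have "open (prod.swap -` S)" "0 \<in> prod.swap -` S" using S open_swap_vimage by auto
  ultimately show ?thesis unfolding eventually_nhds by blast
qed

text \<open>The second claim is the first one for the data reflected in the diagonal, with
  \<open>\<alpha>\<^sub>y\<close> in place of \<open>\<alpha>\<^sub>x\<close>. It yields the decay
  in u.\<close>

lemma local_form_line_monotone_at: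
  assumes data: "local_data n f \<gamma> E" and form: "local_form m z\<^sub>0 \<alpha> n f \<gamma> E"
    and N: "open N" "0 \<in> N" "in_Lp p N (assoc_g n f \<gamma> E)"
  shows "line_monotone_at p m z\<^sub>0" "line_monotone_at p (m \<circ> prod.swap) (prod.swap z\<^sub>0)"
proof -
  have f: "\<exists>r>0. dpser r (f i)" if "i < n" for i
  proof -
    have "real_analytic2_near (f i) 0" using data that by (simp add: local_data_def)
    from dpser_of_real_analytic2_near[OF this] show ?thesis by blast
  qed
  have nz: "\<not> (\<forall>\<^sub>F z in nhds 0. f i z = 0)" if "i < n" for i
    using data that by (simp add: local_data_def)
  have E: "curve_separated E"
    using data by (simp add: local_data_def admissible_region_curve_separated)
  obtain V where V: "open V" "0 \<in> V" "C1_amplitude V \<alpha>"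
    and id: "\<forall>z\<in>V. (z \<in> E \<longrightarrow> (\<forall>i<n. \<gamma> i \<le> 0 \<longrightarrow> f i z \<noteq> 0)) \<longrightarrow>
           m (z\<^sub>0 + z) = \<alpha> z * complex_of_real (assoc_g n f \<gamma> E z)"
    using form unfolding local_form_def by blast
  obtain A \<alpha>\<^sub>x \<alpha>\<^sub>y where bd: "\<And>z. z \<in> V \<Longrightarrow> norm (\<alpha> z) \<le> A" and
    dx: "\<And>x y. (x, y) \<in> V \<Longrightarrow> x \<noteq> 0 \<Longrightarrow>
      ((\<lambda>x. \<alpha> (x, y)) has_vector_derivative \<alpha>\<^sub>x (x, y)) (at x) \<and> norm (\<alpha>\<^sub>x (x, y)) \<le> A / \<bar>x\<bar>" and
    dy: "\<And>x y. (x, y) \<in> V \<Longrightarrow> y \<noteq> 0 \<Longrightarrow>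
      ((\<lambda>y. \<alpha> (x, y)) has_vector_derivative \<alpha>\<^sub>y (x, y)) (at y) \<and> norm (\<alpha>\<^sub>y (x, y)) \<le> A / \<bar>y\<bar>"
    by (rule C1_amplitude_partial_derivatives[OF V(3)]) blast
  obtain g' B where g': "g' \<in> borel_measurable borel" "0 \<le> B"
    "AE z in lborel. z \<in> N \<longrightarrow> g' z = assoc_g n f \<gamma> E z"
    "(\<integral>\<^sup>+z\<in>N. Lp_cost p B (g' z) \<partial>lborel) < \<infinity>"
    by (rule in_Lp_borel_version[OF N(3,1) assoc_g_nonneg]) blast
  have [measurable]: "g' \<in> borel_measurable borel" "N \<in> sets borel" using g'(1) N(1) by auto
  show "line_monotone_at p m z\<^sub>0"
    by (rule line_monotone_atI[OF assoc_g_piecewise_monotone[OF f nz E] V(1,2) _ bd dx N(1,2) g'])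
      (use id in auto)
  let ?s = "prod.swap :: real \<times> real \<Rightarrow> real \<times> real"
  show "line_monotone_at p (m \<circ> ?s) (?s z\<^sub>0)"
  proof (rule line_monotone_atI[where f = "\<lambda>i. f i \<circ> ?s" and E = "?s ` E" and V = "?s -` V" and N = "?s -` N"
        and \<alpha> = "\<alpha> \<circ> ?s" and \<alpha>' = "\<alpha>\<^sub>y \<circ> ?s" and A = A and B = B and g' = "g' \<circ> ?s" and n = n and \<gamma> = \<gamma>,
        OF assoc_g_piecewise_monotone])
    show "\<exists>r>0. dpser r (f i \<circ> ?s)" if "i < n" for i using f[OF that] dpser_swap by blast
    show "\<not> (\<forall>\<^sub>F z in nhds 0. (f i \<circ> ?s) z = 0)" if "i < n" for i
      using nz[OF that] eventually_nhds_0_swap[of "\<lambda>z. f i z = 0"] by auto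
    show "curve_separated (?s ` E)" by (rule curve_separated_swap[OF E])
    show "open (?s -` V)" "open (?s -` N)" using V(1) N(1) by (auto intro: open_swap_vimage)
    show "0 \<in> ?s -` V" "0 \<in> ?s -` N" using V(2) N(2) by auto
    show "norm ((\<alpha> \<circ> ?s) z) \<le> A" if "z \<in> ?s -` V" for z using bd that by simp
    show "((\<lambda>x. (\<alpha> \<circ> ?s) (x, y)) has_vector_derivative (\<alpha>\<^sub>y \<circ> ?s) (x, y)) (at x) \<and> norm ((\<alpha>\<^sub>y \<circ> ?s) (x, y)) \<le> A / \<bar>x\<bar>"
      if "(x, y) \<in> ?s -` V" "x \<noteq> 0" for x y using dy[of y x] that by simp
    show "(m \<circ> ?s) (?s z\<^sub>0 + z) = (\<alpha> \<circ> ?s) z * complex_of_real (assoc_g n (\<lambda>i. f i \<circ> ?s) \<gamma> (?s ` E) z)"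
      if "z \<in> ?s -` V" "z \<in> ?s ` E \<longrightarrow> (\<forall>i<n. (f i \<circ> ?s) z \<noteq> 0)" for z
    proof -
      have "m (z\<^sub>0 + ?s z) = \<alpha> (?s z) * complex_of_real (assoc_g n f \<gamma> E (?s z))"
        using id[rule_format, of "?s z"] that by (auto simp: mem_swap_image_iff)
      then show ?thesis by (simp add: swap_add assoc_g_swap)
    qed
    show "g' \<circ> ?s \<in> borel_measurable borel" by measurable
    show "0 \<le> B" by fact
    show "AE z in lborel. z \<in> ?s -` N \<longrightarrow> (g' \<circ> ?s) z = assoc_g n (\<lambda>i. f i \<circ> ?s) \<gamma> (?s ` E) z"
      using AE_lborel_swap[OF g'(3)] by eventually_elim (simp add: assoc_g_swap)
    have "(\<integral>\<^sup>+z\<in>?s -` N. Lp_cost p B ((g' \<circ> ?s) z) \<partial>lborel) = (\<integral>\<^sup>+z. Lp_cost p B (g' (?s z)) * indicator N (?s z) \<partial>lborel)"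
      by (intro nn_integral_cong) (auto simp: indicator_def)
    also have "\<dots> = (\<integral>\<^sup>+z\<in>N. Lp_cost p B (g' z) \<partial>lborel)"
      by (rule nn_integral_lborel_swap[of "\<lambda>z. Lp_cost p B (g' z) * indicator N z"]) measurable
    finally show "(\<integral>\<^sup>+z\<in>?s -` N. Lp_cost p B ((g' \<circ> ?s) z) \<partial>lborel) < \<infinity>" using g'(4) by simp
  qed
qed

section \<open>Decay of the kernel\<close>

text \<open>For small \<open>d\<close>, whenever \<open>m' z\<close> and \<open>m' (z + (d, 0))\<close> differ both points lie in one of finitely many squares
  of the cover.\<close>

lemma shift_estimate:
  assumes p: "1 < p" and S: "compact S" and L: "\<And>z. z \<in> S \<Longrightarrow> line_monotone_at p m z"
    and m' [measurable]: "m' \<in> borel_measurable borel" and mm': "AE z in lborel. m' z = m z"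
    and out: "\<And>z. z \<notin> S \<Longrightarrow> m' z = 0"
  obtains \<delta> K where "0 < \<delta>" "\<delta> \<le> 1/2" "0 \<le> K"
    "\<And>d. 0 < d \<Longrightarrow> d < \<delta> \<Longrightarrow>
      (\<integral>\<^sup>+z. ennreal (norm (m' (z + (d, 0)) - m' z)) \<partial>lborel) \<le> ennreal (K * rate p d)"
proof -
  define D where "D \<delta> z\<^sub>0 d z = ennreal (norm (indicator (square \<delta>) (z + (d, 0)) * m' (z\<^sub>0 + (z + (d, 0))) -
         indicator (square \<delta>) z * m' (z\<^sub>0 + z)))" for \<delta> z\<^sub>0 d z
  have Dm [measurable]: "D \<delta> z\<^sub>0 d \<in> borel_measurable borel" for \<delta> z\<^sub>0 d
    unfolding D_def by measurable
  have "\<exists>\<delta> K. 0 < \<delta> \<and> 0 \<le> K \<and> (\<forall>d. 0 < d \<longrightarrow> d \<le> 1/2 \<longrightarrow> (\<integral>\<^sup>+z. D \<delta> z\<^sub>0 d z \<partial>lborel) \<le> ennreal (K * rate p d))"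
    if "z\<^sub>0 \<in> S" for z\<^sub>0
    unfolding D_def by (rule local_shift_estimate[OF p L[OF that] m' mm']) blast
  then obtain \<delta> K where \<delta>: "\<And>z\<^sub>0. z\<^sub>0 \<in> S \<Longrightarrow> 0 < \<delta> z\<^sub>0" and K: "\<And>z\<^sub>0. z\<^sub>0 \<in> S \<Longrightarrow> 0 \<le> K z\<^sub>0"
    and est: "\<And>z\<^sub>0 d. z\<^sub>0 \<in> S \<Longrightarrow> 0 < d \<Longrightarrow> d \<le> 1/2 \<Longrightarrow> (\<integral>\<^sup>+z. D (\<delta> z\<^sub>0) z\<^sub>0 d z \<partial>lborel) \<le> ennreal (K z\<^sub>0 * rate p d)"
    by metis
  \<comment> \<open>The cover uses squares of half size: a shift by d < \<delta>/2 from a half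
    square stays in the full square, so both indicators in \<open>D\<close> are 1.\<close>
  have cov0: "S \<subseteq> (\<Union>z\<^sub>0\<in>S. (\<lambda>z. z - z\<^sub>0) -` square (\<delta> z\<^sub>0 / 2))"
    using \<delta> by (fastforce simp: square_def)
  have op: "open ((\<lambda>z. z - z\<^sub>0) -` square (\<delta> z\<^sub>0 / 2))" for z\<^sub>0
    by (rule open_vimage[OF open_square]) (intro continuous_intros)
  obtain Z where Z: "Z \<subseteq> S" "finite Z" and cov: "S \<subseteq> (\<Union>z\<^sub>0\<in>Z. (\<lambda>z. z - z\<^sub>0) -` square (\<delta> z\<^sub>0 / 2))"
    by (rule compactE_image[OF S op cov0])
  \<comment> \<open>The entry 1/2 keeps d within the range of the local estimates and makes the
    minimum meaningful when Z is empty.\<close>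
  define d0 where "d0 = Min (insert (1/2) ((\<lambda>z\<^sub>0. \<delta> z\<^sub>0 / 2) ` Z))"
  have d0: "0 < d0" "d0 \<le> 1/2" "\<And>z\<^sub>0. z\<^sub>0 \<in> Z \<Longrightarrow> d0 \<le> \<delta> z\<^sub>0 / 2"
  proof -
    show "0 < d0" unfolding d0_def using \<delta> Z by (subst Min_gr_iff) auto
    show "d0 \<le> 1/2" unfolding d0_def using Z by (intro Min_le) auto
    show "d0 \<le> \<delta> z\<^sub>0 / 2" if "z\<^sub>0 \<in> Z" for z\<^sub>0 unfolding d0_def using Z that by (intro Min_le) auto
  qed
  have "(\<integral>\<^sup>+z. ennreal (norm (m' (z + (d, 0)) - m' z)) \<partial>lborel) \<le> ennreal ((\<Sum>z\<^sub>0\<in>Z. K z\<^sub>0) * rate p d)"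
    if d: "0 < d" "d < d0" for d
  proof -
    have dh: "d \<le> 1/2" using d d0 by simp
    have pw: "ennreal (norm (m' (w + (d, 0)) - m' w)) \<le> (\<Sum>z\<^sub>0\<in>Z. D (\<delta> z\<^sub>0) z\<^sub>0 d (w - z\<^sub>0))" for w
    proof (cases "m' (w + (d, 0)) = m' w")
      case False
      then have "w \<in> S \<or> w + (d, 0) \<in> S" using out by metis
      then obtain z\<^sub>0 where z0: "z\<^sub>0 \<in> Z" and "w - z\<^sub>0 \<in> square (\<delta> z\<^sub>0 / 2) \<or> w + (d, 0) - z\<^sub>0 \<in> square (\<delta> z\<^sub>0 / 2)"
        using cov by blast
      then have "\<bar>fst w - fst z\<^sub>0\<bar> < \<delta> z\<^sub>0 / 2 \<or> \<bar>fst w + d - fst z\<^sub>0\<bar> < \<delta> z\<^sub>0 / 2" "\<bar>snd w - snd z\<^sub>0\<bar> < \<delta> z\<^sub>0 / 2"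
        by (auto simp: square_def)
      then have "\<bar>fst w - fst z\<^sub>0\<bar> < \<delta> z\<^sub>0" "\<bar>fst w - fst z\<^sub>0 + d\<bar> < \<delta> z\<^sub>0" "\<bar>snd w - snd z\<^sub>0\<bar> < \<delta> z\<^sub>0"
        using d d0(3)[OF z0] by linarith+
      then have "w - z\<^sub>0 \<in> square (\<delta> z\<^sub>0)" "(w - z\<^sub>0) + (d, 0) \<in> square (\<delta> z\<^sub>0)"
        by (auto simp: square_def)
      then have "ennreal (norm (m' (w + (d, 0)) - m' w)) = D (\<delta> z\<^sub>0) z\<^sub>0 d (w - z\<^sub>0)"
        unfolding D_def by (simp add: algebra_simps)
      also have "\<dots> \<le> (\<Sum>z\<^sub>0\<in>Z. D (\<delta> z\<^sub>0) z\<^sub>0 d (w - z\<^sub>0))"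
        using Z z0 by (intro member_le_sum) auto
      finally show ?thesis .
    qed simp
    have "(\<integral>\<^sup>+z. ennreal (norm (m' (z + (d, 0)) - m' z)) \<partial>lborel) \<le> (\<integral>\<^sup>+w. (\<Sum>z\<^sub>0\<in>Z. D (\<delta> z\<^sub>0) z\<^sub>0 d (w - z\<^sub>0)) \<partial>lborel)"
      by (intro nn_integral_mono pw)
    also have "\<dots> = (\<Sum>z\<^sub>0\<in>Z. \<integral>\<^sup>+w. D (\<delta> z\<^sub>0) z\<^sub>0 d (w - z\<^sub>0) \<partial>lborel)"
      by (rule nn_integral_sum) measurable
    also have "\<dots> = (\<Sum>z\<^sub>0\<in>Z. \<integral>\<^sup>+w. D (\<delta> z\<^sub>0) z\<^sub>0 d w \<partial>lborel)"
    proof (rule sum.cong[OF refl])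
      fix z\<^sub>0
      show "(\<integral>\<^sup>+w. D (\<delta> z\<^sub>0) z\<^sub>0 d (w - z\<^sub>0) \<partial>lborel) = (\<integral>\<^sup>+w. D (\<delta> z\<^sub>0) z\<^sub>0 d w \<partial>lborel)"
        using nn_integral_lborel_shift[OF Dm, of "\<delta> z\<^sub>0" z\<^sub>0 d "- z\<^sub>0"] by simp
    qed
    also have "\<dots> \<le> (\<Sum>z\<^sub>0\<in>Z. ennreal (K z\<^sub>0 * rate p d))"
      using Z d dh by (intro sum_mono est) auto
    also have "\<dots> = ennreal ((\<Sum>z\<^sub>0\<in>Z. K z\<^sub>0) * rate p d)"
    proof -
      have "0 < rate p d" by (rule rate_pos[OF d(1) dh])
      then show ?thesis using K Z by (subst sum_ennreal) (auto simp: sum_distrib_right intro!: mult_nonneg_nonneg)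
    qed
    finally show ?thesis .
  qed
  moreover have "0 \<le> (\<Sum>z\<^sub>0\<in>Z. K z\<^sub>0)" using K Z by (intro sum_nonneg) auto
  ultimately show ?thesis using that d0 by blast
qed

section \<open>The oscillating factor and decay in one frequency\<close>

definition osc :: "real \<Rightarrow> real \<Rightarrow> real \<times> real \<Rightarrow> complex" where
  "osc t u z = exp (\<i> * complex_of_real t * complex_of_real (fst z) + \<i> * complex_of_real u * complex_of_real (snd z))"

lemma norm_osc [simp]: "norm (osc t u z) = 1"
  by (simp add: osc_def norm_exp_eq_Re)

lemma osc_measurable [measurable]: "osc t u \<in> borel_measurable borel"
  unfolding osc_def by (intro borel_measurable_continuous_onI continuous_intros)

text \<open>Shifting by \<open>\<pi> / \<bar>t\<bar>\<close> in the first variable changes the sign of the oscillating factor.\<close>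

lemma norm_osc_integral_le_shift:
  assumes m' [measurable]: "m' \<in> borel_measurable borel" and int: "integrable lborel m'" and t: "t \<noteq> 0"
  shows "ennreal (2 * norm (LINT z|lborel. m' z * osc t u z)) \<le>
    (\<integral>\<^sup>+z. ennreal (norm (m' (z + (pi / \<bar>t\<bar>, 0)) - m' z)) \<partial>lborel)"
proof -
  define d where "d = pi / \<bar>t\<bar>"
  let ?I = "LINT z|lborel. m' z * osc t u z"
  have intI: "integrable lborel (\<lambda>z. m' z * osc t u z)"
    using int by (rule Bochner_Integration.integrable_bound) (auto simp: norm_mult)
  have s: "osc t u ((d, 0) + z) = - osc t u z" for z
  proof -
    have "exp (\<i> * complex_of_real (t * d)) = -1"
      using t by (cases "t > 0") (auto simp: d_def exp_minus)
    moreover have "osc t u ((d, 0) + z) = exp (\<i> * complex_of_real (t * d)) * osc t u z"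
      unfolding osc_def by (simp add: algebra_simps flip: exp_add)
    ultimately show ?thesis by simp
  qed
  have intS: "integrable lborel (\<lambda>z. m' ((d, 0) + z) * osc t u ((d, 0) + z))"
  proof -
    have "integrable (distr lborel borel ((+) (d, 0))) (\<lambda>z. m' z * osc t u z)"
      by (subst lborel_distr_plus) (rule intI)
    from integrable_distr[OF _ this] show ?thesis by simp
  qed
  have "?I = (LINT z|distr lborel borel ((+) (d, 0)). m' z * osc t u z)"
    by (subst lborel_distr_plus) simp
  also have "\<dots> = (LINT z|lborel. m' ((d, 0) + z) * osc t u ((d, 0) + z))"
    by (rule integral_distr) measurable
  finally have I2: "?I = (LINT z|lborel. m' ((d, 0) + z) * osc t u ((d, 0) + z))" .
  have "2 * ?I = (LINT z|lborel. m' ((d, 0) + z) * osc t u ((d, 0) + z) + m' z * osc t u z)"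
    using intS intI I2 by (subst Bochner_Integration.integral_add) auto
  then have "ennreal (norm (2 * ?I)) \<le>
      (\<integral>\<^sup>+z. ennreal (norm (m' ((d, 0) + z) * osc t u ((d, 0) + z) + m' z * osc t u z)) \<partial>lborel)"
    using integral_norm_bound_ennreal[OF Bochner_Integration.integrable_add[OF intS intI]] by simp
  also have "\<dots> = (\<integral>\<^sup>+z. ennreal (norm (m' (z + (d, 0)) - m' z)) \<partial>lborel)"
  proof (intro nn_integral_cong arg_cong[where f = ennreal])
    fix z
    have "m' ((d, 0) + z) * osc t u ((d, 0) + z) + m' z * osc t u z = - ((m' (z + (d, 0)) - m' z) * osc t u z)"
      by (subst s) (simp add: algebra_simps add.commute[of "(d, 0)" z])
    then show "norm (m' ((d, 0) + z) * osc t u ((d, 0) + z) + m' z * osc t u z) = norm (m' (z + (d, 0)) - m' z)"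
      by (simp add: norm_mult)
  qed
  finally show ?thesis by (simp add: d_def norm_mult)
qed

text \<open>The shift \<pi>/|t| is below \<delta> exactly for |t| > \<pi>/\<delta>, which is the
  threshold R, and \<delta> \<le> 1/2 makes it at least 2 \<pi>. The factor 2 gained from the sign
  change is dropped.\<close>

lemma osc_integral_decay:
  assumes p: "1 < p" and S: "compact S" and L: "\<And>z. z \<in> S \<Longrightarrow> line_monotone_at p m z"
    and m' [measurable]: "m' \<in> borel_measurable borel" and mm': "AE z in lborel. m' z = m z"
    and out: "\<And>z. z \<notin> S \<Longrightarrow> m' z = 0" and int: "integrable lborel m'"
  obtains R K where "2 * pi \<le> R" "0 \<le> K"
    "\<And>t u. R < \<bar>t\<bar> \<Longrightarrow> norm (LINT z|lborel. m' z * osc t u z) \<le> K * rate p (pi / \<bar>t\<bar>)"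
proof -
  obtain \<delta> K where \<delta>: "0 < \<delta>" "\<delta> \<le> 1/2" and K: "0 \<le> K" and
    est: "\<And>d. 0 < d \<Longrightarrow> d < \<delta> \<Longrightarrow>
      (\<integral>\<^sup>+z. ennreal (norm (m' (z + (d, 0)) - m' z)) \<partial>lborel) \<le> ennreal (K * rate p d)"
    by (rule shift_estimate[OF p S L m' mm' out]) blast+
  show ?thesis
  proof (rule that[OF _ K])
    show "2 * pi \<le> pi / \<delta>" using \<delta> by (simp add: field_simps)
    fix t u assume t: "pi / \<delta> < \<bar>t\<bar>"
    have "0 < pi / \<delta>" using \<delta> by simp
    then have t0: "t \<noteq> 0" using t by linarith
    have d: "0 < pi / \<bar>t\<bar>" "pi / \<bar>t\<bar> < \<delta>" using t t0 \<delta> by (auto simp: field_simps)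
    have "0 < rate p (pi / \<bar>t\<bar>)" using d \<delta>(2) by (intro rate_pos) linarith+
    then have "0 \<le> K * rate p (pi / \<bar>t\<bar>)" using K by simp
    moreover have "ennreal (2 * norm (LINT z|lborel. m' z * osc t u z)) \<le> ennreal (K * rate p (pi / \<bar>t\<bar>))"
      using norm_osc_integral_le_shift[OF m' int t0, of u] est[OF d] by (rule order_trans)
    ultimately have "2 * norm (LINT z|lborel. m' z * osc t u z) \<le> K * rate p (pi / \<bar>t\<bar>)"
      by (simp add: ennreal_le_iff)
    then show "norm (LINT z|lborel. m' z * osc t u z) \<le> K * rate p (pi / \<bar>t\<bar>)"
      using norm_ge_zero[of "LINT z|lborel. m' z * osc t u z"] by linarith
  qed
qed

lemma osc_integral_swap:
  assumes [measurable]: "m' \<in> borel_measurable borel"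
  shows "(LINT z|lborel. (m' \<circ> prod.swap) z * osc u t z) = (LINT z|lborel. m' z * osc t u z)"
proof -
  have "(LINT z|lborel. m' z * osc t u z) = (LINT z|distr lborel lborel prod.swap. m' z * osc t u z)"
    by (simp only: distr_lborel_swap)
  also have "\<dots> = (LINT z|lborel. m' (prod.swap z) * osc t u (prod.swap z))"
    by (rule integral_distr) measurable
  finally show ?thesis by (simp add: osc_def add.commute)
qed

text \<open>R stands for max(|t|, |u|) and N for the norm of (t, u). From 2 + N \<le> 4 R one gets
  \<pi>/R \<le> 4 \<pi>/(2 + N), and R \<le> N bounds the logarithm. The constant 1 / ln 2 + 1
  arises because the summand 1 in the rate is at most ln(2 + N) / ln 2.\<close>

lemma rate_le_decay:
  assumes p: "1 < p" and R: "2 * pi \<le> R" and N: "2 + N \<le> 4 * R" "R \<le> N"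
  shows "p = ennreal r \<Longrightarrow> 1 < r \<Longrightarrow> rate p (pi / R) \<le> (4 * pi) powr (1 - 1 / r) * (2 + N) powr (- (1 - 1 / r))"
    and "p = \<infinity> \<Longrightarrow> rate p (pi / R) \<le> (4 * pi * (1 / ln 2 + 1)) * ((2 + N) powr (- 1) * ln (2 + N))"
proof -
  have Rpos: "R > 0" "N > 0" using R N pi_gt_zero by linarith+
  have le: "pi / R \<le> 4 * pi / (2 + N)"
  proof -
    have "pi * (2 + N) \<le> pi * (4 * R)" using N(1) by (intro mult_left_mono) auto
    then show ?thesis using Rpos by (simp add: field_simps)
  qed
  show "rate p (pi / R) \<le> (4 * pi) powr (1 - 1 / r) * (2 + N) powr (- (1 - 1 / r))" if "p = ennreal r" "1 < r"
  proof -
    have "rate p (pi / R) = (pi / R) powr (1 - 1 / r)" using that by (simp add: rate_def)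
    also have "\<dots> \<le> (4 * pi / (2 + N)) powr (1 - 1 / r)"
      using that Rpos le by (intro powr_mono2) auto
    also have "\<dots> = (4 * pi) powr (1 - 1 / r) * (2 + N) powr (- (1 - 1 / r))"
      unfolding powr_minus using Rpos by (subst powr_divide) (simp_all add: divide_inverse)
    finally show ?thesis .
  qed
  show "rate p (pi / R) \<le> (4 * pi * (1 / ln 2 + 1)) * ((2 + N) powr (- 1) * ln (2 + N))" if "p = \<infinity>"
  proof -
    have "1 / (pi / R) = R / pi" by simp
    also have "R / pi \<le> R / 1" using Rpos pi_ge_two by (intro divide_left_mono) auto
    also have "\<dots> \<le> 2 + N" using N by simp
    finally have l: "ln (1 / (pi / R)) \<le> ln (2 + N)" using Rpos by (subst ln_le_cancel_iff) auto
    have l2: "ln 2 \<le> ln (2 + N)" using Rpos by simp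
    then have "1 \<le> ln (2 + N) / ln 2" by simp
    moreover have "(1 / ln 2 + 1) * ln (2 + N) = ln (2 + N) / ln 2 + ln (2 + N)" by (simp add: algebra_simps)
    ultimately have "1 + ln (1 / (pi / R)) \<le> (1 / ln 2 + 1) * ln (2 + N)" using l by linarith
    moreover have "0 \<le> 1 + ln (1 / (pi / R))"
    proof -
      have "pi \<le> R" using R pi_gt_zero by linarith
      then have "1 \<le> 1 / (pi / R)" by (simp add: le_divide_eq)
      from ln_ge_zero[OF this] show ?thesis by linarith
    qed
    ultimately have "(pi / R) * (1 + ln (1 / (pi / R))) \<le> (4 * pi / (2 + N)) * ((1 / ln 2 + 1) * ln (2 + N))"
      using le Rpos by (intro mult_mono) auto
    moreover have "(4 * pi / (2 + N)) * (c * L) = (4 * pi * c) * ((2 + N) powr (- 1) * L)" for c L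
      using Rpos by (simp add: powr_minus divide_inverse mult_ac)
    ultimately show ?thesis unfolding rate_def using that by simp
  qed
qed

lemma multiplier_kernel_borel_version:
  fixes m m' :: "real \<times> real \<Rightarrow> complex"
  assumes [measurable]: "m' \<in> borel_measurable borel" and ae: "AE z in lborel. m' z = m z"
    and [measurable]: "m \<in> borel_measurable lebesgue"
  shows "multiplier_kernel m t u = (LINT z|lborel. m' z * osc t u z)"
proof -
  have [measurable]: "m' \<in> borel_measurable lebesgue" "osc t u \<in> borel_measurable lebesgue"
    by (auto intro!: measurable_completion)
  have "multiplier_kernel m t u = (LINT z|lebesgue. m z * osc t u z)"
    by (simp add: multiplier_kernel_def osc_def)
  also have "\<dots> = (LINT z|lebesgue. m' z * osc t u z)"
    by (intro integral_cong_AE) (use AE_completion[OF ae] in auto)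
  also have "\<dots> = (LINT z|lborel. m' z * osc t u z)"
    by (rule integral_completion) measurable
  finally show ?thesis .
qed

text \<open>Multiplying by \<open>osc (- t) (- u)\<close> recovers m, so the integrand is not
  integrable either, and its Bochner integral takes the default value 0. Hence m may be assumed
  integrable, and in particular measurable, in the estimates.\<close>

lemma multiplier_kernel_not_integrable:
  assumes "\<not> integrable lebesgue m"
  shows "multiplier_kernel m t u = 0"
proof -
  have [measurable]: "osc t u \<in> borel_measurable lebesgue" "osc (- t) (- u) \<in> borel_measurable lebesgue"
    by (auto intro!: measurable_completion)
  have "\<not> integrable lebesgue (\<lambda>z. m z * osc t u z)"
  proof
    assume i: "integrable lebesgue (\<lambda>z. m z * osc t u z)"
    have "osc t u z * osc (- t) (- u) z = 1" for z by (simp add: osc_def flip: exp_add)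
    then have eq: "m = (\<lambda>z. (m z * osc t u z) * osc (- t) (- u) z)" by (simp add: mult.assoc)
    have "integrable lebesgue (\<lambda>z. (m z * osc t u z) * osc (- t) (- u) z)"
      by (rule Bochner_Integration.integrable_bound[OF i])
        (use borel_measurable_integrable[OF i] in \<open>auto simp: norm_mult intro!: borel_measurable_times\<close>)
    then show False using assms eq by simp
  qed
  then have "(LINT z|lebesgue. m z * osc t u z) = 0" by (rule not_integrable_integral_eq)
  then show ?thesis by (simp add: multiplier_kernel_def osc_def)
qed

text \<open>The indicator of S makes the version vanish everywhere off S and not just almost
  everywhere, as the pointwise covering argument requires.\<close>

lemma complex_lebesgue_borel_version:
  fixes m :: "real \<times> real \<Rightarrow> complex"
  assumes m [measurable]: "m \<in> borel_measurable lebesgue" and S: "closed S" "\<And>z. z \<notin> S \<Longrightarrow> m z = 0"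
  obtains m' where "m' \<in> borel_measurable borel" "AE z in lborel. m' z = m z" "\<And>z. z \<notin> S \<Longrightarrow> m' z = 0"
proof -
  obtain a where a: "a \<in> borel_measurable lborel" "AE z in lborel. Re (m z) = a z"
    using completion_ex_borel_measurable_real[of "\<lambda>z. Re (m z)" lborel] by auto
  obtain b where b: "b \<in> borel_measurable lborel" "AE z in lborel. Im (m z) = b z"
    using completion_ex_borel_measurable_real[of "\<lambda>z. Im (m z)" lborel] by auto
  have [measurable]: "a \<in> borel_measurable borel" "b \<in> borel_measurable borel" "S \<in> sets borel"
    using a b S by auto
  let ?m = "\<lambda>z. indicator S z * (complex_of_real (a z) + \<i> * complex_of_real (b z))"
  show ?thesis
  proof (rule that)
    show "?m \<in> borel_measurable borel" by measurable
    show "AE z in lborel. ?m z = m z"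
      using a(2) b(2) by eventually_elim (use S(2) in \<open>auto simp: indicator_def complex_eq_iff\<close>)
  qed simp
qed

text \<open>The larger of |t| and |u| determines the direction of the shift; the case of u is that
  of t for the reflected multiplier. For integrable m the bound \<open>J\<close> is its L^1
  norm.\<close>

lemma multiplier_kernel_decay:
  assumes p: "1 < p" and S: "compact S"
    and L: "\<And>z. z \<in> S \<Longrightarrow> line_monotone_at p m z \<and> line_monotone_at p (m \<circ> prod.swap) (prod.swap z)"
    and out: "\<And>z. z \<notin> S \<Longrightarrow> m z = 0"
  obtains R K J where "2 * pi \<le> R" "0 \<le> K" "0 \<le> J" "\<And>t u. norm (multiplier_kernel m t u) \<le> J"
    "\<And>t u. R < max \<bar>t\<bar> \<bar>u\<bar> \<Longrightarrow> norm (multiplier_kernel m t u) \<le> K * rate p (pi / max \<bar>t\<bar> \<bar>u\<bar>)"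
proof (cases "integrable lebesgue m")
  case False
  show ?thesis
    by (rule that[of "2 * pi" 0 0]) (simp_all add: multiplier_kernel_not_integrable[OF False])
next
  case True
  then have m [measurable]: "m \<in> borel_measurable lebesgue" by simp
  obtain m' where m' [measurable]: "m' \<in> borel_measurable borel" and ae: "AE z in lborel. m' z = m z"
    and out': "\<And>z. z \<notin> S \<Longrightarrow> m' z = 0"
    by (rule complex_lebesgue_borel_version[OF m compact_imp_closed[OF S] out]) blast+
  have k: "multiplier_kernel m t u = (LINT z|lborel. m' z * osc t u z)" for t u
    by (rule multiplier_kernel_borel_version[OF m' ae m])
  have int: "integrable lborel m'"
  proof -
    have "integrable lebesgue m'"
      by (rule integrable_cong_AE_imp[OF True]) (use AE_completion[OF ae] in \<open>auto intro!: measurable_completion\<close>)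
    then show ?thesis by (simp add: integrable_completion)
  qed
  let ?s = "prod.swap :: real \<times> real \<Rightarrow> real \<times> real"
  have m's: "m' \<circ> ?s \<in> borel_measurable borel" by measurable
  have ints: "integrable lborel (m' \<circ> ?s)"
  proof -
    have "integrable (distr lborel lborel ?s) m'" by (simp only: distr_lborel_swap int)
    from integrable_distr[OF _ this] show ?thesis by (simp add: o_def)
  qed
  obtain R1 K1 where 1: "2 * pi \<le> R1" "0 \<le> K1"
    "\<And>t u. R1 < \<bar>t\<bar> \<Longrightarrow> norm (LINT z|lborel. m' z * osc t u z) \<le> K1 * rate p (pi / \<bar>t\<bar>)"
    by (rule osc_integral_decay[OF p S _ m' ae out' int]) (use L in blast)+
  obtain R2 K2 where 2: "2 * pi \<le> R2" "0 \<le> K2"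
    "\<And>t u. R2 < \<bar>t\<bar> \<Longrightarrow> norm (LINT z|lborel. (m' \<circ> ?s) z * osc t u z) \<le> K2 * rate p (pi / \<bar>t\<bar>)"
  proof (rule osc_integral_decay[OF p _ _ m's _ _ ints])
    show "compact (?s ` S)" by (rule compact_continuous_image[OF continuous_on_swap S])
    show "line_monotone_at p (m \<circ> ?s) z" if "z \<in> ?s ` S" for z using that L by auto
    show "AE z in lborel. (m' \<circ> ?s) z = (m \<circ> ?s) z" using AE_lborel_swap[OF ae] by simp
    show "(m' \<circ> ?s) z = 0" if "z \<notin> ?s ` S" for z using that out'[of "?s z"] by (simp add: mem_swap_image_iff)
  qed blast
  define R where "R = max R1 R2"
  define K where "K = K1 + K2"
  define J where "J = (LINT z|lborel. norm (m' z))"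
  show ?thesis
  proof (rule that[of R K J])
    show "2 * pi \<le> R" "0 \<le> K" "0 \<le> J" using 1 2 by (auto simp: R_def K_def J_def)
    fix t u :: real
    have "norm (LINT z|lborel. m' z * osc t u z) \<le> (LINT z|lborel. norm (m' z * osc t u z))"
      by (rule integral_norm_bound)
    then show "norm (multiplier_kernel m t u) \<le> J" by (simp add: k J_def norm_mult)
    assume tu: "R < max \<bar>t\<bar> \<bar>u\<bar>"
    define T where "T = max \<bar>t\<bar> \<bar>u\<bar>"
    have T: "2 * pi < T" using tu 1 by (simp add: T_def R_def)
    have rp: "0 < rate p (pi / T)"
    proof (rule rate_pos)
      have "T > 0" using T pi_gt_zero by linarith
      then show "0 < pi / T" "pi / T \<le> 1/2" using T by (simp_all add: field_simps)
    qed
    \<comment> \<open>Either alternative suffices, because K = K1 + K2 dominates both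
      constants.\<close>
    have "norm (multiplier_kernel m t u) \<le> K1 * rate p (pi / T) \<or> norm (multiplier_kernel m t u) \<le> K2 * rate p (pi / T)"
    proof (cases "\<bar>u\<bar> \<le> \<bar>t\<bar>")
      case True
      then have "T = \<bar>t\<bar>" by (simp add: T_def)
      then show ?thesis using 1(3)[of t u] tu by (simp add: k R_def T_def[symmetric])
    next
      case False
      then have "T = \<bar>u\<bar>" by (simp add: T_def)
      then show ?thesis using 2(3)[of u t] tu by (simp add: k R_def T_def[symmetric] osc_integral_swap del: o_apply)
    qed
    moreover have "K1 * rate p (pi / T) \<le> K * rate p (pi / T)" "K2 * rate p (pi / T) \<le> K * rate p (pi / T)"
      using rp 1 2 by (auto simp: K_def intro!: mult_right_mono)
    ultimately show "norm (multiplier_kernel m t u) \<le> K * rate p (pi / max \<bar>t\<bar> \<bar>u\<bar>)"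
      unfolding T_def[symmetric] by linarith
  qed
qed

lemma conjugate_exponent:
  fixes p p' :: ennreal
  assumes "1 < p" "p \<noteq> \<infinity>" "1 / p + 1 / p' = 1"
  obtains r where "p = ennreal r" "1 < r" "1 / enn2real p' = 1 - 1 / r"
proof -
  obtain r where r: "p = ennreal r" "0 \<le> r" using assms(2) by (cases p) auto
  then have r1: "1 < r" using assms(1) by (metis ennreal_1 ennreal_less_iff zero_le_one)
  have ip: "1 / p = ennreal (1 / r)" using r r1 by (simp add: divide_ennreal flip: ennreal_1)
  have "1 / p' = 1 - 1 / p"
    using assms(3) by (metis ennreal_add_diff_cancel_left ennreal_one_neq_top ip ennreal_neq_top)
  also have "\<dots> = ennreal (1 - 1 / r)" using r1 unfolding ip by (simp add: ennreal_minus flip: ennreal_1)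
  finally have "1 / p' = ennreal (1 - 1 / r)" .
  then have "enn2real (1 / p') = 1 - 1 / r" using r1 by simp
  \<comment> \<open>True for every p': at 0 and at \<infinity> both sides are 0, since
    \<open>enn2real\<close> sends \<infinity> to 0 and real division by 0 gives 0.\<close>
  moreover have "enn2real (1 / p') = 1 / enn2real p'"
  proof (cases p')
    case (real s)
    then show ?thesis
      by (cases "s = 0") (simp_all add: divide_ennreal_def inverse_ennreal inverse_eq_divide)
  next
    case top
    then show ?thesis by (simp add: divide_ennreal_def)
  qed
  ultimately show ?thesis using that r r1 by simp
qed

theorem theorem1p7:
  fixes m :: "real \<times> real \<Rightarrow> complex"
    and \<alpha> :: "real \<times> real \<Rightarrow> real \<times> real \<Rightarrow> complex"
    and n :: "real \<times> real \<Rightarrow> nat"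
    and f :: "real \<times> real \<Rightarrow> nat \<Rightarrow> real \<times> real \<Rightarrow> real"
    and \<gamma> :: "real \<times> real \<Rightarrow> nat \<Rightarrow> real"
    and E :: "real \<times> real \<Rightarrow> (real \<times> real) set"
    and p p' :: ennreal
  assumes "multiplier m \<alpha> n f \<gamma> E"
    and "1 < p"
    and "\<forall>z\<in>supp m. \<exists>N. open N \<and> 0 \<in> N \<and> in_Lp p N (assoc_g (n z) (f z) (\<gamma> z) (E z))"
    and "1 / p + 1 / p' = 1"
  shows "\<exists>C. \<forall>t u.
      (p < \<infinity> \<longrightarrow> norm (multiplier_kernel m t u) \<le> C * (2 + norm (t, u)) powr (- (1 / enn2real p'))) \<and>
      (p = \<infinity> \<longrightarrow> norm (multiplier_kernel m t u) \<le> C * (2 + norm (t, u)) powr (- 1) * ln (2 + norm (t, u)))"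
proof -
  have S: "compact (supp m)" using assms(1) by (simp add: multiplier_def)
  have L: "line_monotone_at p m z \<and> line_monotone_at p (m \<circ> prod.swap) (prod.swap z)" if z: "z \<in> supp m" for z
  proof -
    obtain N where N: "open N" "0 \<in> N" "in_Lp p N (assoc_g (n z) (f z) (\<gamma> z) (E z))"
      using assms(3) z by blast
    have "local_data (n z) (f z) (\<gamma> z) (E z)" "local_form m z (\<alpha> z) (n z) (f z) (\<gamma> z) (E z)"
      using assms(1) z by (auto simp: multiplier_def)
    from local_form_line_monotone_at[OF this N] show ?thesis by blast
  qed
  have out: "m z = 0" if "z \<notin> supp m" for z
    using that closure_subset[of "{z. m z \<noteq> 0}"] by (auto simp: supp_def)
  obtain R K J where R: "2 * pi \<le> R" and K: "0 \<le> K" and J: "0 \<le> J"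
    and bd: "\<And>t u. norm (multiplier_kernel m t u) \<le> J"
    and dec: "\<And>t u. R < max \<bar>t\<bar> \<bar>u\<bar> \<Longrightarrow> norm (multiplier_kernel m t u) \<le> K * rate p (pi / max \<bar>t\<bar> \<bar>u\<bar>)"
    by (rule multiplier_kernel_decay[OF assms(2) S L out]) blast+
  have R1: "1 \<le> R" using R pi_ge_two by linarith
  \<comment> \<open>Both forms of decay F fit one scheme. For max(|t|, |u|) > R the rate is compared
    with c' F; otherwise the norm is at most 2 R, where F \<ge> c, and the trivial bound J is at
    most (J / c) F.\<close>
  have bound: "\<exists>C. \<forall>t u. norm (multiplier_kernel m t u) \<le> C * F (norm (t, u))"
    if c: "0 < c" "\<And>N. 0 \<le> N \<Longrightarrow> N \<le> 2 * R \<Longrightarrow> c \<le> F N"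
      and c': "0 \<le> c'" "\<And>N. 0 \<le> N \<Longrightarrow> 0 \<le> F N"
        "\<And>T N. 2 * pi \<le> T \<Longrightarrow> 2 + N \<le> 4 * T \<Longrightarrow> T \<le> N \<Longrightarrow> rate p (pi / T) \<le> c' * F N"
    for F :: "real \<Rightarrow> real" and c c'
  proof (intro exI allI)
    fix t u :: real
    define T N where "T = max \<bar>t\<bar> \<bar>u\<bar>" and "N = norm (t, u)"
    have TN: "T \<le> N" "N \<le> 2 * T" "0 \<le> N"
      using norm_fst_le[of t u] norm_snd_le[of u t] norm_Pair_le[of t u] by (auto simp: T_def N_def)
    have F: "0 \<le> F N" by (rule c'(2)[OF TN(3)])
    have "norm (multiplier_kernel m t u) \<le> K * c' * F N \<or> norm (multiplier_kernel m t u) \<le> J / c * F N"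
    proof (cases "R < T")
      case True
      then have "norm (multiplier_kernel m t u) \<le> K * rate p (pi / T)" using dec by (simp add: T_def)
      also have "\<dots> \<le> K * (c' * F N)"
        using True R R1 TN by (intro mult_left_mono[OF _ K] c'(3)) linarith+
      finally show ?thesis by (simp add: mult.assoc)
    next
      case False
      have "norm (multiplier_kernel m t u) \<le> J / c * c" using bd c(1) by simp
      also have "\<dots> \<le> J / c * F N"
        using False TN J c by (intro mult_left_mono c(2)) auto
      finally show ?thesis by blast
    qed
    moreover have "0 \<le> K * c' * F N" "0 \<le> J / c * F N" using K J c(1) c'(1) F by simp_all
    ultimately show "norm (multiplier_kernel m t u) \<le> (K * c' + J / c) * F (norm (t, u))"
      unfolding N_def[symmetric] distrib_right by linarith
  qed
  show ?thesis
  proof (cases "p = \<infinity>")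
    case True
    have "\<exists>C. \<forall>t u. norm (multiplier_kernel m t u) \<le> C * ((2 + norm (t, u)) powr (- 1) * ln (2 + norm (t, u)))"
    \<comment> \<open>The lower bound c takes the decreasing power at N = 2 R and the increasing
      logarithm at N = 0.\<close>
    proof (rule bound[where c = "(2 + 2 * R) powr (- 1) * ln 2" and c' = "4 * pi * (1 / ln 2 + 1)"])
      fix N :: real assume "0 \<le> N" "N \<le> 2 * R"
      then show "(2 + 2 * R) powr (- 1) * ln 2 \<le> (2 + N) powr (- 1) * ln (2 + N)"
        by (intro mult_mono powr_mono2') auto
    next
      fix T N :: real assume "2 * pi \<le> T" "2 + N \<le> 4 * T" "T \<le> N"
      then show "rate p (pi / T) \<le> 4 * pi * (1 / ln 2 + 1) * ((2 + N) powr (- 1) * ln (2 + N))"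
        by (rule rate_le_decay(2)[OF assms(2) _ _ _ True])
    qed (use R1 in auto)
    then show ?thesis using True by (simp add: mult.assoc)
  next
    case False
    obtain r where r: "p = ennreal r" "1 < r" "1 / enn2real p' = 1 - 1 / r"
      by (rule conjugate_exponent[OF assms(2) False assms(4)])
    have "\<exists>C. \<forall>t u. norm (multiplier_kernel m t u) \<le> C * (2 + norm (t, u)) powr (- (1 - 1 / r))"
    proof (rule bound[where c = "(2 + 2 * R) powr (- (1 - 1 / r))" and c' = "(4 * pi) powr (1 - 1 / r)"])
      fix N :: real assume "0 \<le> N" "N \<le> 2 * R"
      then show "(2 + 2 * R) powr (- (1 - 1 / r)) \<le> (2 + N) powr (- (1 - 1 / r))"
        using r(2) by (intro powr_mono2') auto
    next
      fix T N :: real assume "2 * pi \<le> T" "2 + N \<le> 4 * T" "T \<le> N"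
      then show "rate p (pi / T) \<le> (4 * pi) powr (1 - 1 / r) * (2 + N) powr (- (1 - 1 / r))"
        by (rule rate_le_decay(1)[OF assms(2) _ _ _ r(1,2)])
    qed (use R1 in auto)
    then show ?thesis using False r(3) by simp
  qed
qed

end
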